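(* Let $\mathcal{A}$ be a weakly idempotent complete exact category, let $\mathcal{X}$ and $\mathcal{Y}$ be full additive subcategories of $\mathcal{A}$ which are closed under isomorphisms and direct summands, and let $\omega=\mathcal{X}\cap\mathcal{Y}$. Define classes of morphisms of $\mathcal{A}$ as follows. $\mathrm{CoFib}_\omega$ is the class of inflations $f$ with $\operatorname{Coker} f\in\mathcal{X}$. $\mathrm{Fib}_\omega$ is the class of morphisms $f:A\to B$ which are $\omega$-epic, i.e. $\operatorname{Hom}_{\mathcal{A}}(W,f):\operatorname{Hom}_{\mathcal{A}}(W,A)\to\operatorname{Hom}_{\mathcal{A}}(W,B)$ is surjective for every $W\in\omega$. $\mathrm{Weq}_\omega$ is the class of morphisms $f:A\to B$ for which there exist $W\in\omega$ and a morphism $t:W\to B$ such that $(f,t):A\oplus W\to B$ is a deflation with $\operatorname{Ker}(f,t)\in\mathcal{Y}$. Then $(\mathrm{CoFib}_\omega,\mathrm{Fib}_\omega,\mathrm{Weq}_\omega)$ is a model structure on $\mathcal{A}$ if and only if $(\mathcal{X},\mathcal{Y})$ is a hereditary complete cotorsion pair in $\mathcal{A}$ and $\omega$ is contravariantly finite in $\mathcal{A}$. If this is the case, then: the class of trivial cofibrations is precisely the class of splitting monomorphisms with cokernel in $\omega$; the class of trivial fibrations is precisely the class of deflations with kernel in $\mathcal{Y}$; the class of cofibrant objects is $\mathcal{X}$, the class of fibrant objects is $\mathcal{A}$ (all objects), and the class of trivial objects is $\mathcal{Y}$; and the homotopy category of this model structure is (equivalent to) the additive quotient $\mathcal{X}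/\omega$.
   Context: Exact categories are in the sense of Quillen: an additive category with a distinguished class of kernel-cokernel pairs $X\xrightarrow{i}Y\xrightarrow{d}Z$ (conflations) satisfying the usual axioms; $i$ is called an inflation, $d$ a deflation, and $0\to X\to Y\to Z\to 0$ an admissible exact sequence. $\mathcal{A}$ is weakly idempotent complete if every splitting epimorphism is a deflation (equivalently, every splitting monomorphism is an inflation). $\operatorname{Ext}^1_{\mathcal{A}}$ is the Yoneda Ext of the exact structure. For a class $\mathcal{C}$ of objects put ${}^\perp\mathcal{C}=\{X\mid \operatorname{Ext}^1_{\mathcal{A}}(X,C)=0\ \forall C\in\mathcal{C}\}$ and $\mathcal{C}^\perp=\{Y\mid\operatorname{Ext}^1_{\mathcal{A}}(C,Y)=0\ \forall C\in\mathcal{C}\}$. A cotorsion pair is a pair $(\mathcal{C},\mathcal{F})$ of classes of objects with $\mathcal{C}={}^\perp\mathcal{F}$ and $\mathcal{F}=\mathcal{C}^\perp$. It is complete if for every object $X$ there are admissible exact sequences $0\to F\to C\to X\to 0$ and $0\to X\to F'\to C'\to 0$ with $C,C'\in\mathcal{C}$ and $F,F'\in\mathcal{F}$. It is hereditary if $\mathcal{C}$ is closed under kernels of deflations and $\mathcal{F}$ is closed under cokernels of inflations. A full subcategory $\omega$ is contravariantly finite in $\mathcal{A}$ if every object $B$ has a right $\omega$-approximation, i.e. a morphism $t:W\to B$ with $W\in\omega$ through which every morphism $W'\to B$ with $W'\in\omega$ factors. A model structure on a category is a triple $(\mathrm{CoFib},\mathrm{Fib},\mathrm{Weq})$ of classes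 of morphisms (cofibrations, fibrations, weak equivalences) satisfying: (two out of three) if two of $f,g,gf$ are weak equivalences so is the third; (retract) each of the three classes is closed under retracts; (lifting) cofibrations have the left lifting property with respect to $\mathrm{Fib}\cap\mathrm{Weq}$, and fibrations have the right lifting property with respect to $\mathrm{CoFib}\cap\mathrm{Weq}$; (factorization) every morphism $f$ factors as $f=pi$ with $i\in\mathrm{CoFib}\cap\mathrm{Weq}$, $p\in\mathrm{Fib}$, and as $f=qj$ with $j\in\mathrm{CoFib}$, $q\in\mathrm{Fib}\cap\mathrm{Weq}$. No existence of limits or colimits is required, and factorizations need not be functorial. Trivial cofibrations are the morphisms in $\mathrm{CoFib}\cap\mathrm{Weq}$; trivial fibrations are the morphisms in $\mathrm{Fib}\cap\mathrm{Weq}$. An object $X$ is cofibrant if $0\to X$ is a cofibration, fibrant if $X\to 0$ is a fibration, trivial if $0\to X$ (equivalently $X\to 0$) is a weak equivalence. The homotopy category is the localization $\mathcal{A}[\mathrm{Weq}^{-1}]$. The additive quotient $\mathcal{X}/\omega$ has the same objects as $\mathcal{X}$, and its morphism groups are $\operatorname{Hom}_{\mathcal{X}}(X,Y)$ modulo the subgroup of morphisms factoring through an object of $\omega$. *)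

theory Defs
  imports "HOL-Algebra.Coset"
begin

section \<open>Categories, functors, equivalences\<close>

record ('o, 'm) cat =
  Obj :: "'o set"
  Arr :: "'m set"
  Dom :: "'m \<Rightarrow> 'o"
  Cod :: "'m \<Rightarrow> 'o"
  Ident :: "'o \<Rightarrow> 'm"
  Comp :: "'m \<Rightarrow> 'm \<Rightarrow> 'm" (infixr "\<cdot>\<index>" 75)

text \<open>Composition is written in the usual order: \<open>g \<cdot> f\<close> is \<open>g\<close> after \<open>f\<close>.\<close>

definition Hom :: "('o, 'm, 'z) cat_scheme \<Rightarrow> 'o \<Rightarrow> 'o \<Rightarrow> 'm set" where
  "Hom C A B = {f \<in> Arr C. Dom C f = A \<and> Cod C f = B}"

locale category =
  fixes C :: "('o, 'm, 'z) cat_scheme" (structure)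
  assumes Dom_Obj: "f \<in> Arr C \<Longrightarrow> Dom C f \<in> Obj C"
    and Cod_Obj: "f \<in> Arr C \<Longrightarrow> Cod C f \<in> Obj C"
    and Ident_Hom: "A \<in> Obj C \<Longrightarrow> Ident C A \<in> Hom C A A"
    and Comp_Hom: "\<lbrakk>f \<in> Hom C A B; g \<in> Hom C B D\<rbrakk> \<Longrightarrow> g \<cdot> f \<in> Hom C A D"
    and Comp_assoc: "\<lbrakk>f \<in> Hom C A B; g \<in> Hom C B D; h \<in> Hom C D E\<rbrakk>
      \<Longrightarrow> (h \<cdot> g) \<cdot> f = h \<cdot> (g \<cdot> f)"
    and Comp_Ident_right: "f \<in> Hom C A B \<Longrightarrow> f \<cdot> Ident C A = f"
    and Comp_Ident_left: "f \<in> Hom C A B \<Longrightarrow> Ident C B \<cdot> f = f"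

definition is_iso :: "('o, 'm, 'z) cat_scheme \<Rightarrow> 'm \<Rightarrow> bool" where
  "is_iso C f \<longleftrightarrow> f \<in> Arr C \<and>
    (\<exists>g \<in> Hom C (Cod C f) (Dom C f).
      g \<cdot>\<^bsub>C\<^esub> f = Ident C (Dom C f) \<and> f \<cdot>\<^bsub>C\<^esub> g = Ident C (Cod C f))"

definition split_mono :: "('o, 'm, 'z) cat_scheme \<Rightarrow> 'm \<Rightarrow> bool" where
  "split_mono C f \<longleftrightarrow> f \<in> Arr C \<and>
    (\<exists>r \<in> Hom C (Cod C f) (Dom C f). r \<cdot>\<^bsub>C\<^esub> f = Ident C (Dom C f))"

definition split_epi :: "('o, 'm, 'z) cat_scheme \<Rightarrow> 'm \<Rightarrow> bool" where
  "split_epi C f \<longleftrightarrow> f \<in> Arr C \<and>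
    (\<exists>s \<in> Hom C (Cod C f) (Dom C f). f \<cdot>\<^bsub>C\<^esub> s = Ident C (Cod C f))"

definition isomorphic :: "('o, 'm, 'z) cat_scheme \<Rightarrow> 'o \<Rightarrow> 'o \<Rightarrow> bool" where
  "isomorphic C A B \<longleftrightarrow> (\<exists>f \<in> Hom C A B. is_iso C f)"

text \<open>\<open>f' \<cdot> i = i' \<cdot> f\<close> is a pushout square for the span \<open>(i, f)\<close>:
  \<open>i : A \<rightarrow> B\<close>, \<open>f : A \<rightarrow> A'\<close>, \<open>i' : A' \<rightarrow> B'\<close>, \<open>f' : B \<rightarrow> B'\<close>.\<close>

definition is_pushout :: "('o, 'm, 'z) cat_scheme \<Rightarrow> 'm \<Rightarrow> 'm \<Rightarrow> 'm \<Rightarrow> 'm \<Rightarrow> bool" where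
  "is_pushout C i f i' f' \<longleftrightarrow>
    i \<in> Arr C \<and> f \<in> Arr C \<and> i' \<in> Arr C \<and> f' \<in> Arr C \<and>
    Dom C i = Dom C f \<and> Dom C i' = Cod C f \<and> Dom C f' = Cod C i \<and> Cod C i' = Cod C f' \<and>
    f' \<cdot>\<^bsub>C\<^esub> i = i' \<cdot>\<^bsub>C\<^esub> f \<and>
    (\<forall>u \<in> Arr C. \<forall>v \<in> Arr C.
      Dom C u = Cod C f \<and> Dom C v = Cod C i \<and> Cod C u = Cod C v \<and>
      v \<cdot>\<^bsub>C\<^esub> i = u \<cdot>\<^bsub>C\<^esub> f \<longrightarrow>
      (\<exists>!h. h \<in> Hom C (Cod C i') (Cod C u) \<and> h \<cdot>\<^bsub>C\<^esub> i' = u \<and> h \<cdot>\<^bsub>C\<^esub> f' = v))"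

text \<open>\<open>d \<cdot> f' = f \<cdot> d'\<close> is a pullback square for the cospan \<open>(d, f)\<close>:
  \<open>d : B \<rightarrow> D\<close>, \<open>f : D' \<rightarrow> D\<close>, \<open>d' : B' \<rightarrow> D'\<close>, \<open>f' : B' \<rightarrow> B\<close>.\<close>

definition is_pullback :: "('o, 'm, 'z) cat_scheme \<Rightarrow> 'm \<Rightarrow> 'm \<Rightarrow> 'm \<Rightarrow> 'm \<Rightarrow> bool" where
  "is_pullback C d f d' f' \<longleftrightarrow>
    d \<in> Arr C \<and> f \<in> Arr C \<and> d' \<in> Arr C \<and> f' \<in> Arr C \<and>
    Cod C d = Cod C f \<and> Cod C d' = Dom C f \<and> Cod C f' = Dom C d \<and> Dom C d' = Dom C f' \<and>
    d \<cdot>\<^bsub>C\<^esub> f' = f \<cdot>\<^bsub>C\<^esub> d' \<and>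
    (\<forall>u \<in> Arr C. \<forall>v \<in> Arr C.
      Cod C u = Dom C f \<and> Cod C v = Dom C d \<and> Dom C u = Dom C v \<and>
      d \<cdot>\<^bsub>C\<^esub> v = f \<cdot>\<^bsub>C\<^esub> u \<longrightarrow>
      (\<exists>!h. h \<in> Hom C (Dom C u) (Dom C d') \<and> d' \<cdot>\<^bsub>C\<^esub> h = u \<and> f' \<cdot>\<^bsub>C\<^esub> h = v))"

definition is_functor ::
  "('o, 'm, 'z) cat_scheme \<Rightarrow> ('p, 'n, 'y) cat_scheme \<Rightarrow> ('o \<Rightarrow> 'p) \<Rightarrow> ('m \<Rightarrow> 'n) \<Rightarrow> bool" where
  "is_functor C D Fo Fa \<longleftrightarrow>
    (\<forall>A \<in> Obj C. Fo A \<in> Obj D) \<and>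
    (\<forall>A \<in> Obj C. \<forall>B \<in> Obj C. \<forall>f \<in> Hom C A B. Fa f \<in> Hom D (Fo A) (Fo B)) \<and>
    (\<forall>A \<in> Obj C. Fa (Ident C A) = Ident D (Fo A)) \<and>
    (\<forall>f \<in> Arr C. \<forall>g \<in> Arr C. Cod C f = Dom C g \<longrightarrow> Fa (g \<cdot>\<^bsub>C\<^esub> f) = Fa g \<cdot>\<^bsub>D\<^esub> Fa f)"

definition naturally_isomorphic ::
  "('o, 'm, 'z) cat_scheme \<Rightarrow> ('p, 'n, 'y) cat_scheme \<Rightarrow>
    ('o \<Rightarrow> 'p) \<Rightarrow> ('m \<Rightarrow> 'n) \<Rightarrow> ('o \<Rightarrow> 'p) \<Rightarrow> ('m \<Rightarrow> 'n) \<Rightarrow> bool" where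
  "naturally_isomorphic C D Fo Fa Go Ga \<longleftrightarrow>
    (\<exists>\<eta>. (\<forall>A \<in> Obj C. \<eta> A \<in> Hom D (Fo A) (Go A) \<and> is_iso D (\<eta> A)) \<and>
      (\<forall>f \<in> Arr C. \<eta> (Cod C f) \<cdot>\<^bsub>D\<^esub> Fa f = Ga f \<cdot>\<^bsub>D\<^esub> \<eta> (Dom C f)))"

definition equivalent_categories ::
  "('o, 'm, 'z) cat_scheme \<Rightarrow> ('p, 'n, 'y) cat_scheme \<Rightarrow> bool" where
  "equivalent_categories C D \<longleftrightarrow> category C \<and> category D \<and>
    (\<exists>Fo Fa Go Ga. is_functor C D Fo Fa \<and> is_functor D C Go Ga \<and>
      naturally_isomorphic C C (Go \<circ> Fo) (Ga \<circ> Fa) id id \<and>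
      naturally_isomorphic D D (Fo \<circ> Go) (Fa \<circ> Ga) id id)"


section \<open>Localization\<close>

text \<open>
  The localization \<open>C[W\<^sup>-\<^sup>1]\<close> in the sense of Gabriel and Zisman. Its morphisms
  \<open>A \<rightarrow> B\<close> are equivalence classes of zigzags of arrows of \<open>C\<close> from \<open>A\<close> to \<open>B\<close> in which the
  arrows traversed backwards belong to \<open>W\<close>. Zigzags are listed in the order in which they are
  traversed. The source and the target are part of a morphism, since the empty list represents
  the identity of every object.
\<close>

datatype 'm zstep = Fwd 'm | Bwd 'm

fun zsrc :: "('o, 'm, 'z) cat_scheme \<Rightarrow> 'm zstep \<Rightarrow> 'o" where
  "zsrc C (Fwd f) = Dom C f"
| "zsrc C (Bwd w) = Cod C w"

fun ztgt :: "('o, 'm, 'z) cat_scheme \<Rightarrow> 'm zstep \<Rightarrow> 'o" where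
  "ztgt C (Fwd f) = Cod C f"
| "ztgt C (Bwd w) = Dom C w"

fun zstep_ok :: "('o, 'm, 'z) cat_scheme \<Rightarrow> 'm set \<Rightarrow> 'm zstep \<Rightarrow> bool" where
  "zstep_ok C W (Fwd f) \<longleftrightarrow> f \<in> Arr C"
| "zstep_ok C W (Bwd w) \<longleftrightarrow> w \<in> Arr C \<and> w \<in> W"

fun zigzag :: "('o, 'm, 'z) cat_scheme \<Rightarrow> 'm set \<Rightarrow> 'o \<Rightarrow> 'm zstep list \<Rightarrow> 'o \<Rightarrow> bool" where
  "zigzag C W A [] B \<longleftrightarrow> A \<in> Obj C \<and> A = B"
| "zigzag C W A (s # p) B \<longleftrightarrow> zstep_ok C W s \<and> zsrc C s = A \<and> zigzag C W (ztgt C s) p B"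

inductive zz_eq ::
  "('o, 'm, 'z) cat_scheme \<Rightarrow> 'm set \<Rightarrow> 'o \<Rightarrow> 'o \<Rightarrow> 'm zstep list \<Rightarrow> 'm zstep list \<Rightarrow> bool"
  for C :: "('o, 'm, 'z) cat_scheme" and W :: "'m set" where
  zz_refl: "zigzag C W A p B \<Longrightarrow> zz_eq C W A B p p"
| zz_sym: "zz_eq C W A B p q \<Longrightarrow> zz_eq C W A B q p"
| zz_trans: "zz_eq C W A B p q \<Longrightarrow> zz_eq C W A B q r \<Longrightarrow> zz_eq C W A B p r"
| zz_append: "zz_eq C W A B p q \<Longrightarrow> zz_eq C W B D r s \<Longrightarrow> zz_eq C W A D (p @ r) (q @ s)"
| zz_ident: "A \<in> Obj C \<Longrightarrow> zz_eq C W A A [Fwd (Ident C A)] []"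
| zz_comp: "f \<in> Hom C A B \<Longrightarrow> g \<in> Hom C B D \<Longrightarrow>
    zz_eq C W A D [Fwd f, Fwd g] [Fwd (g \<cdot>\<^bsub>C\<^esub> f)]"
| zz_inv_right: "w \<in> W \<Longrightarrow> w \<in> Hom C A B \<Longrightarrow> zz_eq C W A A [Fwd w, Bwd w] []"
| zz_inv_left: "w \<in> W \<Longrightarrow> w \<in> Hom C A B \<Longrightarrow> zz_eq C W B B [Bwd w, Fwd w] []"

definition zz_class ::
  "('o, 'm, 'z) cat_scheme \<Rightarrow> 'm set \<Rightarrow> 'o \<Rightarrow> 'm zstep list \<Rightarrow> 'o \<Rightarrow>
    'o \<times> 'm zstep list set \<times> 'o" where
  "zz_class C W A p B = (A, {q. zz_eq C W A B p q}, B)"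

definition localization ::
  "('o, 'm, 'z) cat_scheme \<Rightarrow> 'm set \<Rightarrow> ('o, 'o \<times> 'm zstep list set \<times> 'o) cat" where
  "localization C W = \<lparr>
    Obj = Obj C,
    Arr = {zz_class C W A p B | A p B. zigzag C W A p B},
    Dom = (\<lambda>(A, P, B). A),
    Cod = (\<lambda>(A, P, B). B),
    Ident = (\<lambda>A. zz_class C W A [] A),
    Comp = (\<lambda>(B, Q, D) (A, P, B'). (A, {r. \<exists>p \<in> P. \<exists>q \<in> Q. zz_eq C W A D (p @ q) r}, D))\<rparr>"

definition loc_map ::
  "('o, 'm, 'z) cat_scheme \<Rightarrow> 'm set \<Rightarrow> 'm \<Rightarrow> 'o \<times> 'm zstep list set \<times> 'o" where
  "loc_map C W f = zz_class C W (Dom C f) [Fwd f] (Cod C f)"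


section \<open>Additive categories\<close>

record ('o, 'm) preadd_cat = "('o, 'm) cat" +
  Plus :: "'m \<Rightarrow> 'm \<Rightarrow> 'm"
  Zero :: "'o \<Rightarrow> 'o \<Rightarrow> 'm"

definition Hom_group :: "('o, 'm, 'z) preadd_cat_scheme \<Rightarrow> 'o \<Rightarrow> 'o \<Rightarrow> 'm monoid" where
  "Hom_group C A B = \<lparr>carrier = Hom C A B, mult = Plus C, one = Zero C A B\<rparr>"

locale preadditive_category = category C
  for C :: "('o, 'm, 'z) preadd_cat_scheme" (structure) +
  assumes Hom_comm_group: "\<lbrakk>A \<in> Obj C; B \<in> Obj C\<rbrakk> \<Longrightarrow> comm_group (Hom_group C A B)"
    and Comp_Plus_right: "\<lbrakk>f \<in> Hom C A B; f' \<in> Hom C A B; g \<in> Hom C B D\<rbrakk>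
      \<Longrightarrow> g \<cdot> Plus C f f' = Plus C (g \<cdot> f) (g \<cdot> f')"
    and Comp_Plus_left: "\<lbrakk>f \<in> Hom C A B; g \<in> Hom C B D; g' \<in> Hom C B D\<rbrakk>
      \<Longrightarrow> Plus C g g' \<cdot> f = Plus C (g \<cdot> f) (g' \<cdot> f)"

definition is_zero_obj :: "('o, 'm, 'z) cat_scheme \<Rightarrow> 'o \<Rightarrow> bool" where
  "is_zero_obj C Z \<longleftrightarrow> Z \<in> Obj C \<and>
    (\<forall>A \<in> Obj C. (\<exists>!f. f \<in> Hom C Z A) \<and> (\<exists>!f. f \<in> Hom C A Z))"

text \<open>\<open>S = A \<oplus> B\<close> with injections \<open>j\<^sub>A, j\<^sub>B\<close> and projections \<open>p\<^sub>A, p\<^sub>B\<close>.\<close>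

definition is_biproduct ::
  "('o, 'm, 'z) preadd_cat_scheme \<Rightarrow> 'o \<Rightarrow> 'o \<Rightarrow> 'o \<Rightarrow> 'm \<Rightarrow> 'm \<Rightarrow> 'm \<Rightarrow> 'm \<Rightarrow> bool" where
  "is_biproduct C S A B j\<^sub>A j\<^sub>B p\<^sub>A p\<^sub>B \<longleftrightarrow>
    S \<in> Obj C \<and> A \<in> Obj C \<and> B \<in> Obj C \<and>
    j\<^sub>A \<in> Hom C A S \<and> j\<^sub>B \<in> Hom C B S \<and> p\<^sub>A \<in> Hom C S A \<and> p\<^sub>B \<in> Hom C S B \<and>
    p\<^sub>A \<cdot>\<^bsub>C\<^esub> j\<^sub>A = Ident C A \<and> p\<^sub>B \<cdot>\<^bsub>C\<^esub> j\<^sub>B = Ident C B \<and>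
    p\<^sub>B \<cdot>\<^bsub>C\<^esub> j\<^sub>A = Zero C A B \<and> p\<^sub>A \<cdot>\<^bsub>C\<^esub> j\<^sub>B = Zero C B A \<and>
    Plus C (j\<^sub>A \<cdot>\<^bsub>C\<^esub> p\<^sub>A) (j\<^sub>B \<cdot>\<^bsub>C\<^esub> p\<^sub>B) = Ident C S"

locale additive_category = preadditive_category C
  for C :: "('o, 'm, 'z) preadd_cat_scheme" (structure) +
  assumes zero_obj_exists: "\<exists>Z. is_zero_obj C Z"
    and biproduct_exists: "\<lbrakk>A \<in> Obj C; B \<in> Obj C\<rbrakk>
      \<Longrightarrow> \<exists>S j\<^sub>A j\<^sub>B p\<^sub>A p\<^sub>B. is_biproduct C S A B j\<^sub>A j\<^sub>B p\<^sub>A p\<^sub>B"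

text \<open>A full subcategory is given by its class of objects.\<close>

definition additive_subcat :: "('o, 'm, 'z) preadd_cat_scheme \<Rightarrow> 'o set \<Rightarrow> bool" where
  "additive_subcat C \<X> \<longleftrightarrow> \<X> \<subseteq> Obj C \<and> (\<exists>Z \<in> \<X>. is_zero_obj C Z) \<and>
    (\<forall>A \<in> \<X>. \<forall>B \<in> \<X>. \<exists>S \<in> \<X>. \<exists>j\<^sub>A j\<^sub>B p\<^sub>A p\<^sub>B. is_biproduct C S A B j\<^sub>A j\<^sub>B p\<^sub>A p\<^sub>B)"

definition iso_closed :: "('o, 'm, 'z) cat_scheme \<Rightarrow> 'o set \<Rightarrow> bool" where
  "iso_closed C \<X> \<longleftrightarrow> (\<forall>A \<in> \<X>. \<forall>B \<in> Obj C. isomorphic C A B \<longrightarrow> B \<in> \<X>)"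

definition summand_closed :: "('o, 'm, 'z) preadd_cat_scheme \<Rightarrow> 'o set \<Rightarrow> bool" where
  "summand_closed C \<X> \<longleftrightarrow>
    (\<forall>S A B j\<^sub>A j\<^sub>B p\<^sub>A p\<^sub>B. S \<in> \<X> \<and> is_biproduct C S A B j\<^sub>A j\<^sub>B p\<^sub>A p\<^sub>B \<longrightarrow> A \<in> \<X>)"

definition is_kernel :: "('o, 'm, 'z) preadd_cat_scheme \<Rightarrow> 'm \<Rightarrow> 'm \<Rightarrow> bool" where
  "is_kernel C k f \<longleftrightarrow> k \<in> Arr C \<and> f \<in> Arr C \<and> Cod C k = Dom C f \<and>
    f \<cdot>\<^bsub>C\<^esub> k = Zero C (Dom C k) (Cod C f) \<and>
    (\<forall>u \<in> Arr C. Cod C u = Dom C f \<and> f \<cdot>\<^bsub>C\<^esub> u = Zero C (Dom C u) (Cod C f) \<longrightarrow>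
      (\<exists>!h. h \<in> Hom C (Dom C u) (Dom C k) \<and> k \<cdot>\<^bsub>C\<^esub> h = u))"

definition is_cokernel :: "('o, 'm, 'z) preadd_cat_scheme \<Rightarrow> 'm \<Rightarrow> 'm \<Rightarrow> bool" where
  "is_cokernel C c f \<longleftrightarrow> c \<in> Arr C \<and> f \<in> Arr C \<and> Dom C c = Cod C f \<and>
    c \<cdot>\<^bsub>C\<^esub> f = Zero C (Dom C f) (Cod C c) \<and>
    (\<forall>u \<in> Arr C. Dom C u = Cod C f \<and> u \<cdot>\<^bsub>C\<^esub> f = Zero C (Dom C f) (Cod C u) \<longrightarrow>
      (\<exists>!h. h \<in> Hom C (Cod C c) (Cod C u) \<and> h \<cdot>\<^bsub>C\<^esub> c = u))"

text \<open>Kernels and cokernels are determined up to isomorphism only; the two predicates below are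
  used for iso-closed classes \<open>\<X>\<close>, where the choice does not matter.\<close>

definition Ker_in :: "('o, 'm, 'z) preadd_cat_scheme \<Rightarrow> 'm \<Rightarrow> 'o set \<Rightarrow> bool" where
  "Ker_in C f \<X> \<longleftrightarrow> (\<exists>k. is_kernel C k f \<and> Dom C k \<in> \<X>)"

definition Coker_in :: "('o, 'm, 'z) preadd_cat_scheme \<Rightarrow> 'm \<Rightarrow> 'o set \<Rightarrow> bool" where
  "Coker_in C f \<X> \<longleftrightarrow> (\<exists>c. is_cokernel C c f \<and> Cod C c \<in> \<X>)"

definition factoring :: "('o, 'm, 'z) cat_scheme \<Rightarrow> 'o set \<Rightarrow> 'o \<Rightarrow> 'o \<Rightarrow> 'm set" where
  "factoring C \<omega> A B = {g \<cdot>\<^bsub>C\<^esub> f | f g W. W \<in> \<omega> \<and> f \<in> Hom C A W \<and> g \<in> Hom C W B}"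

definition quot_class ::
  "('o, 'm, 'z) preadd_cat_scheme \<Rightarrow> 'o set \<Rightarrow> 'm \<Rightarrow> 'm set" where
  "quot_class C \<omega> f =
    factoring C \<omega> (Dom C f) (Cod C f) #>\<^bsub>Hom_group C (Dom C f) (Cod C f)\<^esub> f"

text \<open>The additive quotient \<open>\<X>/\<omega>\<close>. A morphism is a coset, hence a nonempty set of parallel
  arrows of \<open>C\<close>, from which its source and target are read off.\<close>

definition additive_quotient ::
  "('o, 'm, 'z) preadd_cat_scheme \<Rightarrow> 'o set \<Rightarrow> 'o set \<Rightarrow> ('o, 'm set) cat" where
  "additive_quotient C \<X> \<omega> = \<lparr>
    Obj = \<X>,
    Arr = (\<Union>A \<in> \<X>. \<Union>B \<in> \<X>. carrier (Hom_group C A B Mod factoring C \<omega> A B)),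
    Dom = (\<lambda>F. Dom C (SOME f. f \<in> F)),
    Cod = (\<lambda>F. Cod C (SOME f. f \<in> F)),
    Ident = (\<lambda>A. quot_class C \<omega> (Ident C A)),
    Comp = (\<lambda>G F. \<Union>g \<in> G. \<Union>f \<in> F. quot_class C \<omega> (g \<cdot>\<^bsub>C\<^esub> f))\<rparr>"


section \<open>Exact categories\<close>

record ('o, 'm) exact_cat = "('o, 'm) preadd_cat" +
  Conf :: "('m \<times> 'm) set"

definition inflation :: "('o, 'm, 'z) exact_cat_scheme \<Rightarrow> 'm \<Rightarrow> bool" where
  "inflation C i \<longleftrightarrow> (\<exists>d. (i, d) \<in> Conf C)"

definition deflation :: "('o, 'm, 'z) exact_cat_scheme \<Rightarrow> 'm \<Rightarrow> bool" where
  "deflation C d \<longleftrightarrow> (\<exists>i. (i, d) \<in> Conf C)"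

locale exact_category = additive_category C
  for C :: "('o, 'm, 'z) exact_cat_scheme" (structure) +
  assumes Conf_ker_coker: "(i, d) \<in> Conf C \<Longrightarrow> is_kernel C i d \<and> is_cokernel C d i"
    and Conf_iso: "\<lbrakk>(i, d) \<in> Conf C; i' \<in> Arr C; d' \<in> Arr C; Cod C i' = Dom C d';
        a \<in> Hom C (Dom C i) (Dom C i'); b \<in> Hom C (Cod C i) (Cod C i');
        c \<in> Hom C (Cod C d) (Cod C d'); is_iso C a; is_iso C b; is_iso C c;
        b \<cdot> i = i' \<cdot> a; c \<cdot> d = d' \<cdot> b\<rbrakk> \<Longrightarrow> (i', d') \<in> Conf C"
    and Ident_inflation: "A \<in> Obj C \<Longrightarrow> inflation C (Ident C A)"
    and Ident_deflation: "A \<in> Obj C \<Longrightarrow> deflation C (Ident C A)"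
    and inflation_Comp: "\<lbrakk>inflation C i; inflation C j; Cod C i = Dom C j\<rbrakk>
      \<Longrightarrow> inflation C (j \<cdot> i)"
    and deflation_Comp: "\<lbrakk>deflation C d; deflation C e; Cod C d = Dom C e\<rbrakk>
      \<Longrightarrow> deflation C (e \<cdot> d)"
    and inflation_pushout: "\<lbrakk>inflation C i; f \<in> Arr C; Dom C f = Dom C i\<rbrakk>
      \<Longrightarrow> \<exists>i' f'. is_pushout C i f i' f' \<and> inflation C i'"
    and deflation_pullback: "\<lbrakk>deflation C d; f \<in> Arr C; Cod C f = Cod C d\<rbrakk>
      \<Longrightarrow> \<exists>d' f'. is_pullback C d f d' f' \<and> deflation C d'"

definition weakly_idempotent_complete :: "('o, 'm, 'z) exact_cat_scheme \<Rightarrow> bool" where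
  "weakly_idempotent_complete C \<longleftrightarrow> (\<forall>f. split_epi C f \<longrightarrow> deflation C f)"

text \<open>Yoneda extensions of \<open>Z\<close> by \<open>X\<close>, i.e. admissible exact sequences
  \<open>0 \<rightarrow> X \<rightarrow> Y \<rightarrow> Z \<rightarrow> 0\<close>, up to isomorphisms that are the identity on \<open>X\<close> and \<open>Z\<close>.\<close>

definition extensions :: "('o, 'm, 'z) exact_cat_scheme \<Rightarrow> 'o \<Rightarrow> 'o \<Rightarrow> ('m \<times> 'm) set" where
  "extensions C Z X = {(i, d) \<in> Conf C. Dom C i = X \<and> Cod C d = Z}"

definition ext_equiv ::
  "('o, 'm, 'z) exact_cat_scheme \<Rightarrow> 'o \<Rightarrow> 'o \<Rightarrow> (('m \<times> 'm) \<times> ('m \<times> 'm)) set" where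
  "ext_equiv C Z X = {((i, d), (i', d')).
    (i, d) \<in> extensions C Z X \<and> (i', d') \<in> extensions C Z X \<and>
    (\<exists>h \<in> Hom C (Cod C i) (Cod C i'). is_iso C h \<and> h \<cdot>\<^bsub>C\<^esub> i = i' \<and> d' \<cdot>\<^bsub>C\<^esub> h = d)}"

definition Ext1 :: "('o, 'm, 'z) exact_cat_scheme \<Rightarrow> 'o \<Rightarrow> 'o \<Rightarrow> ('m \<times> 'm) set set" where
  "Ext1 C Z X = extensions C Z X // ext_equiv C Z X"

text \<open>Only the vanishing of \<open>Ext\<^sup>1\<close> is needed, so the Baer sum is not defined: a group is zero
  iff its underlying set is a singleton.\<close>

definition Ext1_zero :: "('o, 'm, 'z) exact_cat_scheme \<Rightarrow> 'o \<Rightarrow> 'o \<Rightarrow> bool" where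
  "Ext1_zero C Z X \<longleftrightarrow> (\<exists>\<xi>. Ext1 C Z X = {\<xi>})"

definition left_perp :: "('o, 'm, 'z) exact_cat_scheme \<Rightarrow> 'o set \<Rightarrow> 'o set" where
  "left_perp C \<C> = {X \<in> Obj C. \<forall>Y \<in> \<C>. Ext1_zero C X Y}"

definition right_perp :: "('o, 'm, 'z) exact_cat_scheme \<Rightarrow> 'o set \<Rightarrow> 'o set" where
  "right_perp C \<C> = {Y \<in> Obj C. \<forall>X \<in> \<C>. Ext1_zero C X Y}"

definition cotorsion_pair :: "('o, 'm, 'z) exact_cat_scheme \<Rightarrow> 'o set \<Rightarrow> 'o set \<Rightarrow> bool" where
  "cotorsion_pair C \<C> \<F> \<longleftrightarrow> \<C> \<subseteq> Obj C \<and> \<F> \<subseteq> Obj C \<and>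
    \<C> = left_perp C \<F> \<and> \<F> = right_perp C \<C>"

definition complete_pair :: "('o, 'm, 'z) exact_cat_scheme \<Rightarrow> 'o set \<Rightarrow> 'o set \<Rightarrow> bool" where
  "complete_pair C \<C> \<F> \<longleftrightarrow> (\<forall>X \<in> Obj C.
    (\<exists>(i, d) \<in> Conf C. Dom C i \<in> \<F> \<and> Cod C i \<in> \<C> \<and> Cod C d = X) \<and>
    (\<exists>(i, d) \<in> Conf C. Dom C i = X \<and> Cod C i \<in> \<F> \<and> Cod C d \<in> \<C>))"

definition hereditary_pair :: "('o, 'm, 'z) exact_cat_scheme \<Rightarrow> 'o set \<Rightarrow> 'o set \<Rightarrow> bool" where
  "hereditary_pair C \<C> \<F> \<longleftrightarrow>
    (\<forall>(i, d) \<in> Conf C. Cod C i \<in> \<C> \<and> Cod C d \<in> \<C> \<longrightarrow> Dom C i \<in> \<C>) \<and>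
    (\<forall>(i, d) \<in> Conf C. Dom C i \<in> \<F> \<and> Cod C i \<in> \<F> \<longrightarrow> Cod C d \<in> \<F>)"

definition hereditary_complete_cotorsion_pair ::
  "('o, 'm, 'z) exact_cat_scheme \<Rightarrow> 'o set \<Rightarrow> 'o set \<Rightarrow> bool" where
  "hereditary_complete_cotorsion_pair C \<C> \<F> \<longleftrightarrow>
    cotorsion_pair C \<C> \<F> \<and> complete_pair C \<C> \<F> \<and> hereditary_pair C \<C> \<F>"

definition right_approximation ::
  "('o, 'm, 'z) cat_scheme \<Rightarrow> 'o set \<Rightarrow> 'o \<Rightarrow> 'm \<Rightarrow> bool" where
  "right_approximation C \<omega> B t \<longleftrightarrow> t \<in> Arr C \<and> Dom C t \<in> \<omega> \<and> Cod C t = B \<and>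
    (\<forall>W' \<in> \<omega>. \<forall>u \<in> Hom C W' B. \<exists>v \<in> Hom C W' (Dom C t). t \<cdot>\<^bsub>C\<^esub> v = u)"

definition contravariantly_finite :: "('o, 'm, 'z) cat_scheme \<Rightarrow> 'o set \<Rightarrow> bool" where
  "contravariantly_finite C \<omega> \<longleftrightarrow> (\<forall>B \<in> Obj C. \<exists>t. right_approximation C \<omega> B t)"


section \<open>Model structures\<close>

definition retract_of :: "('o, 'm, 'z) cat_scheme \<Rightarrow> 'm \<Rightarrow> 'm \<Rightarrow> bool" where
  "retract_of C f g \<longleftrightarrow> f \<in> Arr C \<and> g \<in> Arr C \<and>
    (\<exists>s \<in> Hom C (Dom C f) (Dom C g). \<exists>s' \<in> Hom C (Cod C f) (Cod C g).
     \<exists>r \<in> Hom C (Dom C g) (Dom C f). \<exists>r' \<in> Hom C (Cod C g) (Cod C f).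
      g \<cdot>\<^bsub>C\<^esub> s = s' \<cdot>\<^bsub>C\<^esub> f \<and> f \<cdot>\<^bsub>C\<^esub> r = r' \<cdot>\<^bsub>C\<^esub> g \<and>
      r \<cdot>\<^bsub>C\<^esub> s = Ident C (Dom C f) \<and> r' \<cdot>\<^bsub>C\<^esub> s' = Ident C (Cod C f))"

definition retract_closed :: "('o, 'm, 'z) cat_scheme \<Rightarrow> 'm set \<Rightarrow> bool" where
  "retract_closed C M \<longleftrightarrow> (\<forall>g \<in> M. \<forall>f. retract_of C f g \<longrightarrow> f \<in> M)"

text \<open>\<open>i\<close> has the left lifting property with respect to \<open>p\<close>; equivalently \<open>p\<close> has the right
  lifting property with respect to \<open>i\<close>.\<close>

definition lifts_against :: "('o, 'm, 'z) cat_scheme \<Rightarrow> 'm \<Rightarrow> 'm \<Rightarrow> bool" where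
  "lifts_against C i p \<longleftrightarrow>
    (\<forall>u \<in> Hom C (Dom C i) (Dom C p). \<forall>v \<in> Hom C (Cod C i) (Cod C p).
      p \<cdot>\<^bsub>C\<^esub> u = v \<cdot>\<^bsub>C\<^esub> i \<longrightarrow>
      (\<exists>h \<in> Hom C (Cod C i) (Dom C p). h \<cdot>\<^bsub>C\<^esub> i = u \<and> p \<cdot>\<^bsub>C\<^esub> h = v))"

locale model_structure =
  fixes C :: "('o, 'm, 'z) cat_scheme" (structure)
    and CoFib Fib Weq :: "'m set"
  assumes CoFib_Arr: "CoFib \<subseteq> Arr C"
    and Fib_Arr: "Fib \<subseteq> Arr C"
    and Weq_Arr: "Weq \<subseteq> Arr C"
    and two_of_three: "\<lbrakk>f \<in> Hom C A B; g \<in> Hom C B D\<rbrakk> \<Longrightarrow>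
      (f \<in> Weq \<and> g \<in> Weq \<longrightarrow> g \<cdot> f \<in> Weq) \<and>
      (f \<in> Weq \<and> g \<cdot> f \<in> Weq \<longrightarrow> g \<in> Weq) \<and>
      (g \<in> Weq \<and> g \<cdot> f \<in> Weq \<longrightarrow> f \<in> Weq)"
    and CoFib_retract: "retract_closed C CoFib"
    and Fib_retract: "retract_closed C Fib"
    and Weq_retract: "retract_closed C Weq"
    and CoFib_lifting: "\<lbrakk>i \<in> CoFib; p \<in> Fib \<inter> Weq\<rbrakk> \<Longrightarrow> lifts_against C i p"
    and Fib_lifting: "\<lbrakk>i \<in> CoFib \<inter> Weq; p \<in> Fib\<rbrakk> \<Longrightarrow> lifts_against C i p"
    and factor_trivial_cofibration: "f \<in> Arr C \<Longrightarrow>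
      \<exists>i \<in> CoFib \<inter> Weq. \<exists>p \<in> Fib. Dom C i = Dom C f \<and> Cod C i = Dom C p \<and>
        Cod C p = Cod C f \<and> f = p \<cdot> i"
    and factor_trivial_fibration: "f \<in> Arr C \<Longrightarrow>
      \<exists>j \<in> CoFib. \<exists>q \<in> Fib \<inter> Weq. Dom C j = Dom C f \<and> Cod C j = Dom C q \<and>
        Cod C q = Cod C f \<and> f = q \<cdot> j"

definition cofibrant_objs :: "('o, 'm, 'z) cat_scheme \<Rightarrow> 'm set \<Rightarrow> 'o set" where
  "cofibrant_objs C CoFib =
    {X \<in> Obj C. \<exists>Z. is_zero_obj C Z \<and> (\<exists>f \<in> Hom C Z X. f \<in> CoFib)}"

definition fibrant_objs :: "('o, 'm, 'z) cat_scheme \<Rightarrow> 'm set \<Rightarrow> 'o set" where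
  "fibrant_objs C Fib =
    {X \<in> Obj C. \<exists>Z. is_zero_obj C Z \<and> (\<exists>f \<in> Hom C X Z. f \<in> Fib)}"

definition trivial_objs :: "('o, 'm, 'z) cat_scheme \<Rightarrow> 'm set \<Rightarrow> 'o set" where
  "trivial_objs C Weq =
    {X \<in> Obj C. \<exists>Z. is_zero_obj C Z \<and> (\<exists>f \<in> Hom C Z X. f \<in> Weq)}"

definition homotopy_category ::
  "('o, 'm, 'z) cat_scheme \<Rightarrow> 'm set \<Rightarrow> ('o, 'o \<times> 'm zstep list set \<times> 'o) cat" where
  "homotopy_category C Weq = localization C Weq"


section \<open>The three classes of morphisms attached to a pair of subcategories\<close>

definition CoFib\<^sub>\<omega> :: "('o, 'm, 'z) exact_cat_scheme \<Rightarrow> 'o set \<Rightarrow> 'm set" where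
  "CoFib\<^sub>\<omega> C \<X> = {f. inflation C f \<and> Coker_in C f \<X>}"

definition Fib\<^sub>\<omega> :: "('o, 'm, 'z) cat_scheme \<Rightarrow> 'o set \<Rightarrow> 'm set" where
  "Fib\<^sub>\<omega> C \<omega> = {f \<in> Arr C. \<forall>W \<in> \<omega>.
    (\<lambda>u. f \<cdot>\<^bsub>C\<^esub> u) ` Hom C W (Dom C f) = Hom C W (Cod C f)}"

text \<open>In the next definition \<open>g\<close> is the morphism \<open>(f, t) : A \<oplus> W \<rightarrow> B\<close>.\<close>

definition Weq\<^sub>\<omega> :: "('o, 'm, 'z) exact_cat_scheme \<Rightarrow> 'o set \<Rightarrow> 'o set \<Rightarrow> 'm set" where
  "Weq\<^sub>\<omega> C \<omega> \<Y> = {f \<in> Arr C. \<exists>W \<in> \<omega>. \<exists>t \<in> Hom C W (Cod C f).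
    \<exists>S j\<^sub>A j\<^sub>W p\<^sub>A p\<^sub>W. is_biproduct C S (Dom C f) W j\<^sub>A j\<^sub>W p\<^sub>A p\<^sub>W \<and>
      (\<exists>g \<in> Hom C S (Cod C f). g \<cdot>\<^bsub>C\<^esub> j\<^sub>A = f \<and> g \<cdot>\<^bsub>C\<^esub> j\<^sub>W = t \<and>
        deflation C g \<and> Ker_in C g \<Y>)}"

end

(* For a hereditary complete cotorsion pair, f is a weak equivalence if and only if Hom(V, f) is
   bijective modulo omega for every V in X: factor f as an inflation with cokernel in X followed by
   a trivial fibration, which reduces the claim to such an inflation, and heredity forces it to
   split. Two-out-of-three and closure under retracts are then evident. Conversely, every object is
   fibrant and B -> 0 is a trivial fibration for B in Y, so cofibrations lift against it, which
   gives Ext^1(X, Y) = 0; completeness comes from factoring 0 -> A and A -> 0, and heredity from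
   two-out-of-three. The equivalence of the homotopy category with X/omega sends A to a cofibrant
   replacement, to which zigzags lift as arrows that are unique modulo omega. *)
theory Submission
  imports Defs
begin

section \<open>Preadditive categories\<close>

text \<open>\<open>Weq\<^sub>\<omega>\<close> asserts the existence of a presentation
  \<open>(f, t)\<close> whose summand \<open>W\<close> varies with \<open>f\<close>, so neither
  composition nor cancellation is visible from it. Bijectivity modulo \<open>\<omega>\<close>
  mentions no presentation, and the whole cost moves to recovering one: once the inflation in the
  factorization of \<open>f\<close> splits, its cokernel is \<open>W\<close> and the trivial
  fibration is \<open>(f, t)\<close>. With few limits at hand, weak idempotent completeness is the
  main tool. It makes retracts into summands, and it yields cancellation: if
  \<open>g \<cdot> f\<close> is a deflation, so is \<open>g\<close>. Hence \<open>(f, t)\<close> is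
  a deflation as soon as \<open>t\<close> is. Long exact sequences are avoided. Closure properties
  of \<open>\<X>\<close> are read off lifting properties, which pass to composites. In the converse
  direction two-out-of-three only yields closure of \<open>\<Y>\<close> under cokernels of
  inflations; closure of \<open>\<X>\<close> under kernels of deflations is deduced from it. The
  localization needs no calculus of fractions, because it identifies arrows that agree modulo
  \<open>\<omega>\<close>, and evaluation on cofibrant replacements respects each generating
  relation of zigzags.\<close>

lemma Hom_iff [simp]: "f \<in> Hom C A B \<longleftrightarrow> f \<in> Arr C \<and> Dom C f = A \<and> Cod C f = B"
  by (auto simp: Hom_def)

context category
begin

lemma Dom_in_Obj [simp]: "f \<in> Arr C \<Longrightarrow> Dom C f \<in> Obj C"
  and Cod_in_Obj [simp]: "f \<in> Arr C \<Longrightarrow> Cod C f \<in> Obj C"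
  by (simp_all add: Dom_Obj Cod_Obj)

lemma Ident_simps [simp]:
  assumes "A \<in> Obj C"
  shows "Ident C A \<in> Arr C" "Dom C (Ident C A) = A" "Cod C (Ident C A) = A"
  using Ident_Hom[OF assms] by auto

lemma Comp_simps [simp]:
  assumes "f \<in> Arr C" "g \<in> Arr C" "Cod C f = Dom C g"
  shows "g \<cdot> f \<in> Arr C" "Dom C (g \<cdot> f) = Dom C f" "Cod C (g \<cdot> f) = Cod C g"
  using Comp_Hom[of f "Dom C f" "Dom C g" g "Cod C g"] assms by auto

lemma Comp_assoc' [simp]:
  assumes "f \<in> Arr C" "g \<in> Arr C" "h \<in> Arr C" "Cod C f = Dom C g" "Cod C g = Dom C h"
  shows "(h \<cdot> g) \<cdot> f = h \<cdot> (g \<cdot> f)"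
  using Comp_assoc[of f "Dom C f" "Dom C g" g "Dom C h" h "Cod C h"] assms by auto

lemma Comp_Ident [simp]:
  shows "f \<in> Arr C \<Longrightarrow> Dom C f = A \<Longrightarrow> f \<cdot> Ident C A = f"
    and "f \<in> Arr C \<Longrightarrow> Cod C f = A \<Longrightarrow> Ident C A \<cdot> f = f"
  using Comp_Ident_right[of f "Dom C f" "Cod C f"] Comp_Ident_left[of f "Dom C f" "Cod C f"]
  by auto

text \<open>Composites are normalised with brackets to the right, where a known product
  \<open>g \<cdot> f\<close> no longer occurs as a subterm of
  \<open>g \<cdot> (f \<cdot> x)\<close>. Instances of this lemma turn
  \<open>g \<cdot> f = h\<close> back into a usable rewrite rule.\<close>

lemma Comp_reassoc:
  assumes "g \<cdot> f = h" "f \<in> Arr C" "g \<in> Arr C" "Cod C f = Dom C g" "x \<in> Arr C" "Cod C x = Dom C f"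
  shows "g \<cdot> (f \<cdot> x) = h \<cdot> x"
  using assms by (metis Comp_assoc')

lemma Comp_reassoc_left:
  assumes "g \<cdot> f = h" "f \<in> Arr C" "g \<in> Arr C" "Cod C f = Dom C g" "x \<in> Arr C" "Cod C g = Dom C x"
  shows "(x \<cdot> g) \<cdot> f = x \<cdot> h"
  using assms by (metis Comp_assoc')

lemma is_isoI:
  assumes "f \<in> Arr C" "g \<in> Arr C" "Dom C g = Cod C f" "Cod C g = Dom C f"
    "g \<cdot> f = Ident C (Dom C f)" "f \<cdot> g = Ident C (Cod C f)"
  shows "is_iso C f"
  using assms by (auto simp: is_iso_def)

lemma is_isoE:
  assumes "is_iso C f"
  obtains g where "g \<in> Arr C" "Dom C g = Cod C f" "Cod C g = Dom C f"
    "g \<cdot> f = Ident C (Dom C f)" "f \<cdot> g = Ident C (Cod C f)"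
  using assms by (auto simp: is_iso_def)

lemma is_iso_Ident [simp]: "A \<in> Obj C \<Longrightarrow> is_iso C (Ident C A)"
  by (rule is_isoI[where g = "Ident C A"]) auto

end

section \<open>Additive calculus on hom-groups, kernels and biproducts\<close>

context preadditive_category
begin

abbreviation padd (infixl "\<^bold>+" 65) where "f \<^bold>+ g \<equiv> Plus C f g"

definition neg where "neg f = inv\<^bsub>Hom_group C (Dom C f) (Cod C f)\<^esub> f"

abbreviation parallel where
  "parallel f g \<equiv> f \<in> Arr C \<and> g \<in> Arr C \<and> Dom C f = Dom C g \<and> Cod C f = Cod C g"

lemma Plus_simps [simp]:
  assumes "f \<in> Arr C" "g \<in> Arr C" "Dom C f = Dom C g" "Cod C f = Cod C g"
  shows "f \<^bold>+ g \<in> Arr C" "Dom C (f \<^bold>+ g) = Dom C g" "Cod C (f \<^bold>+ g) = Cod C g"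
proof -
  interpret H: comm_group "Hom_group C (Dom C g) (Cod C g)"
    using assms by (intro Hom_comm_group) auto
  show "f \<^bold>+ g \<in> Arr C" "Dom C (f \<^bold>+ g) = Dom C g" "Cod C (f \<^bold>+ g) = Cod C g"
    using H.m_closed[of f g] assms by (auto simp: Hom_group_def)
qed

lemma Zero_simps [simp]:
  assumes "A \<in> Obj C" "B \<in> Obj C"
  shows "Zero C A B \<in> Arr C" "Dom C (Zero C A B) = A" "Cod C (Zero C A B) = B"
proof -
  interpret H: comm_group "Hom_group C A B" using assms by (intro Hom_comm_group) auto
  show "Zero C A B \<in> Arr C" "Dom C (Zero C A B) = A" "Cod C (Zero C A B) = B"
    using H.one_closed by (auto simp: Hom_group_def)
qed

lemma neg_simps [simp]:
  assumes "f \<in> Arr C"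
  shows "neg f \<in> Arr C" "Dom C (neg f) = Dom C f" "Cod C (neg f) = Cod C f"
proof -
  interpret H: comm_group "Hom_group C (Dom C f) (Cod C f)"
    using assms by (intro Hom_comm_group) auto
  show "neg f \<in> Arr C" "Dom C (neg f) = Dom C f" "Cod C (neg f) = Cod C f"
    using H.inv_closed[of f] assms by (auto simp: Hom_group_def neg_def)
qed

lemma Plus_assoc:
  assumes "f \<in> Arr C" "g \<in> Arr C" "h \<in> Arr C"
    "Dom C f = Dom C g" "Cod C f = Cod C g" "Dom C g = Dom C h" "Cod C g = Cod C h"
  shows "(f \<^bold>+ g) \<^bold>+ h = f \<^bold>+ (g \<^bold>+ h)"
proof -
  interpret H: comm_group "Hom_group C (Dom C f) (Cod C f)"
    using assms by (intro Hom_comm_group) auto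
  show ?thesis using H.m_assoc[of f g h] assms by (auto simp: Hom_group_def)
qed

lemma Plus_comm:
  assumes "f \<in> Arr C" "g \<in> Arr C" "Dom C f = Dom C g" "Cod C f = Cod C g"
  shows "f \<^bold>+ g = g \<^bold>+ f"
proof -
  interpret H: comm_group "Hom_group C (Dom C f) (Cod C f)"
    using assms by (intro Hom_comm_group) auto
  show ?thesis using H.m_comm[of f g] assms by (auto simp: Hom_group_def)
qed

lemma Plus_left_comm:
  assumes "f \<in> Arr C" "g \<in> Arr C" "h \<in> Arr C"
    "Dom C f = Dom C g" "Cod C f = Cod C g" "Dom C g = Dom C h" "Cod C g = Cod C h"
  shows "f \<^bold>+ (g \<^bold>+ h) = g \<^bold>+ (f \<^bold>+ h)"
  using assms by (metis Plus_assoc Plus_comm)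

lemmas Plus_ac = Plus_assoc Plus_comm Plus_left_comm

lemma Plus_Zero [simp]:
  assumes "f \<in> Arr C" "Dom C f = A" "Cod C f = B"
  shows "f \<^bold>+ Zero C A B = f" "Zero C A B \<^bold>+ f = f"
proof -
  interpret H: comm_group "Hom_group C A B" using assms by (intro Hom_comm_group) auto
  show "f \<^bold>+ Zero C A B = f" "Zero C A B \<^bold>+ f = f"
    using H.r_one[of f] H.l_one[of f] assms by (auto simp: Hom_group_def)
qed

lemma Plus_neg [simp]:
  assumes "f \<in> Arr C"
  shows "f \<^bold>+ neg f = Zero C (Dom C f) (Cod C f)" "neg f \<^bold>+ f = Zero C (Dom C f) (Cod C f)"
proof -
  interpret H: comm_group "Hom_group C (Dom C f) (Cod C f)"
    using assms by (intro Hom_comm_group) auto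
  show "f \<^bold>+ neg f = Zero C (Dom C f) (Cod C f)" "neg f \<^bold>+ f = Zero C (Dom C f) (Cod C f)"
    using H.r_inv[of f] H.l_inv[of f] assms by (auto simp: Hom_group_def neg_def)
qed

lemma Plus_neg_cancel [simp]:
  assumes "f \<in> Arr C" "g \<in> Arr C" "Dom C f = Dom C g" "Cod C f = Cod C g"
  shows "f \<^bold>+ (neg f \<^bold>+ g) = g" "neg f \<^bold>+ (f \<^bold>+ g) = g"
  using assms by (simp_all flip: Plus_assoc)

lemma Plus_neg_cancel' [simp]:
  assumes "f \<in> Arr C" "g \<in> Arr C" "Dom C f = Dom C g" "Cod C f = Cod C g"
  shows "f \<^bold>+ (g \<^bold>+ neg f) = g" "neg f \<^bold>+ (g \<^bold>+ f) = g"
  using assms by (simp_all add: Plus_comm[of g])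

lemma Plus_left_cancel:
  assumes "f \<in> Arr C" "g \<in> Arr C" "h \<in> Arr C"
    "Dom C f = Dom C g" "Cod C f = Cod C g" "Dom C g = Dom C h" "Cod C g = Cod C h"
    "f \<^bold>+ g = f \<^bold>+ h"
  shows "g = h"
  using assms by (metis Plus_neg_cancel(2))

lemma neg_unique:
  assumes "f \<in> Arr C" "g \<in> Arr C" "Dom C f = Dom C g" "Cod C f = Cod C g"
    "f \<^bold>+ g = Zero C (Dom C f) (Cod C f)"
  shows "g = neg f"
  by (rule Plus_left_cancel[of f]) (use assms in simp_all)

lemma neg_neg [simp]: "f \<in> Arr C \<Longrightarrow> neg (neg f) = f"
  by (rule neg_unique[symmetric]) simp_all

lemma neg_Plus [simp]:
  assumes "f \<in> Arr C" "g \<in> Arr C" "Dom C f = Dom C g" "Cod C f = Cod C g"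
  shows "neg (f \<^bold>+ g) = neg f \<^bold>+ neg g"
proof -
  have "(f \<^bold>+ g) \<^bold>+ (neg f \<^bold>+ neg g) = f \<^bold>+ (g \<^bold>+ (neg g \<^bold>+ neg f))"
    using assms by (simp add: Plus_assoc Plus_comm[of "neg f"])
  also have "\<dots> = Zero C (Dom C f) (Cod C f)" using assms by simp
  finally show ?thesis by (intro neg_unique[symmetric]) (use assms in simp_all)
qed

lemma Comp_Plus [simp]:
  assumes "f \<in> Arr C" "f' \<in> Arr C" "g \<in> Arr C" "Dom C f = Dom C f'" "Cod C f = Cod C f'"
  shows "Dom C g = Cod C f' \<Longrightarrow> g \<cdot> (f \<^bold>+ f') = g \<cdot> f \<^bold>+ g \<cdot> f'"
    and "Cod C g = Dom C f' \<Longrightarrow> (f \<^bold>+ f') \<cdot> g = f \<cdot> g \<^bold>+ f' \<cdot> g"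
  using Comp_Plus_right[of f "Dom C f'" "Cod C f'" f' g] Comp_Plus_left[of g _ "Dom C f'" f _ f'] assms
  by auto

lemma Comp_Zero [simp]:
  assumes "g \<in> Arr C" "D \<in> Obj C"
  shows "Dom C g = B \<Longrightarrow> g \<cdot> Zero C D B = Zero C D (Cod C g)"
    and "Cod C g = B \<Longrightarrow> Zero C B D \<cdot> g = Zero C (Dom C g) D"
proof -
  show "g \<cdot> Zero C D B = Zero C D (Cod C g)" if "Dom C g = B"
  proof -
    have "g \<cdot> Zero C D B \<^bold>+ g \<cdot> Zero C D B = g \<cdot> Zero C D B"
      using assms that Comp_Plus(1)[of "Zero C D B" "Zero C D B" g] by (auto simp del: Comp_Plus)
    then show ?thesis
      by (intro Plus_left_cancel[of "g \<cdot> Zero C D B" "g \<cdot> Zero C D B"]) (use assms that in auto)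
  qed
  show "Zero C B D \<cdot> g = Zero C (Dom C g) D" if "Cod C g = B"
  proof -
    have "Zero C B D \<cdot> g \<^bold>+ Zero C B D \<cdot> g = Zero C B D \<cdot> g"
      using assms that Comp_Plus(2)[of "Zero C B D" "Zero C B D" g] by (auto simp del: Comp_Plus)
    then show ?thesis
      by (intro Plus_left_cancel[of "Zero C B D \<cdot> g" "Zero C B D \<cdot> g"]) (use assms that in auto)
  qed
qed

lemma Comp_neg [simp]:
  assumes "f \<in> Arr C" "g \<in> Arr C" "Cod C f = Dom C g"
  shows "g \<cdot> neg f = neg (g \<cdot> f)" "neg g \<cdot> f = neg (g \<cdot> f)"
proof -
  have "g \<cdot> f \<^bold>+ g \<cdot> neg f = g \<cdot> (f \<^bold>+ neg f)"
    by (rule Comp_Plus(1)[symmetric]) (use assms in simp_all)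
  also have "\<dots> = Zero C (Dom C f) (Cod C g)" using assms by (simp del: Comp_Plus)
  finally have "g \<cdot> f \<^bold>+ g \<cdot> neg f = Zero C (Dom C f) (Cod C g)" .
  then show "g \<cdot> neg f = neg (g \<cdot> f)" by (intro neg_unique) (use assms in simp_all)
  have "g \<cdot> f \<^bold>+ neg g \<cdot> f = (g \<^bold>+ neg g) \<cdot> f"
    by (rule Comp_Plus(2)[symmetric]) (use assms in simp_all)
  also have "\<dots> = Zero C (Dom C f) (Cod C g)" using assms by (simp del: Comp_Plus)
  finally have "g \<cdot> f \<^bold>+ neg g \<cdot> f = Zero C (Dom C f) (Cod C g)" .
  then show "neg g \<cdot> f = neg (g \<cdot> f)" by (intro neg_unique) (use assms in simp_all)
qed

lemma neg_Zero [simp]: "A \<in> Obj C \<Longrightarrow> B \<in> Obj C \<Longrightarrow> neg (Zero C A B) = Zero C A B"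
  by (rule neg_unique[symmetric]) simp_all

subsection \<open>Zero objects, kernels and biproducts\<close>

lemma zero_obj_Obj: "is_zero_obj C Z \<Longrightarrow> Z \<in> Obj C"
  by (simp add: is_zero_obj_def)

text \<open>Every arrow into or out of \<open>Z\<close> is its own composite with the identity of
  \<open>Z\<close>, so one equation replaces uniqueness conditions ranging over all objects.\<close>

lemma zero_obj_Ident: "is_zero_obj C Z \<longleftrightarrow> Z \<in> Obj C \<and> Ident C Z = Zero C Z Z"
proof
  assume Z: "is_zero_obj C Z"
  then have o: "Z \<in> Obj C" and "\<exists>!f. f \<in> Hom C Z Z" by (auto simp: is_zero_obj_def)
  then show "Z \<in> Obj C \<and> Ident C Z = Zero C Z Z" by (metis Hom_iff Ident_simps Zero_simps)
next
  assume Z: "Z \<in> Obj C \<and> Ident C Z = Zero C Z Z"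
  show "is_zero_obj C Z" unfolding is_zero_obj_def
  proof (intro conjI ballI ex1I)
    fix A f assume *: "A \<in> Obj C" "f \<in> Hom C Z A"
    then have "f = f \<cdot> Ident C Z" by simp
    then show "f = Zero C Z A" using * Z by auto
  next
    fix A f assume *: "A \<in> Obj C" "f \<in> Hom C A Z"
    then have "f = Ident C Z \<cdot> f" by simp
    then show "f = Zero C A Z" using * Z by auto
  qed (use Z in auto)
qed

lemma zero_obj_arrow:
  assumes "is_zero_obj C Z" "f \<in> Arr C"
  shows "Dom C f = Z \<Longrightarrow> f = Zero C Z (Cod C f)" and "Cod C f = Z \<Longrightarrow> f = Zero C (Dom C f) Z"
proof -
  have Z: "Z \<in> Obj C" using assms(1) by (rule zero_obj_Obj)
  show "f = Zero C Z (Cod C f)" if "Dom C f = Z"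
  proof -
    have "\<exists>!h. h \<in> Hom C Z (Cod C f)" using assms by (simp add: is_zero_obj_def)
    then show ?thesis using Z assms that by (metis Hom_iff Cod_in_Obj Zero_simps)
  qed
  show "f = Zero C (Dom C f) Z" if "Cod C f = Z"
  proof -
    have "\<exists>!h. h \<in> Hom C (Dom C f) Z" using assms by (simp add: is_zero_obj_def)
    then show ?thesis using Z assms that by (metis Hom_iff Dom_in_Obj Zero_simps)
  qed
qed

lemma is_kernelD:
  assumes "is_kernel C k f"
  shows "k \<in> Arr C" "f \<in> Arr C" "Cod C k = Dom C f" "f \<cdot> k = Zero C (Dom C k) (Cod C f)"
  using assms by (auto simp: is_kernel_def)

lemma kernel_factor:
  assumes "is_kernel C k f" "u \<in> Arr C" "Cod C u = Dom C f" "f \<cdot> u = Zero C (Dom C u) (Cod C f)"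
  obtains h where "h \<in> Arr C" "Dom C h = Dom C u" "Cod C h = Dom C k" "k \<cdot> h = u"
  using assms unfolding is_kernel_def by (metis Hom_iff)

lemma kernel_mono:
  assumes "is_kernel C k f" "u \<in> Arr C" "v \<in> Arr C" "Dom C u = Dom C v"
    "Cod C u = Dom C k" "Cod C v = Dom C k" "k \<cdot> u = k \<cdot> v"
  shows "u = v"
proof -
  note k = is_kernelD[OF assms(1)]
  have "f \<cdot> (k \<cdot> u) = Zero C (Dom C u) (Cod C f)"
    using k assms by (simp add: Comp_reassoc[OF k(4)])
  then have "\<exists>!h. h \<in> Hom C (Dom C u) (Dom C k) \<and> k \<cdot> h = k \<cdot> u"
    using assms(1) k assms(2-7) unfolding is_kernel_def by (metis Comp_simps)
  then show ?thesis using assms by (metis Hom_iff)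
qed

lemma is_cokernelD:
  assumes "is_cokernel C c f"
  shows "c \<in> Arr C" "f \<in> Arr C" "Dom C c = Cod C f" "c \<cdot> f = Zero C (Dom C f) (Cod C c)"
  using assms by (auto simp: is_cokernel_def)

lemma cokernel_factor:
  assumes "is_cokernel C c f" "u \<in> Arr C" "Dom C u = Cod C f" "u \<cdot> f = Zero C (Dom C f) (Cod C u)"
  obtains h where "h \<in> Arr C" "Dom C h = Cod C c" "Cod C h = Cod C u" "h \<cdot> c = u"
  using assms unfolding is_cokernel_def by (metis Hom_iff)

lemma cokernel_epi:
  assumes "is_cokernel C c f" "u \<in> Arr C" "v \<in> Arr C" "Cod C u = Cod C v"
    "Dom C u = Cod C c" "Dom C v = Cod C c" "u \<cdot> c = v \<cdot> c"
  shows "u = v"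
proof -
  note c = is_cokernelD[OF assms(1)]
  have "(u \<cdot> c) \<cdot> f = Zero C (Dom C f) (Cod C u)"
    using c assms by (simp del: Comp_assoc' add: Comp_reassoc_left[OF c(4)])
  then have "\<exists>!h. h \<in> Hom C (Cod C c) (Cod C u) \<and> h \<cdot> c = u \<cdot> c"
    using assms(1) c assms(2-7) unfolding is_cokernel_def by (metis Comp_simps)
  then show ?thesis using assms by (metis Hom_iff)
qed

lemma is_cokernelI:
  assumes "c \<in> Arr C" "f \<in> Arr C" "Dom C c = Cod C f" "c \<cdot> f = Zero C (Dom C f) (Cod C c)"
    and "\<And>u. \<lbrakk>u \<in> Arr C; Dom C u = Cod C f; u \<cdot> f = Zero C (Dom C f) (Cod C u)\<rbrakk>
      \<Longrightarrow> \<exists>h \<in> Hom C (Cod C c) (Cod C u). h \<cdot> c = u"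
    and "\<And>u v. \<lbrakk>u \<in> Arr C; v \<in> Arr C; Cod C u = Cod C v; Dom C u = Cod C c; Dom C v = Cod C c;
      u \<cdot> c = v \<cdot> c\<rbrakk> \<Longrightarrow> u = v"
  shows "is_cokernel C c f"
  unfolding is_cokernel_def
proof (intro conjI ballI impI)
  fix u assume "u \<in> Arr C" "Dom C u = Cod C f \<and> u \<cdot> f = Zero C (Dom C f) (Cod C u)"
  then obtain h where "h \<in> Hom C (Cod C c) (Cod C u)" "h \<cdot> c = u" using assms(5) by blast
  then show "\<exists>!h. h \<in> Hom C (Cod C c) (Cod C u) \<and> h \<cdot> c = u"
    using assms(6) by (metis Hom_iff)
qed (use assms in auto)

lemma is_biproductD:
  assumes "is_biproduct C S A B jA jB pA pB"
  shows "S \<in> Obj C" "A \<in> Obj C" "B \<in> Obj C"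
    "jA \<in> Arr C" "Dom C jA = A" "Cod C jA = S" "jB \<in> Arr C" "Dom C jB = B" "Cod C jB = S"
    "pA \<in> Arr C" "Dom C pA = S" "Cod C pA = A" "pB \<in> Arr C" "Dom C pB = S" "Cod C pB = B"
    "pA \<cdot> jA = Ident C A" "pB \<cdot> jB = Ident C B" "pB \<cdot> jA = Zero C A B" "pA \<cdot> jB = Zero C B A"
    "jA \<cdot> pA \<^bold>+ jB \<cdot> pB = Ident C S"
  using assms by (auto simp: is_biproduct_def)

lemma is_biproduct_commute:
  "is_biproduct C S A B jA jB pA pB \<Longrightarrow> is_biproduct C S B A jB jA pB pA"
  by (auto simp: is_biproduct_def Plus_comm)

lemma biproduct_decomp_right:
  assumes "is_biproduct C S A B jA jB pA pB" "h \<in> Arr C" "Dom C h = S"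
  shows "h = (h \<cdot> jA) \<cdot> pA \<^bold>+ (h \<cdot> jB) \<cdot> pB"
proof -
  note b = is_biproductD[OF assms(1)]
  have "h = h \<cdot> (jA \<cdot> pA \<^bold>+ jB \<cdot> pB)" using b(1-15) assms by (simp only: b(20) Comp_Ident)
  then show ?thesis using b(1-15) assms by simp
qed

lemma biproduct_decomp_left:
  assumes "is_biproduct C S A B jA jB pA pB" "h \<in> Arr C" "Cod C h = S"
  shows "h = jA \<cdot> (pA \<cdot> h) \<^bold>+ jB \<cdot> (pB \<cdot> h)"
proof -
  note b = is_biproductD[OF assms(1)]
  have "h = (jA \<cdot> pA \<^bold>+ jB \<cdot> pB) \<cdot> h" using b(1-15) assms by (simp only: b(20) Comp_Ident)
  then show ?thesis using b(1-15) assms by simp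
qed

lemma biproduct_copair:
  assumes "is_biproduct C S A B jA jB pA pB" "f \<in> Arr C" "g \<in> Arr C"
    "Dom C f = A" "Dom C g = B" "Cod C f = T" "Cod C g = T"
  obtains h where "h \<in> Arr C" "Dom C h = S" "Cod C h = T" "h \<cdot> jA = f" "h \<cdot> jB = g"
    "h = f \<cdot> pA \<^bold>+ g \<cdot> pB"
  using is_biproductD[OF assms(1)] assms(2-)
  by (intro that[of "f \<cdot> pA \<^bold>+ g \<cdot> pB"]) auto

lemma biproduct_pair:
  assumes "is_biproduct C S A B jA jB pA pB" "f \<in> Arr C" "g \<in> Arr C"
    "Cod C f = A" "Cod C g = B" "Dom C f = T" "Dom C g = T"
  obtains h where "h \<in> Arr C" "Cod C h = S" "Dom C h = T" "pA \<cdot> h = f" "pB \<cdot> h = g"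
    "h = jA \<cdot> f \<^bold>+ jB \<cdot> g"
  using is_biproductD[OF assms(1)] assms(2-)
  by (intro that[of "jA \<cdot> f \<^bold>+ jB \<cdot> g"])
    (auto simp: Comp_reassoc[OF is_biproductD(16)[OF assms(1)]] Comp_reassoc[OF is_biproductD(17)[OF assms(1)]]
      Comp_reassoc[OF is_biproductD(18)[OF assms(1)]] Comp_reassoc[OF is_biproductD(19)[OF assms(1)]])

lemma biproduct_right_ext:
  assumes "is_biproduct C S A B jA jB pA pB" "h \<in> Arr C" "Dom C h = S" "h' \<in> Arr C" "Dom C h' = S"
    "h \<cdot> jA = h' \<cdot> jA" "h \<cdot> jB = h' \<cdot> jB"
  shows "h = h'"
  using biproduct_decomp_right[OF assms(1)] assms by metis

lemma biproduct_left_ext: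
  assumes "is_biproduct C S A B jA jB pA pB" "h \<in> Arr C" "Cod C h = S" "h' \<in> Arr C" "Cod C h' = S"
    "pA \<cdot> h = pA \<cdot> h'" "pB \<cdot> h = pB \<cdot> h'"
  shows "h = h'"
  using biproduct_decomp_left[OF assms(1)] assms by metis

lemma biproduct_with_zero:
  assumes "A \<in> Obj C" "is_zero_obj C Z"
  shows "is_biproduct C A A Z (Ident C A) (Zero C Z A) (Ident C A) (Zero C A Z)"
  using assms(1) assms(2)[unfolded zero_obj_Ident] by (auto simp: is_biproduct_def)

lemma biproduct_cokernel:
  assumes "is_biproduct C S A B jA jB pA pB"
  shows "is_cokernel C pB jA"
proof (rule is_cokernelI)
  note b = is_biproductD[OF assms]
  fix u assume u: "u \<in> Arr C" "Dom C u = Cod C jA" "u \<cdot> jA = Zero C (Dom C jA) (Cod C u)"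
  then have "u = (u \<cdot> jB) \<cdot> pB" using biproduct_decomp_right[OF assms, of u] b by simp
  then show "\<exists>h \<in> Hom C (Cod C pB) (Cod C u). h \<cdot> pB = u"
    using b u by (intro bexI[of _ "u \<cdot> jB"]) auto
next
  note b = is_biproductD[OF assms]
  fix u v assume *: "u \<in> Arr C" "v \<in> Arr C" "Cod C u = Cod C v" "Dom C u = Cod C pB"
    "Dom C v = Cod C pB" "u \<cdot> pB = v \<cdot> pB"
  have "(w \<cdot> pB) \<cdot> jB = w" if "w \<in> Arr C" "Dom C w = B" for w
    using that b by simp
  then show "u = v" using * b by metis
qed (use is_biproductD[OF assms] in auto)

text \<open>The idempotent \<open>1 - s \<cdot> d\<close> is killed by \<open>d\<close> and
  therefore factors through the kernel; the factor is the missing projection, and its identities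
  follow by cancelling the monomorphism \<open>k\<close>.\<close>

lemma split_kernel_biproduct:
  assumes "is_kernel C k d" "s \<in> Arr C" "Dom C s = Cod C d" "Cod C s = Dom C d"
    "d \<cdot> s = Ident C (Cod C d)"
  obtains r where "is_biproduct C (Dom C d) (Dom C k) (Cod C d) k s r d"
proof -
  note k = is_kernelD[OF assms(1)]
  let ?e = "Ident C (Dom C d) \<^bold>+ neg (s \<cdot> d)"
  have "d \<cdot> ?e = Zero C (Dom C ?e) (Cod C d)"
    using k assms by (simp add: Comp_reassoc[OF assms(5)])
  then obtain r where r: "r \<in> Arr C" "Dom C r = Dom C d" "Cod C r = Dom C k" "k \<cdot> r = ?e"
    using kernel_factor[OF assms(1), of ?e] k assms by auto
  have "r \<cdot> k = Ident C (Dom C k)"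
    by (rule kernel_mono[OF assms(1)])
      (use k r assms in \<open>simp_all add: Comp_reassoc[OF r(4)]\<close>)
  moreover have "r \<cdot> s = Zero C (Cod C d) (Dom C k)"
    by (rule kernel_mono[OF assms(1)])
      (use k r assms in \<open>simp_all add: Comp_reassoc[OF r(4)]\<close>)
  ultimately show ?thesis
    using that[of r] k r assms by (simp add: is_biproduct_def Plus_assoc)
qed

text \<open>Mirror image of the preceding argument: \<open>1 - i \<cdot> r\<close> kills
  \<open>i\<close>, so it descends to the cokernel and gives the missing injection.\<close>

lemma split_cokernel_biproduct:
  assumes "is_cokernel C c i" "r \<in> Arr C" "Dom C r = Cod C i" "Cod C r = Dom C i"
    "r \<cdot> i = Ident C (Dom C i)"
  obtains s where "is_biproduct C (Cod C i) (Dom C i) (Cod C c) i s r c"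
proof -
  note c = is_cokernelD[OF assms(1)]
  let ?e = "Ident C (Cod C i) \<^bold>+ neg (i \<cdot> r)"
  have "?e \<cdot> i = Zero C (Dom C i) (Cod C ?e)"
    using c assms by simp
  then obtain s where s: "s \<in> Arr C" "Dom C s = Cod C c" "Cod C s = Cod C i" "s \<cdot> c = ?e"
    using cokernel_factor[OF assms(1), of ?e] c assms by auto
  have "c \<cdot> s = Ident C (Cod C c)"
    by (rule cokernel_epi[OF assms(1)])
      (use c s assms in \<open>simp_all add: Comp_reassoc[OF c(4)]\<close>)
  moreover have "r \<cdot> s = Zero C (Cod C c) (Dom C i)"
    by (rule cokernel_epi[OF assms(1)])
      (use c s assms in \<open>simp_all add: Comp_reassoc[OF assms(5)]\<close>)
  ultimately show ?thesis
    using that[of s] c s assms by (simp add: is_biproduct_def)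
qed

end

section \<open>Exact categories\<close>

text \<open>The axioms of an exact category are self-dual, so facts about pushouts, inflations and
  cokernels transfer to pullbacks, deflations and kernels. The record type is fixed without
  extension fields, so that the opposite category has the same type.\<close>

definition op_cat :: "('o, 'm) exact_cat \<Rightarrow> ('o, 'm) exact_cat" where
  "op_cat C = \<lparr>Obj = Obj C, Arr = Arr C, Dom = Cod C, Cod = Dom C, Ident = Ident C,
    Comp = (\<lambda>g f. f \<cdot>\<^bsub>C\<^esub> g), Plus = Plus C, Zero = (\<lambda>A B. Zero C B A), Conf = (Conf C)\<inverse>\<rparr>"

lemma op_cat_simps [simp]:
  "Obj (op_cat C) = Obj C" "Arr (op_cat C) = Arr C" "Dom (op_cat C) = Cod C"
  "Cod (op_cat C) = Dom C" "Ident (op_cat C) = Ident C" "g \<cdot>\<^bsub>op_cat C\<^esub> f = f \<cdot>\<^bsub>C\<^esub> g"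
  "Plus (op_cat C) = Plus C" "Zero (op_cat C) A B = Zero C B A" "Conf (op_cat C) = (Conf C)\<inverse>"
  by (auto simp: op_cat_def)

lemma op_cat_notions [simp]:
  "is_kernel (op_cat C) k f \<longleftrightarrow> is_cokernel C k f"
  "is_cokernel (op_cat C) k f \<longleftrightarrow> is_kernel C k f"
  "inflation (op_cat C) i \<longleftrightarrow> deflation C i"
  "deflation (op_cat C) i \<longleftrightarrow> inflation C i"
  "is_pushout (op_cat C) i f i' f' \<longleftrightarrow> is_pullback C i f i' f'"
  "is_pullback (op_cat C) i f i' f' \<longleftrightarrow> is_pushout C i f i' f'"
  "is_iso (op_cat C) f \<longleftrightarrow> is_iso C f"
  "is_biproduct (op_cat C) S A B jA jB pA pB \<longleftrightarrow> is_biproduct C S A B pA pB jA jB"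
  "split_epi (op_cat C) f \<longleftrightarrow> split_mono C f"
  "split_mono (op_cat C) f \<longleftrightarrow> split_epi C f"
  "Hom_group (op_cat C) A B = Hom_group C B A"
  "Hom (op_cat C) A B = Hom C B A"
  unfolding is_kernel_def is_cokernel_def inflation_def deflation_def is_pushout_def
    is_pullback_def is_iso_def is_biproduct_def Hom_group_def split_epi_def split_mono_def Hom_def
  by (auto simp: conj_commute)

lemma zero_obj_op_cat [simp]: "is_zero_obj (op_cat C) Z \<longleftrightarrow> is_zero_obj C Z"
  by (auto simp: is_zero_obj_def Hom_def conj_commute)

section \<open>Conflations and their pushouts\<close>

context exact_category
begin

lemma confD:
  assumes "(i, d) \<in> Conf C"
  shows "i \<in> Arr C" "d \<in> Arr C" "Cod C i = Dom C d" "d \<cdot> i = Zero C (Dom C i) (Cod C d)"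
    "is_kernel C i d" "is_cokernel C d i" "inflation C i" "deflation C d"
proof -
  show k: "is_kernel C i d" and "is_cokernel C d i" using Conf_ker_coker[OF assms] by auto
  show "i \<in> Arr C" "d \<in> Arr C" "Cod C i = Dom C d" "d \<cdot> i = Zero C (Dom C i) (Cod C d)"
    using is_kernelD[OF k] by auto
  show "inflation C i" "deflation C d" using assms by (auto simp: inflation_def deflation_def)
qed

lemma inflation_Arr: "inflation C i \<Longrightarrow> i \<in> Arr C"
  by (auto simp: inflation_def dest: confD)

lemma Conf_isoI:
  assumes "(i, d) \<in> Conf C" "i' \<in> Arr C" "d' \<in> Arr C" "b \<in> Arr C" "c \<in> Arr C"
    "Dom C i' = Dom C i" "Dom C b = Cod C i" "Cod C b = Cod C i'" "Dom C d' = Cod C i'"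
    "Dom C c = Cod C d" "Cod C c = Cod C d'" "is_iso C b" "is_iso C c" "b \<cdot> i = i'"
    "c \<cdot> d = d' \<cdot> b"
  shows "(i', d') \<in> Conf C"
  by (rule Conf_iso[OF assms(1), of i' d' "Ident C (Dom C i)" b c])
    (use assms confD[OF assms(1)] in auto)

lemma cokernel_iso:
  assumes "is_cokernel C c i" "is_cokernel C d i"
  obtains h where "h \<in> Arr C" "Dom C h = Cod C d" "Cod C h = Cod C c" "h \<cdot> d = c" "is_iso C h"
proof -
  note c = is_cokernelD[OF assms(1)] and d = is_cokernelD[OF assms(2)]
  obtain h where h: "h \<in> Arr C" "Dom C h = Cod C d" "Cod C h = Cod C c" "h \<cdot> d = c"
    using cokernel_factor[OF assms(2), of c] c d by auto
  obtain k where k: "k \<in> Arr C" "Dom C k = Cod C c" "Cod C k = Cod C d" "k \<cdot> c = d"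
    using cokernel_factor[OF assms(1), of d] c d by auto
  have "k \<cdot> h = Ident C (Cod C d)"
    by (rule cokernel_epi[OF assms(2)]) (use c d h k in simp_all)
  moreover have "h \<cdot> k = Ident C (Cod C c)"
    by (rule cokernel_epi[OF assms(1)]) (use c d h k in simp_all)
  ultimately show ?thesis using that[of h] h k by (metis is_isoI)
qed

text \<open>Two cokernels differ by an isomorphism, under which conflations are closed. This allows
  \<open>CoFib\<^sub>\<omega>\<close>, whose definition speaks of an arbitrary cokernel, to be
  handled through conflations.\<close>

lemma inflation_cokernel_Conf:
  assumes "inflation C i" "is_cokernel C c i"
  shows "(i, c) \<in> Conf C"
proof -
  obtain d where d: "(i, d) \<in> Conf C" using assms(1) by (auto simp: inflation_def)
  note c = is_cokernelD[OF assms(2)] and cd = confD[OF d]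
  obtain h where "h \<in> Arr C" "Dom C h = Cod C d" "Cod C h = Cod C c" "h \<cdot> d = c" "is_iso C h"
    using cokernel_iso[OF assms(2) cd(6)] .
  then show ?thesis
    using c cd by (intro Conf_isoI[OF d, of i c "Ident C (Cod C i)" h]) auto
qed

lemma inflation_iso:
  assumes "inflation C i" "h \<in> Arr C" "is_iso C h" "Dom C h = Cod C i"
  shows "inflation C (h \<cdot> i)"
proof -
  obtain d where d: "(i, d) \<in> Conf C" using assms(1) by (auto simp: inflation_def)
  obtain g where g: "g \<in> Arr C" "Dom C g = Cod C h" "Cod C g = Dom C h"
    "g \<cdot> h = Ident C (Dom C h)" "h \<cdot> g = Ident C (Cod C h)" using is_isoE[OF assms(3)] .
  note cd = confD[OF d]
  have "(h \<cdot> i, d \<cdot> g) \<in> Conf C"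
    using cd g assms
    by (intro Conf_isoI[OF d, of "h \<cdot> i" "d \<cdot> g" h "Ident C (Cod C d)"]) auto
  then show ?thesis by (auto simp: inflation_def)
qed

lemma pushoutD:
  assumes "is_pushout C i f i' f'"
  shows "i \<in> Arr C" "f \<in> Arr C" "i' \<in> Arr C" "f' \<in> Arr C"
    "Dom C f = Dom C i" "Dom C i' = Cod C f" "Dom C f' = Cod C i" "Cod C f' = Cod C i'"
    "f' \<cdot> i = i' \<cdot> f"
  using assms by (auto simp: is_pushout_def)

lemma pushout_ex1:
  assumes "is_pushout C i f i' f'" "u \<in> Arr C" "v \<in> Arr C"
    "Dom C u = Cod C f" "Dom C v = Cod C i" "Cod C u = Cod C v" "v \<cdot> i = u \<cdot> f"
  shows "\<exists>!h. h \<in> Hom C (Cod C i') (Cod C u) \<and> h \<cdot> i' = u \<and> h \<cdot> f' = v"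
  using assms unfolding is_pushout_def by blast

lemma pushout_factor:
  assumes "is_pushout C i f i' f'" "u \<in> Arr C" "v \<in> Arr C" "Dom C u = Cod C f" "Dom C v = Cod C i"
    "Cod C u = T" "Cod C v = T" "v \<cdot> i = u \<cdot> f"
  obtains h where "h \<in> Arr C" "Dom C h = Cod C i'" "Cod C h = T" "h \<cdot> i' = u" "h \<cdot> f' = v"
  using pushout_ex1[OF assms(1-5)] assms(6-8) by (metis Hom_iff)

lemma pushout_ext:
  assumes "is_pushout C i f i' f'" "g \<in> Arr C" "h \<in> Arr C" "Dom C g = Cod C i'" "Dom C h = Cod C i'"
    "Cod C g = Cod C h" "g \<cdot> i' = h \<cdot> i'" "g \<cdot> f' = h \<cdot> f'"
  shows "g = h"
proof -
  note p = pushoutD[OF assms(1)]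
  have "(g \<cdot> f') \<cdot> i = (g \<cdot> i') \<cdot> f" using p assms(2-6) by simp
  moreover have "g \<cdot> i' \<in> Arr C" "g \<cdot> f' \<in> Arr C" "Dom C (g \<cdot> i') = Cod C f"
    "Dom C (g \<cdot> f') = Cod C i" "Cod C (g \<cdot> i') = Cod C (g \<cdot> f')" "Cod C (g \<cdot> i') = Cod C g"
    using p assms(2-6) by auto
  ultimately have "\<exists>!k. k \<in> Hom C (Cod C i') (Cod C g) \<and> k \<cdot> i' = g \<cdot> i' \<and> k \<cdot> f' = g \<cdot> f'"
    using pushout_ex1[OF assms(1), of "g \<cdot> i'" "g \<cdot> f'"] by metis
  then show ?thesis using assms by (metis Hom_iff)
qed

lemma is_pushoutI:
  assumes "i \<in> Arr C" "f \<in> Arr C" "i' \<in> Arr C" "f' \<in> Arr C"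
    "Dom C i = Dom C f" "Dom C i' = Cod C f" "Dom C f' = Cod C i" "Cod C i' = Cod C f'"
    "f' \<cdot> i = i' \<cdot> f"
    and "\<And>u v. \<lbrakk>u \<in> Arr C; v \<in> Arr C; Dom C u = Cod C f; Dom C v = Cod C i; Cod C u = Cod C v;
      v \<cdot> i = u \<cdot> f\<rbrakk> \<Longrightarrow> \<exists>h \<in> Hom C (Cod C i') (Cod C v). h \<cdot> i' = u \<and> h \<cdot> f' = v"
    and "\<And>g h. \<lbrakk>g \<in> Arr C; h \<in> Arr C; Dom C g = Cod C i'; Dom C h = Cod C i'; Cod C g = Cod C h;
      g \<cdot> i' = h \<cdot> i'; g \<cdot> f' = h \<cdot> f'\<rbrakk> \<Longrightarrow> g = h"
  shows "is_pushout C i f i' f'"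
  unfolding is_pushout_def
proof (intro conjI ballI impI)
  fix u v assume "u \<in> Arr C" "v \<in> Arr C"
    "Dom C u = Cod C f \<and> Dom C v = Cod C i \<and> Cod C u = Cod C v \<and> v \<cdot> i = u \<cdot> f"
  then obtain h where "h \<in> Hom C (Cod C i') (Cod C u)" "h \<cdot> i' = u \<and> h \<cdot> f' = v"
    using assms(10)[of u v] by auto
  then show "\<exists>!h. h \<in> Hom C (Cod C i') (Cod C u) \<and> h \<cdot> i' = u \<and> h \<cdot> f' = v"
    using assms(11) by (metis Hom_iff)
qed (use assms in auto)

lemma is_pushout_commute:
  assumes "is_pushout C i f i' f'"
  shows "is_pushout C f i f' i'"
proof (rule is_pushoutI)
  fix u v assume "u \<in> Arr C" "v \<in> Arr C" "Dom C u = Cod C i" "Dom C v = Cod C f"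
    "Cod C u = Cod C v" "v \<cdot> f = u \<cdot> i"
  then show "\<exists>h \<in> Hom C (Cod C f') (Cod C v). h \<cdot> f' = u \<and> h \<cdot> i' = v"
    using pushout_ex1[OF assms, of v u] pushoutD[OF assms] by metis
next
  fix g h assume "g \<in> Arr C" "h \<in> Arr C" "Dom C g = Cod C f'" "Dom C h = Cod C f'"
    "Cod C g = Cod C h" "g \<cdot> f' = h \<cdot> f'" "g \<cdot> i' = h \<cdot> i'"
  then show "g = h" using pushout_ext[OF assms, of g h] pushoutD[OF assms] by metis
qed (use pushoutD[OF assms] in auto)

text \<open>The axiom provides one pushout that is an inflation; any other pushout of the same span
  differs from it by an isomorphism.\<close>

lemma pushout_inflation:
  assumes "inflation C i" "is_pushout C i f i' f'"
  shows "inflation C i'"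
proof -
  note p = pushoutD[OF assms(2)]
  obtain k g where po: "is_pushout C i f k g" and k: "inflation C k"
    using inflation_pushout[OF assms(1), of f] p by auto
  note q = pushoutD[OF po]
  obtain h where h: "h \<in> Arr C" "Dom C h = Cod C k" "Cod C h = Cod C i'" "h \<cdot> k = i'" "h \<cdot> g = f'"
    using pushout_factor[OF po p(3,4)] p by auto
  obtain h' where h': "h' \<in> Arr C" "Dom C h' = Cod C i'" "Cod C h' = Cod C k" "h' \<cdot> i' = k" "h' \<cdot> f' = g"
    using pushout_factor[OF assms(2) q(3,4)] q by auto
  have "h' \<cdot> h = Ident C (Cod C k)"
    by (rule pushout_ext[OF po]) (use q h h' in simp_all)
  moreover have "h \<cdot> h' = Ident C (Cod C i')"
    by (rule pushout_ext[OF assms(2)]) (use p h h' in simp_all)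
  ultimately have "is_iso C h" using h h' by (metis is_isoI)
  then show ?thesis using inflation_iso[OF k, of h] h by simp
qed

text \<open>Pushing out does not change the cokernel: \<open>d\<close> and zero agree on the span
  and induce \<open>d'\<close>, and an arrow killing \<open>i'\<close> gives, after composition with
  \<open>f'\<close>, one that kills \<open>i\<close> and so factors through
  \<open>d\<close>.\<close>

lemma pushout_Conf:
  assumes "(i, d) \<in> Conf C" "is_pushout C i f i' f'"
  obtains d' where "(i', d') \<in> Conf C" "Cod C d' = Cod C d" "d' \<cdot> f' = d"
proof -
  note p = pushoutD[OF assms(2)] and cd = confD[OF assms(1)]
  have "d \<cdot> i = Zero C (Cod C f) (Cod C d) \<cdot> f" using p cd by auto
  then obtain d' where d': "d' \<in> Arr C" "Dom C d' = Cod C i'" "Cod C d' = Cod C d"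
    "d' \<cdot> i' = Zero C (Cod C f) (Cod C d)" "d' \<cdot> f' = d"
    using pushout_factor[OF assms(2), of "Zero C (Cod C f) (Cod C d)" d "Cod C d"] p cd by auto
  have "is_cokernel C d' i'"
  proof (rule is_cokernelI)
    fix u assume u: "u \<in> Arr C" "Dom C u = Cod C i'" "u \<cdot> i' = Zero C (Dom C i') (Cod C u)"
    have "(u \<cdot> f') \<cdot> i = u \<cdot> (i' \<cdot> f)" using u p by simp
    also have "\<dots> = Zero C (Dom C i) (Cod C u)"
      using u(1,2) p(1-8) by (simp add: Comp_reassoc[OF u(3)])
    finally obtain h where h: "h \<in> Arr C" "Dom C h = Cod C d" "Cod C h = Cod C u" "h \<cdot> d = u \<cdot> f'"
      using cokernel_factor[OF cd(6), of "u \<cdot> f'"] u p by auto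
    have "h \<cdot> d' = u"
      by (rule pushout_ext[OF assms(2)]) (use d' h u p in simp_all)
    then show "\<exists>h \<in> Hom C (Cod C d') (Cod C u). h \<cdot> d' = u" using h d' by auto
  next
    fix u v assume uv: "u \<in> Arr C" "v \<in> Arr C" "Cod C u = Cod C v" "Dom C u = Cod C d'"
      "Dom C v = Cod C d'" "u \<cdot> d' = v \<cdot> d'"
    then have "(u \<cdot> d') \<cdot> f' = (v \<cdot> d') \<cdot> f'" by simp
    then have "u \<cdot> d = v \<cdot> d" using uv(1-5) d' p by simp
    then show "u = v" using cokernel_epi[OF cd(6)] uv d' by simp
  qed (use d' p in auto)
  then have "(i', d') \<in> Conf C"
    using inflation_cokernel_Conf pushout_inflation[OF cd(7) assms(2)] by blast
  then show ?thesis using that d' by blast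
qed

lemma Conf_pushout:
  assumes "(i, d) \<in> Conf C" "f \<in> Arr C" "Dom C f = Dom C i"
  obtains i' d' f' where "(i', d') \<in> Conf C" "is_pushout C i f i' f'" "Cod C d' = Cod C d" "d' \<cdot> f' = d"
proof -
  obtain i' f' where p: "is_pushout C i f i' f'"
    using inflation_pushout[OF confD(7)[OF assms(1)] assms(2,3)] by blast
  show ?thesis using pushout_Conf[OF assms(1) p] p that by metis
qed

text \<open>The identity is a deflation, so it has a kernel that is an inflation. This kernel is a
  zero arrow and a monomorphism at once, which makes its source a zero object.\<close>

lemma zero_inflation:
  assumes "A \<in> Obj C"
  obtains Z where "is_zero_obj C Z" "inflation C (Zero C Z A)"
proof -
  obtain z where z: "(z, Ident C A) \<in> Conf C" using Ident_deflation[OF assms] by (auto simp: deflation_def)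
  note c = confD[OF z]
  have 0: "z = Zero C (Dom C z) A" using c assms by simp
  have "Ident C (Dom C z) = Zero C (Dom C z) (Dom C z)"
    by (rule kernel_mono[OF c(5)]) (use c assms 0 in auto)
  then have "is_zero_obj C (Dom C z)" using c by (simp add: zero_obj_Ident)
  then show ?thesis using that 0 c by metis
qed

text \<open>A biproduct is the pushout of the arrows from a zero object to \<open>A\<close> and to
  \<open>B\<close>, so \<open>jA\<close> is a pushout of the inflation from zero to
  \<open>B\<close>.\<close>

lemma biproduct_Conf:
  assumes "is_biproduct C S A B jA jB pA pB"
  shows "(jA, pB) \<in> Conf C"
proof -
  note b = is_biproductD[OF assms]
  obtain Z where Z: "is_zero_obj C Z" "inflation C (Zero C Z B)" using zero_inflation[OF b(3)] .
  have [simp]: "Z \<in> Obj C" by (rule zero_obj_Obj[OF Z(1)])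
  have "is_pushout C (Zero C Z B) (Zero C Z A) jA jB"
  proof (rule is_pushoutI)
    fix u v assume uv: "u \<in> Arr C" "v \<in> Arr C" "Dom C u = Cod C (Zero C Z A)" "Dom C v = Cod C (Zero C Z B)"
      "Cod C u = Cod C v"
    then have "Dom C u = A" "Dom C v = B" using b by auto
    then obtain h where "h \<in> Arr C" "Dom C h = S" "Cod C h = Cod C v" "h \<cdot> jA = u" "h \<cdot> jB = v"
      using biproduct_copair[OF assms uv(1,2)] uv(5) by metis
    then show "\<exists>h \<in> Hom C (Cod C jA) (Cod C v). h \<cdot> jA = u \<and> h \<cdot> jB = v" using b by auto
  next
    fix g h assume "g \<in> Arr C" "h \<in> Arr C" "Dom C g = Cod C jA" "Dom C h = Cod C jA"
      "g \<cdot> jA = h \<cdot> jA" "g \<cdot> jB = h \<cdot> jB"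
    then show "g = h" using biproduct_right_ext[OF assms] b by auto
  qed (use b in auto)
  then have "inflation C jA" by (rule pushout_inflation[OF Z(2)])
  then show ?thesis by (rule inflation_cokernel_Conf[OF _ biproduct_cokernel[OF assms]])
qed

lemma biproduct_Conf': "is_biproduct C S A B jA jB pA pB \<Longrightarrow> (jB, pA) \<in> Conf C"
  by (rule biproduct_Conf[OF is_biproduct_commute])

end

section \<open>Weak idempotent completeness: duality and cancellation\<close>

locale wic_exact = exact_category C for C :: "('o, 'm) exact_cat" (structure) +
  assumes wic: "weakly_idempotent_complete C"
begin

text \<open>Reversing arrows permutes the axioms. Only closure of conflations under isomorphism
  needs work: its comparison isomorphisms point the wrong way afterwards and are replaced by their
  inverses.\<close>

lemma exact_op_cat: "exact_category (op_cat C)"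
proof (intro exact_category.intro exact_category_axioms.intro additive_category.intro
    additive_category_axioms.intro preadditive_category.intro preadditive_category_axioms.intro
    category.intro)
  fix i d assume "(i, d) \<in> Conf (op_cat C)"
  then show "is_kernel (op_cat C) i d \<and> is_cokernel (op_cat C) d i" using confD[of d i] by auto
next
  fix i d i' d' a b c
  assume *: "(i, d) \<in> Conf (op_cat C)" "i' \<in> Arr (op_cat C)" "d' \<in> Arr (op_cat C)"
    "Cod (op_cat C) i' = Dom (op_cat C) d'" "a \<in> Hom (op_cat C) (Dom (op_cat C) i) (Dom (op_cat C) i')"
    "b \<in> Hom (op_cat C) (Cod (op_cat C) i) (Cod (op_cat C) i')"
    "c \<in> Hom (op_cat C) (Cod (op_cat C) d) (Cod (op_cat C) d')"
    "is_iso (op_cat C) a" "is_iso (op_cat C) b" "is_iso (op_cat C) c"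
    "b \<cdot>\<^bsub>op_cat C\<^esub> i = i' \<cdot>\<^bsub>op_cat C\<^esub> a" "c \<cdot>\<^bsub>op_cat C\<^esub> d = d' \<cdot>\<^bsub>op_cat C\<^esub> b"
  have di: "(d, i) \<in> Conf C" using *(1) by simp
  note cd = confD[OF di]
  obtain a' where a: "a' \<in> Arr C" "Dom C a' = Cod C a" "Cod C a' = Dom C a"
    "a' \<cdot> a = Ident C (Dom C a)" "a \<cdot> a' = Ident C (Cod C a)" using *(8) is_isoE[of a] by auto
  obtain b' where b: "b' \<in> Arr C" "Dom C b' = Cod C b" "Cod C b' = Dom C b"
    "b' \<cdot> b = Ident C (Dom C b)" "b \<cdot> b' = Ident C (Cod C b)" using *(9) is_isoE[of b] by auto
  obtain c' where c: "c' \<in> Arr C" "Dom C c' = Cod C c" "Cod C c' = Dom C c"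
    "c' \<cdot> c = Ident C (Dom C c)" "c \<cdot> c' = Ident C (Cod C c)" using *(10) is_isoE[of c] by auto
  have o: "i' \<in> Arr C" "d' \<in> Arr C" "Dom C i' = Cod C d'" "a \<in> Arr C" "b \<in> Arr C" "c \<in> Arr C"
    "Cod C a = Cod C i" "Dom C a = Cod C i'" "Cod C b = Dom C i" "Dom C b = Cod C d'"
    "Cod C c = Dom C d" "Dom C c = Dom C d'" "i \<cdot> b = a \<cdot> i'" "d \<cdot> c = b \<cdot> d'"
    using * by auto
  have inv: "is_iso C a'" "is_iso C b'" "is_iso C c'"
    by (rule is_isoI[where g = a] is_isoI[where g = b] is_isoI[where g = c];
        use a b c o in simp)+
  have 1: "b' \<cdot> d = d' \<cdot> c'"
  proof -
    have "b' \<cdot> d = b' \<cdot> ((d \<cdot> c) \<cdot> c')" using o(1-12) a b c cd by simp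
    also have "\<dots> = (b' \<cdot> b) \<cdot> (d' \<cdot> c')" using o a(1-3) b(1-3) c(1-3) cd by simp
    finally show ?thesis using o(1-12) b c by simp
  qed
  have 2: "a' \<cdot> i = i' \<cdot> b'"
  proof -
    have "a' \<cdot> i = a' \<cdot> ((i \<cdot> b) \<cdot> b')" using o(1-12) a b c cd by simp
    also have "\<dots> = (a' \<cdot> a) \<cdot> (i' \<cdot> b')" using o a(1-3) b(1-3) c(1-3) cd by simp
    finally show ?thesis using o(1-12) b a by simp
  qed
  have "(d', i') \<in> Conf C"
    by (rule Conf_iso[OF di, of d' i' c' b' a']) (use o a b c inv 1 2 cd in auto)
  then show "(i', d') \<in> Conf (op_cat C)" by simp
next
  show "\<exists>Z. is_zero_obj (op_cat C) Z" using zero_obj_exists by simp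
next
  fix A B assume "A \<in> Obj (op_cat C)" "B \<in> Obj (op_cat C)"
  then show "\<exists>S jA jB pA pB. is_biproduct (op_cat C) S A B jA jB pA pB"
    using biproduct_exists by (simp, metis)
next
  fix A B assume "A \<in> Obj (op_cat C)" "B \<in> Obj (op_cat C)"
  then show "comm_group (Hom_group (op_cat C) A B)" by (simp add: Hom_comm_group)
next
  fix i f assume "inflation (op_cat C) i" "f \<in> Arr (op_cat C)" "Dom (op_cat C) f = Dom (op_cat C) i"
  then show "\<exists>i' f'. is_pushout (op_cat C) i f i' f' \<and> inflation (op_cat C) i'"
    using deflation_pullback[of i f] by simp
next
  fix d f assume "deflation (op_cat C) d" "f \<in> Arr (op_cat C)" "Cod (op_cat C) f = Cod (op_cat C) d"
  then show "\<exists>d' f'. is_pullback (op_cat C) d f d' f' \<and> deflation (op_cat C) d'"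
    using inflation_pushout[of d f] by simp
qed (auto simp: Ident_inflation Ident_deflation inflation_Comp deflation_Comp)

lemma split_epi_deflation: "split_epi C f \<Longrightarrow> deflation C f"
  using wic by (simp add: weakly_idempotent_complete_def)

text \<open>The retraction is a split epimorphism, hence a deflation, and so has a kernel; that
  kernel is the complement of \<open>m\<close>. This is how weak idempotent completeness makes every
  retract a direct summand.\<close>

lemma split_mono_biproduct:
  assumes "r \<in> Arr C" "m \<in> Arr C" "Dom C r = Cod C m" "Cod C r = Dom C m" "r \<cdot> m = Ident C (Dom C m)"
  obtains k q where "is_biproduct C (Cod C m) (Dom C m) (Dom C k) m k r q" "(k, r) \<in> Conf C" "(m, q) \<in> Conf C"
proof -
  have "split_epi C r" using assms by (auto simp: split_epi_def)
  then obtain k where k: "(k, r) \<in> Conf C" using split_epi_deflation by (auto simp: deflation_def)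
  note c = confD[OF k]
  obtain q where "is_biproduct C (Dom C r) (Dom C k) (Cod C r) k m q r"
    using split_kernel_biproduct[OF c(5), of m] assms by auto
  then have b: "is_biproduct C (Cod C m) (Dom C m) (Dom C k) m k r q"
    using assms is_biproduct_commute by metis
  then show ?thesis using that k biproduct_Conf by blast
qed

lemma split_mono_inflation: "split_mono C f \<Longrightarrow> inflation C f"
  unfolding split_mono_def by (metis split_mono_biproduct confD(7) Hom_iff)

text \<open>Split monomorphisms being inflations is weak idempotent completeness of the opposite
  category; from here on the dual statements come for free.\<close>

lemma wic_op_cat: "wic_exact (op_cat C)"
proof -
  show ?thesis
    by (intro wic_exact.intro wic_exact_axioms.intro exact_op_cat) (auto simp: weakly_idempotent_complete_def split_mono_inflation)
qed

lemmas pullback_dual = wic_exact.axioms(1)[OF wic_op_cat]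
lemmas pullback_factor = exact_category.pushout_factor[OF pullback_dual, simplified]
lemmas pullbackD = exact_category.pushoutD[OF pullback_dual, simplified]
lemmas is_pullbackI = exact_category.is_pushoutI[OF pullback_dual, simplified]
lemmas pullback_deflation = exact_category.pushout_inflation[OF pullback_dual, simplified]
lemmas Conf_pullback = exact_category.Conf_pushout[OF pullback_dual, simplified]
lemmas deflation_kernel_Conf = exact_category.inflation_cokernel_Conf[OF pullback_dual, simplified]

lemma deflation_iso:
  assumes "deflation C d" "h \<in> Arr C" "is_iso C h" "Cod C h = Dom C d"
  shows "deflation C (d \<cdot> h)"
  using exact_category.inflation_iso[OF pullback_dual, of d h] assms by simp

text \<open>The kernel of \<open>g \<cdot> pB\<close> contains \<open>A\<close> as a summand, since
  \<open>jA\<close> factors through it. Splitting \<open>A\<close> off leaves the candidate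
  \<open>k\<close> for the kernel of \<open>g\<close>.\<close>

lemma deflation_biproduct_projection:
  assumes "is_biproduct C S B A jB jA pB pA" "g \<in> Arr C" "Dom C g = B" "deflation C (g \<cdot> pB)"
  shows "deflation C g"
proof -
  note b = is_biproductD[OF assms(1)]
  obtain \<kappa> where cf: "(\<kappa>, g \<cdot> pB) \<in> Conf C" using assms(4) by (auto simp: deflation_def)
  note c = confD[OF cf]
  have [simp]: "\<kappa> \<in> Arr C" "Cod C \<kappa> = S" using c assms b by auto
  have "(g \<cdot> pB) \<cdot> jA = Zero C A (Cod C g)" using assms b by simp
  then obtain \<alpha> where \<alpha>: "\<alpha> \<in> Arr C" "Dom C \<alpha> = A" "Cod C \<alpha> = Dom C \<kappa>" "\<kappa> \<cdot> \<alpha> = jA"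
    using kernel_factor[OF c(5), of jA] assms(2,3) b by auto
  have "(pA \<cdot> \<kappa>) \<cdot> \<alpha> = Ident C A" "pA \<cdot> \<kappa> \<in> Arr C" "Dom C (pA \<cdot> \<kappa>) = Dom C \<kappa>" "Cod C (pA \<cdot> \<kappa>) = A"
    using \<alpha> b by simp_all
  then obtain k\<^sub>0 \<pi> where bi: "is_biproduct C (Dom C \<kappa>) A (Dom C k\<^sub>0) \<alpha> k\<^sub>0 (pA \<cdot> \<kappa>) \<pi>"
    using split_mono_biproduct[of "pA \<cdot> \<kappa>" \<alpha>] \<alpha>(1-3) by metis
  note b0 = is_biproductD[OF bi]
  define k where "k = pB \<cdot> (\<kappa> \<cdot> k\<^sub>0)"
  have k [simp]: "k \<in> Arr C" "Dom C k = Dom C k\<^sub>0" "Cod C k = B" using b b0 by (auto simp: k_def)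
  have pB\<kappa>: "pB \<cdot> \<kappa> = k \<cdot> \<pi>"
  proof -
    have "pB \<cdot> \<kappa> = ((pB \<cdot> \<kappa>) \<cdot> \<alpha>) \<cdot> (pA \<cdot> \<kappa>) \<^bold>+ ((pB \<cdot> \<kappa>) \<cdot> k\<^sub>0) \<cdot> \<pi>"
      by (rule biproduct_decomp_right[OF bi]) (use b in auto)
    also have "(pB \<cdot> \<kappa>) \<cdot> \<alpha> = Zero C A B" using \<alpha> b by simp
    also have "(pB \<cdot> \<kappa>) \<cdot> k\<^sub>0 = k" using b b0 by (simp add: k_def)
    finally show ?thesis using b b0 by simp
  qed
  \<comment> \<open>Discarding \<open>A\<close> from the kernel and from \<open>S\<close>
    simultaneously is a pushout, so the conflation ending in \<open>g \<cdot> pB\<close> is carried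
    to one starting with \<open>k\<close>; its deflation is \<open>g\<close> because
    \<open>pB\<close> can be cancelled.\<close>
  have "is_pushout C \<kappa> \<pi> k pB"
  proof (rule is_pushoutI)
    fix u v assume uv: "u \<in> Arr C" "v \<in> Arr C" "Dom C u = Cod C \<pi>" "Dom C v = Cod C \<kappa>"
      "Cod C u = Cod C v" "v \<cdot> \<kappa> = u \<cdot> \<pi>"
    have "v \<cdot> jA = (v \<cdot> \<kappa>) \<cdot> \<alpha>" using uv(1-5) \<alpha> by simp
    also have "\<dots> = Zero C A (Cod C v)" using uv b0 \<alpha>(1-3) by simp
    finally have vjA: "v \<cdot> jA = Zero C A (Cod C v)" .
    have vj: "v = v \<cdot> (jB \<cdot> pB)"
      using biproduct_decomp_right[OF assms(1), of v] uv(1-5) b by (simp add: vjA)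
    have "(v \<cdot> jB) \<cdot> k = (v \<cdot> (jB \<cdot> pB)) \<cdot> (\<kappa> \<cdot> k\<^sub>0)" using uv(1-5) b b0 by (simp add: k_def)
    also have "\<dots> = (v \<cdot> \<kappa>) \<cdot> k\<^sub>0" using uv(1-5) b0 vj by simp
    also have "\<dots> = u" using uv b0 by simp
    finally show "\<exists>h \<in> Hom C (Cod C k) (Cod C v). h \<cdot> k = u \<and> h \<cdot> pB = v"
      using uv vj b by (intro bexI[of _ "v \<cdot> jB"]) auto
  next
    fix f h assume *: "f \<in> Arr C" "h \<in> Arr C" "Dom C f = Cod C k" "Dom C h = Cod C k" "f \<cdot> pB = h \<cdot> pB"
    have "(w \<cdot> pB) \<cdot> jB = w" if "w \<in> Arr C" "Dom C w = B" for w using that b by simp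
    then show "f = h" using * by (metis k(3))
  qed (use b b0 pB\<kappa> in auto)
  then obtain d where d: "(k, d) \<in> Conf C" "Cod C d = Cod C (g \<cdot> pB)" "d \<cdot> pB = g \<cdot> pB"
    using pushout_Conf[OF cf] by blast
  have "(w \<cdot> pB) \<cdot> jB = w" if "w \<in> Arr C" "Dom C w = B" for w using that b by simp
  then have "d = g" using d assms(2,3) confD[OF d(1)] by (metis k(3))
  then show ?thesis using d(1) by (auto simp: deflation_def)
qed

text \<open>On the biproduct of \<open>B\<close> and \<open>A\<close>, the arrow with components
  \<open>g\<close> and \<open>g \<cdot> f\<close> is a deflation: it is \<open>1\<close> plus
  \<open>g \<cdot> f\<close>, a pullback of the given deflation, followed by the split epimorphism
  \<open>(g, 1)\<close>. An automorphism removes its second component, which leaves \<open>g\<close>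
  precomposed with a projection.\<close>

lemma deflation_cancel:
  assumes "f \<in> Arr C" "g \<in> Arr C" "Cod C f = Dom C g" "deflation C (g \<cdot> f)"
  shows "deflation C g"
proof -
  let ?A = "Dom C f" and ?B = "Dom C g" and ?D = "Cod C g"
  obtain S jB jA pB pA where bS: "is_biproduct C S ?B ?A jB jA pB pA"
    using biproduct_exists[of ?B ?A] assms by auto
  obtain T iB iD qB qD where bT: "is_biproduct C T ?B ?D iB iD qB qD"
    using biproduct_exists[of ?B ?D] assms by auto
  note s = is_biproductD[OF bS] and t = is_biproductD[OF bT]
  define e where "e = g \<cdot> f"
  have e: "e \<in> Arr C" "Dom C e = ?A" "Cod C e = ?D" using assms by (auto simp: e_def)
  obtain h where h: "h \<in> Arr C" "Cod C h = T" "Dom C h = S" "qB \<cdot> h = pB" "qD \<cdot> h = e \<cdot> pA"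
    "h = iB \<cdot> pB \<^bold>+ iD \<cdot> (e \<cdot> pA)"
    using biproduct_pair[OF bT, of pB "e \<cdot> pA" S] e s by auto
  have "is_pullback C e qD h pA"
  proof (rule is_pullbackI)
    fix u v assume uv: "u \<in> Arr C" "v \<in> Arr C" "Cod C u = Dom C qD" "Cod C v = Dom C e"
      "Dom C u = Dom C v" "e \<cdot> v = qD \<cdot> u"
    have "qB \<cdot> u \<in> Arr C" "Cod C (qB \<cdot> u) = ?B" "Dom C (qB \<cdot> u) = Dom C v"
      using uv(1-5) t(1-15) by simp_all
    then obtain w where w: "w \<in> Arr C" "Cod C w = S" "Dom C w = Dom C v" "pB \<cdot> w = qB \<cdot> u" "pA \<cdot> w = v"
      using biproduct_pair[OF bS, of "qB \<cdot> u" v "Dom C v"] uv(2,4) e(2) by metis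
    have "qB \<cdot> (h \<cdot> w) = qB \<cdot> u"
      by (subst Comp_reassoc[OF h(4)]) (use w(1-4) h(1-3) t(1-15) in auto)
    moreover have "qD \<cdot> (h \<cdot> w) = qD \<cdot> u"
      by (subst Comp_reassoc[OF h(5)]) (use w h(1-3) t(1-15) s(1-15) e uv in auto)
    ultimately have "h \<cdot> w = u"
      using biproduct_left_ext[OF bT, of "h \<cdot> w" u] w(1-3) h(1-3) uv(1-3) t(1-15) by simp
    then show "\<exists>w \<in> Hom C (Dom C v) (Dom C h). h \<cdot> w = u \<and> pA \<cdot> w = v" using w h(1-3) by auto
  next
    fix u v assume uv: "u \<in> Arr C" "v \<in> Arr C" "Cod C u = Dom C h" "Cod C v = Dom C h"
      "Dom C u = Dom C v" "h \<cdot> u = h \<cdot> v" "pA \<cdot> u = pA \<cdot> v"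
    have "pB \<cdot> w = qB \<cdot> (h \<cdot> w)" if "w \<in> Arr C" "Cod C w = S" for w
      using that h(1-3) t by (simp add: Comp_reassoc[OF h(4)])
    then have "pB \<cdot> u = pB \<cdot> v" using uv h by metis
    then show "u = v" using biproduct_left_ext[OF bS, of u v] uv h by auto
  qed (use e h t s in auto)
  then have h_defl: "deflation C h" using pullback_deflation assms(4) by (simp add: e_def)
  obtain r where r: "r \<in> Arr C" "Dom C r = T" "Cod C r = ?D" "r \<cdot> iB = g" "r \<cdot> iD = Ident C ?D"
    "r = g \<cdot> qB \<^bold>+ Ident C ?D \<cdot> qD"
    using biproduct_copair[OF bT, of g "Ident C ?D" ?D] assms by auto
  have "split_epi C r" unfolding split_epi_def using r(1-5) t(1-15) by (intro conjI bexI[of _ iD]) simp_all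
  then have rh: "deflation C (r \<cdot> h)"
    using deflation_Comp[OF h_defl split_epi_deflation] h(2) r(2) by metis
  \<comment> \<open>A shear of the biproduct with inverse \<open>\<psi>\<close>: it subtracts
    \<open>f\<close> of the \<open>A\<close>-coordinate from the \<open>B\<close>-coordinate, which
    cancels the component \<open>g \<cdot> f\<close>.\<close>
  define \<phi> where "\<phi> = Ident C S \<^bold>+ neg (jB \<cdot> (f \<cdot> pA))"
  define \<psi> where "\<psi> = Ident C S \<^bold>+ jB \<cdot> (f \<cdot> pA)"
  have \<phi>: "\<phi> \<in> Arr C" "Dom C \<phi> = S" "Cod C \<phi> = S" and \<psi>: "\<psi> \<in> Arr C" "Dom C \<psi> = S" "Cod C \<psi> = S"
    using s assms by (auto simp: \<phi>_def \<psi>_def)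
  have 0: "jB \<cdot> (f \<cdot> (pA \<cdot> (jB \<cdot> (f \<cdot> pA)))) = Zero C S S"
    using s assms by (simp add: Comp_reassoc[OF s(18)])
  have "is_iso C \<phi>"
    by (rule is_isoI[where g = \<psi>])
      (use \<phi> \<psi> s(1-15) assms in \<open>simp_all add: \<phi>_def \<psi>_def 0 Plus_assoc\<close>)
  moreover have "(r \<cdot> h) \<cdot> \<phi> = g \<cdot> pB"
  proof -
    have "r \<cdot> h = g \<cdot> pB \<^bold>+ e \<cdot> pA"
      using r(1-5) h(1-3) s t e assms(2) by (simp add: h(6) Comp_reassoc[OF r(4)] Comp_reassoc[OF r(5)])
    then show ?thesis
      using s e assms(1-3)
      by (simp add: \<phi>_def Comp_reassoc[OF s(16)] Comp_reassoc[OF s(17)] Comp_reassoc[OF s(18)]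
          Comp_reassoc[OF s(19)] Plus_assoc e_def)
  qed
  ultimately have "deflation C (g \<cdot> pB)"
    using deflation_iso[OF rh \<phi>(1)] \<phi> r h by simp
  then show ?thesis
    using deflation_biproduct_projection[OF bS assms(2)] by simp
qed

lemma inflation_cancel:
  assumes "f \<in> Arr C" "g \<in> Arr C" "Cod C f = Dom C g" "inflation C (g \<cdot> f)"
  shows "inflation C f"
  using wic_exact.deflation_cancel[OF wic_op_cat, of g f] assms by simp

end

section \<open>Vanishing of Ext\<close>

context wic_exact
begin

text \<open>Vanishing of Ext in working form: each splitting supplies a retraction and a section
  directly, without passing through equivalence classes of extensions.\<close>

definition ext_vanish :: "'o \<Rightarrow> 'o \<Rightarrow> bool" where
  "ext_vanish Z X \<longleftrightarrow> (\<forall>i d. (i, d) \<in> Conf C \<and> Dom C i = X \<and> Cod C d = Z \<longrightarrow>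
    (\<exists>r s. is_biproduct C (Dom C d) X Z i s r d))"

lemma ext_vanishE:
  assumes "ext_vanish (Cod C d) (Dom C i)" "(i, d) \<in> Conf C"
  obtains r s where "is_biproduct C (Dom C d) (Dom C i) (Cod C d) i s r d"
  using assms unfolding ext_vanish_def by blast

lemma ext_vanish_retractionI:
  assumes "\<And>i d. (i, d) \<in> Conf C \<Longrightarrow> Dom C i = X \<Longrightarrow> Cod C d = Z \<Longrightarrow>
    \<exists>r. r \<in> Arr C \<and> Dom C r = Dom C d \<and> Cod C r = X \<and> r \<cdot> i = Ident C X"
  shows "ext_vanish Z X"
  unfolding ext_vanish_def
proof (intro allI impI)
  fix i d assume *: "(i, d) \<in> Conf C \<and> Dom C i = X \<and> Cod C d = Z"
  then obtain r where r: "r \<in> Arr C" "Dom C r = Dom C d" "Cod C r = X" "r \<cdot> i = Ident C X"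
    using assms by blast
  note c = confD[of i d]
  show "\<exists>r s. is_biproduct C (Dom C d) X Z i s r d"
    using split_cokernel_biproduct[OF c(6), of r] * r c(3) by metis
qed

lemma ext_vanish_sectionI:
  assumes "\<And>i d. (i, d) \<in> Conf C \<Longrightarrow> Dom C i = X \<Longrightarrow> Cod C d = Z \<Longrightarrow>
    \<exists>s. s \<in> Arr C \<and> Dom C s = Z \<and> Cod C s = Dom C d \<and> d \<cdot> s = Ident C Z"
  shows "ext_vanish Z X"
  unfolding ext_vanish_def
proof (intro allI impI)
  fix i d assume *: "(i, d) \<in> Conf C \<and> Dom C i = X \<and> Cod C d = Z"
  then obtain s where s: "s \<in> Arr C" "Dom C s = Z" "Cod C s = Dom C d" "d \<cdot> s = Ident C Z"
    using assms by blast
  note c = confD[of i d]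
  show "\<exists>r s. is_biproduct C (Dom C d) X Z i s r d"
    using split_kernel_biproduct[OF c(5), of s] * s by metis
qed

lemma split_extensions_equivalent:
  assumes "is_biproduct C S X Z i s r d" "is_biproduct C S' X Z i' s' r' d'"
  shows "\<exists>h \<in> Hom C S S'. is_iso C h \<and> h \<cdot> i = i' \<and> d' \<cdot> h = d"
proof -
  note b = is_biproductD[OF assms(1)] and b' = is_biproductD[OF assms(2)]
  define h where "h = i' \<cdot> r \<^bold>+ s' \<cdot> d"
  define h' where "h' = i \<cdot> r' \<^bold>+ s \<cdot> d'"
  have h: "h \<in> Arr C" "Dom C h = S" "Cod C h = S'" "h' \<in> Arr C" "Dom C h' = S'" "Cod C h' = S"
    using b b' by (simp_all add: h_def h'_def)
  have e: "h \<cdot> i = i'" "h \<cdot> s = s'" "h' \<cdot> i' = i" "h' \<cdot> s' = s"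
    using b b' by (simp_all add: h_def h'_def)
  have "h' \<cdot> h = Ident C S"
    by (rule biproduct_right_ext[OF assms(1)]) (use h e b b' in simp_all)
  moreover have "h \<cdot> h' = Ident C S'"
    by (rule biproduct_right_ext[OF assms(2)]) (use h e b b' in simp_all)
  ultimately have "is_iso C h" using h by (intro is_isoI[of h h']) simp_all
  moreover have "d' \<cdot> h = d"
    by (rule biproduct_right_ext[OF assms(1)]) (use h e b b' in simp_all)
  ultimately show ?thesis using h e by auto
qed

text \<open>The biproduct extension always exists. If all extensions split they are all equivalent,
  which gives one class; if there is one class, each extension is equivalent to the biproduct, and
  the projection of the biproduct pulls back to a retraction.\<close>

lemma Ext1_zero_iff:
  assumes "Z \<in> Obj C" "X \<in> Obj C"
  shows "Ext1_zero C Z X \<longleftrightarrow> ext_vanish Z X"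
proof
  assume "ext_vanish Z X"
  moreover obtain S jX jZ pX pZ where b: "is_biproduct C S X Z jX jZ pX pZ"
    using biproduct_exists assms by blast
  ultimately have "ext_equiv C Z X = extensions C Z X \<times> extensions C Z X"
    using split_extensions_equivalent confD(3)
    unfolding ext_equiv_def extensions_def ext_vanish_def by (auto; metis)
  moreover have "extensions C Z X \<noteq> {}"
    using biproduct_Conf[OF b] is_biproductD[OF b] unfolding extensions_def by auto
  ultimately have "Ext1 C Z X = {extensions C Z X}"
    unfolding Ext1_def quotient_def by auto
  then show "Ext1_zero C Z X" by (auto simp: Ext1_zero_def)
next
  assume "Ext1_zero C Z X"
  then obtain \<xi> where \<xi>: "Ext1 C Z X = {\<xi>}" by (auto simp: Ext1_zero_def)
  obtain S jX jZ pX pZ where b: "is_biproduct C S X Z jX jZ pX pZ"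
    using biproduct_exists assms by blast
  note bD = is_biproductD[OF b]
  have e0: "(jX, pZ) \<in> extensions C Z X"
    using biproduct_Conf[OF b] bD unfolding extensions_def by auto
  have r0: "((jX, pZ), (jX, pZ)) \<in> ext_equiv C Z X"
    using e0 bD unfolding ext_equiv_def by (auto intro!: bexI[of _ "Ident C S"])
  show "ext_vanish Z X"
  proof (rule ext_vanish_retractionI)
    fix i d assume id: "(i, d) \<in> Conf C" "Dom C i = X" "Cod C d = Z"
    then have "(i, d) \<in> extensions C Z X" by (auto simp: extensions_def)
    moreover have "ext_equiv C Z X `` {e} = \<xi>" if "e \<in> extensions C Z X" for e
      using quotientI[OF that, of "ext_equiv C Z X"] \<xi> by (simp add: Ext1_def)
    ultimately have "ext_equiv C Z X `` {(i, d)} = ext_equiv C Z X `` {(jX, pZ)}" using e0 by simp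
    \<comment> \<open>The split extension belongs to its own class by reflexivity \<open>r0\<close>,
      and this class equals that of \<open>(i, d)\<close>.\<close>
    then have "((i, d), (jX, pZ)) \<in> ext_equiv C Z X" using r0 by blast
    then obtain h where h: "h \<in> Arr C" "Dom C h = Cod C i" "Cod C h = S" "h \<cdot> i = jX"
      using bD unfolding ext_equiv_def by auto
    show "\<exists>r. r \<in> Arr C \<and> Dom C r = Dom C d \<and> Cod C r = X \<and> r \<cdot> i = Ident C X"
      using h bD confD[OF id(1)] by (intro exI[of _ "pX \<cdot> h"]) simp
  qed
qed

text \<open>Pulled back along \<open>v\<close>, the conflation ends at \<open>Z\<close> and splits;
  a section followed by the other leg of the pullback is the lift.\<close>

lemma lift_along_deflation:
  assumes "(k, p) \<in> Conf C" "ext_vanish Z (Dom C k)" "v \<in> Arr C" "Dom C v = Z" "Cod C v = Cod C p"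
  obtains h where "h \<in> Arr C" "Dom C h = Z" "Cod C h = Dom C p" "p \<cdot> h = v"
proof -
  obtain p' k' v' where pb: "(k', p') \<in> Conf C" "is_pullback C p v p' v'" "Dom C k' = Dom C k"
    using Conf_pullback[OF assms(1), of v] assms(3,5) by metis
  note pD = pullbackD[OF pb(2)]
  obtain r s where "is_biproduct C (Dom C p') (Dom C k') (Cod C p') k' s r p'"
    using ext_vanishE[of p' k'] pb assms pD by metis
  note b = is_biproductD[OF this]
  have "p \<cdot> (v' \<cdot> s) = v"
    using pD b assms(3-5) by (simp add: Comp_reassoc[OF pD(9)])
  then show ?thesis using that[of "v' \<cdot> s"] pD b assms(4) by simp
qed

lemma extend_along_inflation:
  assumes "(i, c) \<in> Conf C" "ext_vanish (Cod C c) Y" "v \<in> Arr C" "Cod C v = Y" "Dom C v = Dom C i"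
  obtains h where "h \<in> Arr C" "Cod C h = Y" "Dom C h = Dom C c" "h \<cdot> i = v"
proof -
  obtain i' c' v' where po: "(i', c') \<in> Conf C" "is_pushout C i v i' v'" "Cod C c' = Cod C c"
    using Conf_pushout[OF assms(1), of v] assms(3,5) by metis
  note pD = pushoutD[OF po(2)]
  obtain r s where "is_biproduct C (Dom C c') (Dom C i') (Cod C c') i' s r c'"
    using ext_vanishE[of c' i'] po assms pD by metis
  note b = is_biproductD[OF this]
  have "(r \<cdot> v') \<cdot> i = v"
    using pD b assms(3-5) confD(3)[OF po(1)] by (simp add: Comp_reassoc[OF b(16)])
  then show ?thesis using that[of "r \<cdot> v'"] pD b assms(4) confD(3)[OF po(1)] confD(3)[OF assms(1)] by simp
qed

text \<open>After pulling \<open>p\<close> back to \<open>d' : P' \<rightarrow> B\<close>, the kernel of \<open>c \<cdot> d'\<close> is \<open>Y \<oplus> A\<close>. Pushing it out to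
  \<open>Y\<close> gives a split conflation, whence a retraction \<open>\<rho>\<close> of \<open>Y \<rightarrow> P'\<close> that kills \<open>A\<close>.\<close>

lemma ext_vanish_lifts:
  assumes ic: "(i, c) \<in> Conf C" and kp: "(k, p) \<in> Conf C" and ext: "ext_vanish (Cod C c) (Dom C k)"
  shows "lifts_against C i p"
  unfolding lifts_against_def
proof (intro ballI impI)
  fix u v assume "u \<in> Hom C (Dom C i) (Dom C p)" "v \<in> Hom C (Cod C i) (Cod C p)"
    and eq: "p \<cdot> u = v \<cdot> i"
  then have u: "u \<in> Arr C" "Dom C u = Dom C i" "Cod C u = Dom C p"
    and v: "v \<in> Arr C" "Dom C v = Dom C c" "Cod C v = Cod C p"
    using confD(3)[OF ic] by auto
  note ic' = confD[OF ic] and kp' = confD[OF kp]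
  obtain d k' w where pb: "(k', d) \<in> Conf C" "is_pullback C p v d w" "Dom C k' = Dom C k"
    using Conf_pullback[OF kp, of v] v by metis
  note pD = pullbackD[OF pb(2)] and kd = confD[OF pb(1)]
  have d: "Cod C d = Dom C c" "Dom C w = Dom C d" "Cod C w = Dom C p" "p \<cdot> w = v \<cdot> d"
    using pD v by simp_all
  obtain i' where i': "i' \<in> Arr C" "Dom C i' = Dom C i" "Cod C i' = Dom C d" "d \<cdot> i' = i" "w \<cdot> i' = u"
    using pullback_factor[OF pb(2) ic'(1) u(1)] eq u v ic'(3) by metis
  have "deflation C (c \<cdot> d)" using deflation_Comp[OF kd(8) ic'(8)] d by simp
  then obtain \<kappa> where \<kappa>c: "(\<kappa>, c \<cdot> d) \<in> Conf C" by (auto simp: deflation_def)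
  note \<kappa>0 = confD[OF \<kappa>c]
  have \<kappa>: "\<kappa> \<in> Arr C" "Cod C \<kappa> = Dom C d" "c \<cdot> (d \<cdot> \<kappa>) = Zero C (Dom C \<kappa>) (Cod C c)"
    using \<kappa>0(1-4) kd(1-3) ic'(1-3) d by simp_all
  obtain a where a: "a \<in> Arr C" "Dom C a = Dom C \<kappa>" "Cod C a = Dom C i" "i \<cdot> a = d \<cdot> \<kappa>"
    using kernel_factor[OF ic'(5), of "d \<cdot> \<kappa>"] \<kappa> kd d ic' by auto
  \<comment> \<open>\<open>a\<close> and \<open>\<pi>\<close> are the coordinates of the kernel of
    \<open>c \<cdot> d\<close> on \<open>Dom C i\<close> and on \<open>Dom C k\<close>;
    \<open>\<kappa>\<^sub>2\<close> and \<open>\<kappa>\<^sub>1\<close> below are the matching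
    inclusions.\<close>
  have "d \<cdot> (\<kappa> \<^bold>+ neg (i' \<cdot> a)) = Zero C (Dom C \<kappa>) (Cod C d)"
    using \<kappa> kd(1-3) d a i' ic' by (simp add: Comp_reassoc[OF i'(4)])
  then obtain \<pi> where \<pi>: "\<pi> \<in> Arr C" "Dom C \<pi> = Dom C \<kappa>" "Cod C \<pi> = Dom C k" "k' \<cdot> \<pi> = \<kappa> \<^bold>+ neg (i' \<cdot> a)"
    using kernel_factor[OF kd(5), of "\<kappa> \<^bold>+ neg (i' \<cdot> a)"] \<kappa> kd(1-3) d a(1-3) i'(1-3) pb(3) by auto
  obtain e q m where po: "(e, q) \<in> Conf C" "is_pushout C \<kappa> \<pi> e m" "Cod C q = Cod C (c \<cdot> d)"
    using Conf_pushout[OF \<kappa>c, of \<pi>] \<pi> by metis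
  note qD = pushoutD[OF po(2)] and eq' = confD[OF po(1)]
  have "Cod C q = Cod C c" "Dom C e = Dom C k" using po(3) ic'(1-3) kd(1-3) d qD \<pi> by simp_all
  then obtain \<rho> where \<rho>: "\<rho> \<in> Arr C" "Dom C \<rho> = Dom C q" "Cod C \<rho> = Dom C k" "\<rho> \<cdot> e = Ident C (Dom C k)"
    using ext_vanishE[OF _ po(1)] ext is_biproductD by metis
  define \<sigma> where "\<sigma> = \<rho> \<cdot> m"
  have \<sigma>: "\<sigma> \<in> Arr C" "Dom C \<sigma> = Dom C d" "Cod C \<sigma> = Dom C k"
    using \<rho>(1-3) qD(1-8) eq'(1-3) \<kappa> by (simp_all add: \<sigma>_def)
  have \<sigma>\<kappa>: "\<sigma> \<cdot> \<kappa> = \<pi>"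
    using \<rho> qD eq'(1-3) \<kappa>(1,2) \<pi>(1-3) by (simp add: \<sigma>_def Comp_reassoc[OF \<rho>(4)])
  have "(c \<cdot> d) \<cdot> k' = Zero C (Dom C k) (Cod C c)" using kd ic'(1-3) d pb(3) kp'(1) by simp
  then obtain \<kappa>\<^sub>1 where \<kappa>1: "\<kappa>\<^sub>1 \<in> Arr C" "Dom C \<kappa>\<^sub>1 = Dom C k" "Cod C \<kappa>\<^sub>1 = Dom C \<kappa>" "\<kappa> \<cdot> \<kappa>\<^sub>1 = k'"
    using kernel_factor[OF \<kappa>0(5), of k'] kd(1-3) ic'(1-3) d pb(3) by auto
  have "(c \<cdot> d) \<cdot> i' = Zero C (Dom C i) (Cod C c)" using kd(1-3) ic' d i' by simp
  then obtain \<kappa>\<^sub>2 where \<kappa>2: "\<kappa>\<^sub>2 \<in> Arr C" "Dom C \<kappa>\<^sub>2 = Dom C i" "Cod C \<kappa>\<^sub>2 = Dom C \<kappa>" "\<kappa> \<cdot> \<kappa>\<^sub>2 = i'"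
    using kernel_factor[OF \<kappa>0(5), of i'] kd(1-3) ic'(1-3) d i'(1-3) by auto
  have a1: "a \<cdot> \<kappa>\<^sub>1 = Zero C (Dom C k) (Dom C i)"
    by (rule kernel_mono[OF ic'(5)])
      (use a \<kappa>1 \<kappa> ic' kd d pb(3) kp'(1) in \<open>simp_all add: Comp_reassoc[OF a(4)]\<close>)
  have a2: "a \<cdot> \<kappa>\<^sub>2 = Ident C (Dom C i)"
    by (rule kernel_mono[OF ic'(5)])
      (use a \<kappa>2 \<kappa> ic' kd d i' in \<open>simp_all add: Comp_reassoc[OF a(4)]\<close>)
  have \<pi>1: "\<pi> \<cdot> \<kappa>\<^sub>1 = Ident C (Dom C k)"
    by (rule kernel_mono[OF kd(5)])
      (use a(1-3) a1 \<pi> \<kappa>1 \<kappa>(1,2) kd pb(3) i'(1-3) kp'(1) in \<open>simp_all add: Comp_reassoc[OF \<pi>(4)]\<close>)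
  have \<pi>2: "\<pi> \<cdot> \<kappa>\<^sub>2 = Zero C (Dom C i) (Dom C k)"
    by (rule kernel_mono[OF kd(5)])
      (use a(1-3) a2 \<pi> \<kappa>2 \<kappa>(1,2) kd pb(3) i'(1-3) kp'(1) ic'(1) in \<open>simp_all add: Comp_reassoc[OF \<pi>(4)]\<close>)
  have \<sigma>k: "\<sigma> \<cdot> k' = Ident C (Dom C k)"
    using \<sigma>\<kappa> \<pi>1 \<kappa>1 \<kappa>(1,2) \<sigma> by (metis Comp_reassoc)
  have \<sigma>i: "\<sigma> \<cdot> i' = Zero C (Dom C i) (Dom C k)"
    using \<sigma>\<kappa> \<pi>2 \<kappa>2 \<kappa>(1,2) \<sigma> by (metis Comp_reassoc)
  \<comment> \<open>Since \<open>\<sigma>\<close> retracts \<open>k'\<close> and kills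
    \<open>i'\<close>, this projection kills \<open>k'\<close> and fixes \<open>i'\<close>. It
    descends along \<open>d\<close> to a section \<open>h\<close> with
    \<open>h \<cdot> i = i'\<close>, so that \<open>w \<cdot> h\<close> is the required
    diagonal.\<close>
  define \<theta> where "\<theta> = Ident C (Dom C d) \<^bold>+ neg (k' \<cdot> \<sigma>)"
  have \<theta>: "\<theta> \<in> Arr C" "Dom C \<theta> = Dom C d" "Cod C \<theta> = Dom C d"
    using \<sigma> kd(1-3) pb(3) by (simp_all add: \<theta>_def)
  have "\<theta> \<cdot> k' = Zero C (Dom C k') (Cod C \<theta>)" using \<sigma> \<sigma>k kd(1-3) pb(3) by (simp add: \<theta>_def)
  then obtain h where h: "h \<in> Arr C" "Dom C h = Cod C d" "Cod C h = Dom C d" "h \<cdot> d = \<theta>"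
    using cokernel_factor[OF kd(6), of \<theta>] \<theta> kd(3) by metis
  have "d \<cdot> h = Ident C (Cod C d)"
    by (rule cokernel_epi[OF kd(6)])
      (use h \<sigma> kd pb(3) in \<open>simp_all add: \<theta>_def Comp_reassoc[OF kd(4)]\<close>)
  then have "p \<cdot> (w \<cdot> h) = v"
    using h(1-3) d pD(1-4) v kd(1-3) by (simp add: Comp_reassoc[OF d(4)])
  moreover have "(w \<cdot> h) \<cdot> i = u"
  proof -
    have "(w \<cdot> h) \<cdot> i = w \<cdot> ((h \<cdot> d) \<cdot> i')"
      unfolding i'(4)[symmetric] using h(1-3) d(1-3) pD(1-4) i'(1-3) kd(1-3) by simp
    also have "(h \<cdot> d) \<cdot> i' = i'"
      unfolding h(4) using \<sigma> \<sigma>i kd(1-3) pb(3) i'(1-3) ic'(1) by (simp add: \<theta>_def)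
    finally show ?thesis using i' by simp
  qed
  ultimately show "\<exists>h \<in> Hom C (Cod C i) (Dom C p). h \<cdot> i = u \<and> p \<cdot> h = v"
    using h(1-3) d(1-3) pD(1-4) ic'(1-3) by (intro bexI[of _ "w \<cdot> h"]) simp_all
qed

lemma lifts_againstE:
  assumes "lifts_against C i p" "u \<in> Arr C" "v \<in> Arr C" "Dom C u = Dom C i" "Cod C u = Dom C p"
    "Dom C v = Cod C i" "Cod C v = Cod C p" "p \<cdot> u = v \<cdot> i"
  obtains h where "h \<in> Arr C" "Dom C h = Cod C i" "Cod C h = Dom C p" "h \<cdot> i = u" "p \<cdot> h = v"
  using assms unfolding lifts_against_def by (metis Hom_iff)

text \<open>Closure is assumed for biproduct summands, whereas arguments produce retracts; the
  kernel of the retraction supplies the complement.\<close>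

lemma retract_in_summand_closed:
  assumes "summand_closed C \<X>" "S \<in> \<X>" "s \<in> Arr C" "r \<in> Arr C" "Cod C s = S" "Dom C r = S"
    "Cod C r = Dom C s" "r \<cdot> s = Ident C (Dom C s)"
  shows "Dom C s \<in> \<X>"
proof -
  obtain k q where "is_biproduct C (Cod C s) (Dom C s) (Dom C k) s k r q"
    using split_mono_biproduct[of r s] assms by metis
  then show ?thesis using assms unfolding summand_closed_def by blast
qed

end

section \<open>A pair of additive subcategories\<close>

locale subcat_pair = wic_exact +
  fixes \<X> \<Y> :: "'a set"
  assumes X_additive: "additive_subcat C \<X>" and X_summand: "summand_closed C \<X>"
    and Y_additive: "additive_subcat C \<Y>" and Y_summand: "summand_closed C \<Y>"
begin

abbreviation "\<omega> \<equiv> \<X> \<inter> \<Y>"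

lemma X_Obj [simp]: "A \<in> \<X> \<Longrightarrow> A \<in> Obj C" and Y_Obj [simp]: "A \<in> \<Y> \<Longrightarrow> A \<in> Obj C"
  using X_additive Y_additive by (auto simp: additive_subcat_def)

lemma zero_in_subcat:
  assumes "is_zero_obj C Z" "additive_subcat C \<Z>" "summand_closed C \<Z>"
  shows "Z \<in> \<Z>"
proof -
  obtain Z' where Z': "Z' \<in> \<Z>" "is_zero_obj C Z'" using assms by (auto simp: additive_subcat_def)
  have "Z \<in> Obj C" "Z' \<in> Obj C" using assms(1) Z'(2) zero_obj_Obj by auto
  then show ?thesis
    using retract_in_summand_closed[OF assms(3) Z'(1), of "Zero C Z Z'" "Zero C Z' Z"]
      assms(1)[unfolded zero_obj_Ident] by simp
qed

lemma zero_in: "is_zero_obj C Z \<Longrightarrow> Z \<in> \<X>" "is_zero_obj C Z \<Longrightarrow> Z \<in> \<Y>"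
  using zero_in_subcat X_additive X_summand Y_additive Y_summand by blast+

text \<open>An additive subcategory is only known to contain some biproduct of its objects; any
  other one is a retract of it through the comparison arrows.\<close>

lemma biproduct_in_subcat:
  assumes "is_biproduct C S A B jA jB pA pB" "A \<in> \<Z>" "B \<in> \<Z>" "additive_subcat C \<Z>" "summand_closed C \<Z>"
  shows "S \<in> \<Z>"
proof -
  obtain S' iA iB qA qB where S': "S' \<in> \<Z>" "is_biproduct C S' A B iA iB qA qB"
    using assms unfolding additive_subcat_def by blast
  note b = is_biproductD[OF assms(1)] and b' = is_biproductD[OF S'(2)]
  let ?s = "iA \<cdot> pA \<^bold>+ iB \<cdot> pB" and ?r = "jA \<cdot> qA \<^bold>+ jB \<cdot> qB"
  have "?r \<cdot> ?s = jA \<cdot> pA \<^bold>+ jB \<cdot> pB"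
    using b(1-15) b'(1-15) by (simp add: Comp_reassoc[OF b'(16)] Comp_reassoc[OF b'(17)]
        Comp_reassoc[OF b'(18)] Comp_reassoc[OF b'(19)])
  then show ?thesis
    using retract_in_summand_closed[OF assms(5) S'(1), of ?s ?r] b b'(1-15) by simp
qed

lemma biproduct_in:
  assumes "is_biproduct C S A B jA jB pA pB"
  shows "A \<in> \<X> \<Longrightarrow> B \<in> \<X> \<Longrightarrow> S \<in> \<X>" "A \<in> \<Y> \<Longrightarrow> B \<in> \<Y> \<Longrightarrow> S \<in> \<Y>"
  using biproduct_in_subcat[OF assms] X_additive X_summand Y_additive Y_summand by blast+

text \<open>These turn out to be the trivial fibrations; see \<open>Fib_Int_Weq\<close>.\<close>

definition Ydefl where "Ydefl p \<longleftrightarrow> (\<exists>k. (k, p) \<in> Conf C \<and> Dom C k \<in> \<Y>)"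

lemma Ydefl_iff: "Ydefl p \<longleftrightarrow> deflation C p \<and> Ker_in C p \<Y>"
  unfolding Ydefl_def Ker_in_def using deflation_kernel_Conf confD by blast

lemma Ydefl_Arr: "Ydefl p \<Longrightarrow> p \<in> Arr C"
  unfolding Ydefl_def using confD by blast

lemma CoFib_iff: "f \<in> CoFib\<^sub>\<omega> C \<X> \<longleftrightarrow> (\<exists>c. (f, c) \<in> Conf C \<and> Cod C c \<in> \<X>)"
  unfolding CoFib\<^sub>\<omega>_def Coker_in_def using inflation_cokernel_Conf confD by blast

lemma Fib_iff: "f \<in> Fib\<^sub>\<omega> C \<omega> \<longleftrightarrow> f \<in> Arr C \<and> (\<forall>w \<in> Arr C. Dom C w \<in> \<omega> \<and> Cod C w = Cod C f \<longrightarrow>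
    (\<exists>u \<in> Hom C (Dom C w) (Dom C f). f \<cdot> u = w))"
  (is "?l \<longleftrightarrow> ?r")
proof
  assume l: ?l
  have "\<exists>u \<in> Hom C (Dom C w) (Dom C f). f \<cdot> u = w"
    if "w \<in> Arr C" "Dom C w \<in> \<omega>" "Cod C w = Cod C f" for w
  proof -
    have "w \<in> (\<lambda>u. f \<cdot> u) ` Hom C (Dom C w) (Dom C f)"
      using l that unfolding Fib\<^sub>\<omega>_def by auto
    then show ?thesis by blast
  qed
  then show ?r using l by (simp add: Fib\<^sub>\<omega>_def)
next
  assume r: ?r
  have "Hom C W (Cod C f) \<subseteq> (\<lambda>u. f \<cdot> u) ` Hom C W (Dom C f)" if "W \<in> \<omega>" for W
    using r that by (auto simp: image_iff) metis
  moreover have "(\<lambda>u. f \<cdot> u) ` Hom C W (Dom C f) \<subseteq> Hom C W (Cod C f)" for W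
    using r by auto
  ultimately show ?l using r by (auto simp: Fib\<^sub>\<omega>_def)
qed

lemma Weq_iff: "f \<in> Weq\<^sub>\<omega> C \<omega> \<Y> \<longleftrightarrow> f \<in> Arr C \<and> (\<exists>W \<in> \<omega>. \<exists>S jA jW pA pW g.
    is_biproduct C S (Dom C f) W jA jW pA pW \<and> Ydefl g \<and> Dom C g = S \<and> Cod C g = Cod C f \<and> g \<cdot> jA = f)"
  (is "?l \<longleftrightarrow> ?r")
proof
  assume ?l
  then obtain W S jA jW pA pW g where *: "f \<in> Arr C" "W \<in> \<omega>"
    "is_biproduct C S (Dom C f) W jA jW pA pW" "g \<in> Hom C S (Cod C f)" "g \<cdot> jA = f"
    "deflation C g" "Ker_in C g \<Y>"
    unfolding Weq\<^sub>\<omega>_def by blast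
  then have "Ydefl g" "Dom C g = S" "Cod C g = Cod C f" using Ydefl_iff by auto
  then show ?r using * by blast
next
  assume ?r
  then obtain W S jA jW pA pW g where *: "f \<in> Arr C" "W \<in> \<omega>"
    "is_biproduct C S (Dom C f) W jA jW pA pW" "Ydefl g" "Dom C g = S" "Cod C g = Cod C f" "g \<cdot> jA = f"
    by blast
  note b = is_biproductD[OF *(3)]
  have "g \<in> Hom C S (Cod C f)" "g \<cdot> jW \<in> Hom C W (Cod C f)" using * b Ydefl_Arr by auto
  then show ?l using *(1-4,7) Ydefl_iff unfolding Weq\<^sub>\<omega>_def by blast
qed

text \<open>A zero object lies in both classes, so \<open>W = 0\<close> is allowed and
  \<open>p\<close> presents itself.\<close>

lemma Ydefl_Weq:
  assumes "Ydefl p"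
  shows "p \<in> Weq\<^sub>\<omega> C \<omega> \<Y>"
proof -
  note p = Ydefl_Arr[OF assms]
  obtain Z where Z: "is_zero_obj C Z" using zero_obj_exists by blast
  have "is_biproduct C (Dom C p) (Dom C p) Z (Ident C (Dom C p)) (Zero C Z (Dom C p))
      (Ident C (Dom C p)) (Zero C (Dom C p) Z)"
    using biproduct_with_zero[OF _ Z] p by simp
  then show ?thesis unfolding Weq_iff using p assms zero_in[OF Z] by (metis Comp_Ident(1) IntI)
qed

text \<open>If \<open>f\<close> is \<open>\<omega>\<close>-epic, then \<open>(f, t) = f \<cdot> (1, s)\<close>, so \<open>f\<close> is a deflation whose kernel is a retract
  of the kernel of \<open>(f, t)\<close>.\<close>

lemma Fib_Weq_Ydefl:
  assumes "f \<in> Fib\<^sub>\<omega> C \<omega>" "f \<in> Weq\<^sub>\<omega> C \<omega> \<Y>"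
  shows "Ydefl f"
proof -
  obtain W S jA jW pA pW g where f: "f \<in> Arr C" and W: "W \<in> \<omega>"
    and bi: "is_biproduct C S (Dom C f) W jA jW pA pW"
    and g: "Ydefl g" "Dom C g = S" "Cod C g = Cod C f" "g \<cdot> jA = f"
    using assms(2) unfolding Weq_iff by blast
  note b = is_biproductD[OF bi] and g0 = Ydefl_Arr[OF g(1)]
  have "g \<cdot> jW \<in> Arr C" "Dom C (g \<cdot> jW) \<in> \<omega>" "Cod C (g \<cdot> jW) = Cod C f" using b g g0 W by simp_all
  then obtain s where s: "s \<in> Arr C" "Dom C s = W" "Cod C s = Dom C f" "f \<cdot> s = g \<cdot> jW"
    using assms(1) b g g0 unfolding Fib_iff by (metis Comp_simps(2) Hom_iff)
  define m where "m = pA \<^bold>+ s \<cdot> pW"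
  have m: "m \<in> Arr C" "Dom C m = S" "Cod C m = Dom C f" using b s by (simp_all add: m_def)
  have mjA: "m \<cdot> jA = Ident C (Dom C f)" using b s f by (simp add: m_def)
  have gm: "g = f \<cdot> m"
    by (rule biproduct_right_ext[OF bi]) (use b s f m g g0 in \<open>simp_all add: m_def\<close>)
  then have "deflation C f" using deflation_cancel[OF m(1) f m(3)] g(1) Ydefl_iff by simp
  then obtain k where k: "(k, f) \<in> Conf C" by (auto simp: deflation_def)
  obtain l where l: "(l, g) \<in> Conf C" "Dom C l \<in> \<Y>" using g(1) by (auto simp: Ydefl_def)
  note kf = confD[OF k] and lg = confD[OF l(1)]
  have "g \<cdot> (jA \<cdot> k) = Zero C (Dom C k) (Cod C g)"
    using kf b g(2,3) g0 by (simp add: Comp_reassoc[OF g(4)])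
  then obtain a where a: "a \<in> Arr C" "Dom C a = Dom C k" "Cod C a = Dom C l" "l \<cdot> a = jA \<cdot> k"
    using kernel_factor[OF lg(5), of "jA \<cdot> k"] kf(1-3) b(1-15) g(2) by auto
  have "f \<cdot> (m \<cdot> l) = Zero C (Dom C l) (Cod C f)"
    using lg m f g(2,3) by (simp add: Comp_reassoc[OF gm[symmetric]])
  then obtain a' where a': "a' \<in> Arr C" "Dom C a' = Dom C l" "Cod C a' = Dom C k" "k \<cdot> a' = m \<cdot> l"
    using kernel_factor[OF kf(5), of "m \<cdot> l"] lg(1-3) m g(2) by auto
  have "a' \<cdot> a = Ident C (Dom C k)"
    by (rule kernel_mono[OF kf(5)])
      (use a a' kf lg m b g(2) mjA in \<open>simp_all add: Comp_reassoc[OF a'(4)] Comp_reassoc[OF mjA]\<close>)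
  then have "Dom C a \<in> \<Y>"
    by (intro retract_in_summand_closed[OF Y_summand l(2), of a a']) (use a a' in simp_all)
  then show ?thesis unfolding Ydefl_def using k a by metis
qed

end

section \<open>Consequences of orthogonality\<close>

locale orthogonal_pair = subcat_pair +
  assumes orth: "A \<in> \<X> \<Longrightarrow> B \<in> \<Y> \<Longrightarrow> ext_vanish A B"
begin

lemma Ydefl_lift:
  assumes "Ydefl p" "v \<in> Arr C" "Dom C v \<in> \<X>" "Cod C v = Cod C p"
  obtains h where "h \<in> Arr C" "Dom C h = Dom C v" "Cod C h = Dom C p" "p \<cdot> h = v"
  using assms lift_along_deflation orth unfolding Ydefl_def by metis

lemma cofib_extend:
  assumes "(i, c) \<in> Conf C" "Cod C c \<in> \<X>" "v \<in> Arr C" "Cod C v \<in> \<Y>" "Dom C v = Dom C i"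
  obtains h where "h \<in> Arr C" "Cod C h = Cod C v" "Dom C h = Cod C i" "h \<cdot> i = v"
  using extend_along_inflation[OF assms(1) orth[OF assms(2,4)] assms(3) refl assms(5)] confD(3)[OF assms(1)]
  by metis

lemma CoFib_lifts_Ydefl: "f \<in> CoFib\<^sub>\<omega> C \<X> \<Longrightarrow> Ydefl p \<Longrightarrow> lifts_against C f p"
  using ext_vanish_lifts orth unfolding Ydefl_def CoFib_iff by blast

lemma Ydefl_Fib: "Ydefl p \<Longrightarrow> p \<in> Fib\<^sub>\<omega> C \<omega>"
  unfolding Fib_iff using Ydefl_Arr by (metis Hom_iff IntE Ydefl_lift)

text \<open>Only orthogonality enters, so trivial fibrations are already identified in the converse
  direction, before the other properties of a cotorsion pair are known.\<close>

lemma Fib_Int_Weq: "Fib\<^sub>\<omega> C \<omega> \<inter> Weq\<^sub>\<omega> C \<omega> \<Y> = {p. Ydefl p}"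
  using Fib_Weq_Ydefl Ydefl_Fib Ydefl_Weq by blast

end

section \<open>Morphisms modulo \<open>\<omega>\<close>\<close>

context subcat_pair
begin

definition fac where "fac f \<longleftrightarrow> (\<exists>u v. u \<in> Arr C \<and> v \<in> Arr C \<and> Cod C u = Dom C v \<and> Dom C v \<in> \<omega> \<and> f = v \<cdot> u)"

lemma facI: "u \<in> Arr C \<Longrightarrow> v \<in> Arr C \<Longrightarrow> Cod C u = Dom C v \<Longrightarrow> Dom C v \<in> \<omega> \<Longrightarrow> fac (v \<cdot> u)"
  by (auto simp: fac_def)

lemma facE:
  assumes "fac f"
  obtains u v where "u \<in> Arr C" "v \<in> Arr C" "Cod C u = Dom C v" "Dom C v \<in> \<omega>" "Dom C u = Dom C f"
    "Cod C v = Cod C f" "v \<cdot> u = f"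
  using assms unfolding fac_def by (metis Comp_simps(2,3))

lemma fac_Arr: "fac f \<Longrightarrow> f \<in> Arr C"
  by (auto simp: fac_def)

lemma factoring_iff: "f \<in> factoring C \<omega> A B \<longleftrightarrow> fac f \<and> Dom C f = A \<and> Cod C f = B"
proof
  assume "f \<in> factoring C \<omega> A B"
  then show "fac f \<and> Dom C f = A \<and> Cod C f = B" by (auto simp: factoring_def intro!: facI)
next
  assume *: "fac f \<and> Dom C f = A \<and> Cod C f = B"
  then obtain u v where "u \<in> Arr C" "v \<in> Arr C" "Cod C u = Dom C v" "Dom C v \<in> \<omega>" "Dom C u = Dom C f"
    "Cod C v = Cod C f" "v \<cdot> u = f" using facE by blast
  then have "f = v \<cdot> u \<and> Dom C v \<in> \<omega> \<and> u \<in> Hom C A (Dom C v) \<and> v \<in> Hom C (Dom C v) B"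
    using * by simp
  then show "f \<in> factoring C \<omega> A B" unfolding factoring_def by blast
qed

lemma fac_Comp_left: "fac f \<Longrightarrow> g \<in> Arr C \<Longrightarrow> Dom C g = Cod C f \<Longrightarrow> fac (g \<cdot> f)"
  unfolding fac_def by (metis Comp_assoc' Comp_simps)

lemma fac_Comp_right: "fac f \<Longrightarrow> g \<in> Arr C \<Longrightarrow> Cod C g = Dom C f \<Longrightarrow> fac (f \<cdot> g)"
  unfolding fac_def by (metis Comp_assoc' Comp_simps)

lemma fac_Zero:
  assumes "A \<in> Obj C" "B \<in> Obj C"
  shows "fac (Zero C A B)"
proof -
  obtain Z where Z: "is_zero_obj C Z" using zero_obj_exists by blast
  then have "Z \<in> \<omega>" using zero_in by blast
  then have "fac (Zero C Z B \<cdot> Zero C A Z)" using assms by (intro facI) auto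
  then show ?thesis using assms zero_obj_Obj[OF Z] by simp
qed

lemma fac_neg: "fac f \<Longrightarrow> fac (neg f)"
proof -
  assume "fac f"
  then obtain u v where "u \<in> Arr C" "v \<in> Arr C" "Cod C u = Dom C v" "Dom C v \<in> \<omega>" "f = v \<cdot> u"
    unfolding fac_def by blast
  then show ?thesis using facI[of u "neg v"] by simp
qed

text \<open>A sum of an arrow through \<open>W\<close> and one through \<open>W'\<close> factors
  through the biproduct of \<open>W\<close> and \<open>W'\<close>. This is where additivity of both
  subcategories makes the null arrows an ideal.\<close>

lemma fac_Plus:
  assumes "fac f" "fac g" "Dom C f = Dom C g" "Cod C f = Cod C g"
  shows "fac (f \<^bold>+ g)"
proof -
  obtain u v where f: "u \<in> Arr C" "v \<in> Arr C" "Cod C u = Dom C v" "Dom C v \<in> \<omega>" "Dom C u = Dom C f"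
    "Cod C v = Cod C f" "v \<cdot> u = f" using facE[OF assms(1)] .
  obtain u' v' where g: "u' \<in> Arr C" "v' \<in> Arr C" "Cod C u' = Dom C v'" "Dom C v' \<in> \<omega>" "Dom C u' = Dom C g"
    "Cod C v' = Cod C g" "v' \<cdot> u' = g" using facE[OF assms(2)] .
  obtain S j j' p p' where bi: "is_biproduct C S (Dom C v) (Dom C v') j j' p p'"
    using biproduct_exists[of "Dom C v" "Dom C v'"] f g by auto
  note b = is_biproductD[OF bi]
  have S: "S \<in> \<omega>" using biproduct_in[OF bi] f g by blast
  have fA: "f \<in> Arr C" "g \<in> Arr C" using assms fac_Arr by auto
  let ?h = "v \<cdot> p \<^bold>+ v' \<cdot> p'" and ?k = "j \<cdot> u \<^bold>+ j' \<cdot> u'"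
  have h: "?h \<in> Arr C" "Dom C ?h = S" "Cod C ?h = Cod C g" and k: "?k \<in> Arr C" "Cod C ?k = S"
    "Dom C ?k = Dom C g"
    using b f g assms(3,4) by simp_all
  have 1: "p \<cdot> ?k = u" "p' \<cdot> ?k = u'"
    using b(1-15) f(1-6) g(1-6) assms(3,4) by (simp_all add: Comp_reassoc[OF b(16)] Comp_reassoc[OF b(17)]
        Comp_reassoc[OF b(18)] Comp_reassoc[OF b(19)])
  have "?h \<cdot> ?k = v \<cdot> (p \<cdot> ?k) \<^bold>+ v' \<cdot> (p' \<cdot> ?k)"
    using b(1-15) f(1-6) g(1-6) k assms(3,4) by (simp add: Plus_ac)
  also have "\<dots> = f \<^bold>+ g" unfolding 1 f(7) g(7) by simp
  finally show ?thesis using facI[OF k(1) h(1)] h(2) k(2) S by simp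
qed

text \<open>Equality in the additive quotient, kept as a congruence on arrows of \<open>C\<close> so
  that composites can be rewritten without cosets.\<close>

definition homot (infix "\<approx>" 50) where "f \<approx> g \<longleftrightarrow> parallel f g \<and> fac (f \<^bold>+ neg g)"

lemma homot_parallel: "f \<approx> g \<Longrightarrow> parallel f g"
  by (simp add: homot_def)

lemma homot_refl [simp]: "f \<in> Arr C \<Longrightarrow> f \<approx> f"
  by (simp add: homot_def fac_Zero)

lemma homot_sym: "f \<approx> g \<Longrightarrow> g \<approx> f"
proof -
  assume *: "f \<approx> g"
  then have "neg (f \<^bold>+ neg g) = g \<^bold>+ neg f" by (simp add: homot_def Plus_comm)
  then show ?thesis using * fac_neg unfolding homot_def by metis
qed

lemma homot_trans [trans]: "f \<approx> g \<Longrightarrow> g \<approx> h \<Longrightarrow> f \<approx> h"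
proof -
  assume *: "f \<approx> g" "g \<approx> h"
  then have "(f \<^bold>+ neg g) \<^bold>+ (g \<^bold>+ neg h) = f \<^bold>+ neg h" by (simp add: homot_def Plus_assoc)
  moreover have "fac ((f \<^bold>+ neg g) \<^bold>+ (g \<^bold>+ neg h))"
    by (rule fac_Plus) (use * in \<open>auto simp: homot_def\<close>)
  ultimately show ?thesis using * by (simp add: homot_def)
qed

lemma homot_Comp_left: "f \<approx> g \<Longrightarrow> h \<in> Arr C \<Longrightarrow> Dom C h = Cod C g \<Longrightarrow> h \<cdot> f \<approx> h \<cdot> g"
  using fac_Comp_left[of "f \<^bold>+ neg g" h] by (simp add: homot_def)

lemma homot_Comp_right: "f \<approx> g \<Longrightarrow> h \<in> Arr C \<Longrightarrow> Cod C h = Dom C g \<Longrightarrow> f \<cdot> h \<approx> g \<cdot> h"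
  using fac_Comp_right[of "f \<^bold>+ neg g" h] by (simp add: homot_def)

lemma homot_Comp:
  assumes "f \<approx> f'" "g \<approx> g'" "Cod C f = Dom C g"
  shows "g \<cdot> f \<approx> g' \<cdot> f'"
proof -
  have "g \<cdot> f \<approx> g' \<cdot> f" by (rule homot_Comp_right) (use assms homot_parallel[OF assms(1)] homot_parallel[OF assms(2)] in auto)
  also have "\<dots> \<approx> g' \<cdot> f'" by (rule homot_Comp_left) (use assms homot_parallel[OF assms(1)] homot_parallel[OF assms(2)] in auto)
  finally show ?thesis .
qed

lemma homot_fac:
  assumes "f \<approx> g" "fac g"
  shows "fac f"
proof -
  have "fac ((f \<^bold>+ neg g) \<^bold>+ g)" by (rule fac_Plus) (use assms in \<open>auto simp: homot_def\<close>)
  then show ?thesis using assms by (simp add: homot_def Plus_assoc)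
qed

text \<open>\<open>wbij f\<close>: every \<open>V \<in> \<X>\<close> sees \<open>f\<close> as a bijection modulo \<open>\<omega>\<close>. This turns out to characterise
  the weak equivalences, and makes two-out-of-three and closure under retracts evident.\<close>

definition wbij where "wbij f \<longleftrightarrow> f \<in> Arr C \<and>
  (\<forall>v \<in> Arr C. Dom C v \<in> \<X> \<and> Cod C v = Cod C f \<longrightarrow>
    (\<exists>u \<in> Arr C. Dom C u = Dom C v \<and> Cod C u = Dom C f \<and> f \<cdot> u \<approx> v)) \<and>
  (\<forall>u \<in> Arr C. Dom C u \<in> \<X> \<and> Cod C u = Dom C f \<and> fac (f \<cdot> u) \<longrightarrow> fac u)"

lemma wbij_Arr: "wbij f \<Longrightarrow> f \<in> Arr C"
  by (simp add: wbij_def)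

lemma wbij_surj:
  assumes "wbij f" "v \<in> Arr C" "Dom C v \<in> \<X>" "Cod C v = Cod C f"
  obtains u where "u \<in> Arr C" "Dom C u = Dom C v" "Cod C u = Dom C f" "f \<cdot> u \<approx> v"
  using assms unfolding wbij_def by blast

lemma wbij_inj:
  assumes "wbij f" "u \<in> Arr C" "Dom C u \<in> \<X>" "Cod C u = Dom C f" "fac (f \<cdot> u)"
  shows "fac u"
  using assms unfolding wbij_def by blast

lemma wbijI:
  assumes "f \<in> Arr C"
    "\<And>v. \<lbrakk>v \<in> Arr C; Dom C v \<in> \<X>; Cod C v = Cod C f\<rbrakk> \<Longrightarrow>
      \<exists>u \<in> Arr C. Dom C u = Dom C v \<and> Cod C u = Dom C f \<and> f \<cdot> u \<approx> v"
    "\<And>u. \<lbrakk>u \<in> Arr C; Dom C u \<in> \<X>; Cod C u = Dom C f; fac (f \<cdot> u)\<rbrakk> \<Longrightarrow> fac u"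
  shows "wbij f"
  using assms unfolding wbij_def by blast

text \<open>Injectivity in \<open>wbij\<close> concerns arrows that become null; applied to a
  difference it gives cancellation modulo \<open>\<omega>\<close>.\<close>

lemma wbij_cancel:
  assumes "wbij f" "f \<cdot> u \<approx> f \<cdot> v" "u \<in> Arr C" "v \<in> Arr C" "Dom C u = Dom C v"
    "Dom C v \<in> \<X>" "Cod C u = Dom C f" "Cod C v = Dom C f"
  shows "u \<approx> v"
proof -
  have f: "f \<in> Arr C" using assms(1) by (rule wbij_Arr)
  have "fac (f \<cdot> (u \<^bold>+ neg v))" using assms(2) f assms(3-8) by (simp add: homot_def)
  then have "fac (u \<^bold>+ neg v)"
    using wbij_inj[OF assms(1), of "u \<^bold>+ neg v"] assms(3-8) f by simp
  then show ?thesis using assms by (simp add: homot_def)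
qed

lemma wbij_Comp:
  assumes "wbij f" "wbij g" "Cod C f = Dom C g"
  shows "wbij (g \<cdot> f)"
proof (rule wbijI)
  note A = assms(1,2)[THEN wbij_Arr]
  show "g \<cdot> f \<in> Arr C" using A assms by simp
  fix v assume v: "v \<in> Arr C" "Dom C v \<in> \<X>" "Cod C v = Cod C (g \<cdot> f)"
  obtain w where w: "w \<in> Arr C" "Dom C w = Dom C v" "Cod C w = Dom C g" "g \<cdot> w \<approx> v"
    using wbij_surj[OF assms(2) v(1,2)] v A assms(3) by auto
  obtain u where u: "u \<in> Arr C" "Dom C u = Dom C w" "Cod C u = Dom C f" "f \<cdot> u \<approx> w"
    using wbij_surj[OF assms(1) w(1)] w v assms(3) by auto
  have "g \<cdot> (f \<cdot> u) \<approx> g \<cdot> w" by (rule homot_Comp_left[OF u(4)]) (use A w in auto)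
  also note w(4)
  finally have "(g \<cdot> f) \<cdot> u \<approx> v" using A u assms(3) by simp
  then show "\<exists>u \<in> Arr C. Dom C u = Dom C v \<and> Cod C u = Dom C (g \<cdot> f) \<and> (g \<cdot> f) \<cdot> u \<approx> v"
    using u w A assms(3) by (intro bexI[of _ u]) simp_all
next
  note A = assms(1,2)[THEN wbij_Arr]
  fix u assume u: "u \<in> Arr C" "Dom C u \<in> \<X>" "Cod C u = Dom C (g \<cdot> f)" "fac ((g \<cdot> f) \<cdot> u)"
  have "fac (f \<cdot> u)" by (rule wbij_inj[OF assms(2)]) (use u A assms(3) in simp_all)
  then show "fac u" using wbij_inj[OF assms(1)] u A assms(3) by simp
qed

lemma wbij_cancel_right:
  assumes "wbij f" "wbij (g \<cdot> f)" "Cod C f = Dom C g" "g \<in> Arr C"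
  shows "wbij g"
proof (rule wbijI)
  note A = wbij_Arr[OF assms(1)]
  show "g \<in> Arr C" by fact
  fix v assume v: "v \<in> Arr C" "Dom C v \<in> \<X>" "Cod C v = Cod C g"
  obtain u where u: "u \<in> Arr C" "Dom C u = Dom C v" "Cod C u = Dom C (g \<cdot> f)" "(g \<cdot> f) \<cdot> u \<approx> v"
    using wbij_surj[OF assms(2) v(1,2)] v A assms(3,4) by auto
  then show "\<exists>u \<in> Arr C. Dom C u = Dom C v \<and> Cod C u = Dom C g \<and> g \<cdot> u \<approx> v"
    using A assms(3,4) by (intro bexI[of _ "f \<cdot> u"]) simp_all
next
  note A = wbij_Arr[OF assms(1)]
  fix w assume w: "w \<in> Arr C" "Dom C w \<in> \<X>" "Cod C w = Dom C g" "fac (g \<cdot> w)"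
  obtain u where u: "u \<in> Arr C" "Dom C u = Dom C w" "Cod C u = Dom C f" "f \<cdot> u \<approx> w"
    using wbij_surj[OF assms(1) w(1,2)] w assms(3) by auto
  have "g \<cdot> (f \<cdot> u) \<approx> g \<cdot> w" by (rule homot_Comp_left[OF u(4)]) (use assms w in auto)
  then have "fac ((g \<cdot> f) \<cdot> u)" using homot_fac w(4) A u assms(3,4) by simp
  then have "fac u" using wbij_inj[OF assms(2) u(1)] u w A assms(3,4) by simp
  then have "fac (f \<cdot> u)" using fac_Comp_left[of u f] A u by simp
  then show "fac w" using homot_fac homot_sym u(4) by blast
qed

lemma wbij_cancel_left:
  assumes "wbij g" "wbij (g \<cdot> f)" "Cod C f = Dom C g" "f \<in> Arr C"
  shows "wbij f"
proof (rule wbijI)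
  note A = wbij_Arr[OF assms(1)]
  show "f \<in> Arr C" by fact
  fix w assume w: "w \<in> Arr C" "Dom C w \<in> \<X>" "Cod C w = Cod C f"
  obtain u where u: "u \<in> Arr C" "Dom C u = Dom C (g \<cdot> w)" "Cod C u = Dom C (g \<cdot> f)" "(g \<cdot> f) \<cdot> u \<approx> g \<cdot> w"
    using wbij_surj[OF assms(2), of "g \<cdot> w"] w A assms(3,4) by auto
  have u': "Dom C u = Dom C w" "Cod C u = Dom C f" using u w A assms(3,4) by simp_all
  have "f \<cdot> u \<approx> w"
    by (rule wbij_cancel[OF assms(1)]) (use u(1,4) u' w A assms(3,4) in simp_all)
  then show "\<exists>u \<in> Arr C. Dom C u = Dom C w \<and> Cod C u = Dom C f \<and> f \<cdot> u \<approx> w"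
    using u(1) u' by blast
next
  note A = wbij_Arr[OF assms(1)]
  fix u assume u: "u \<in> Arr C" "Dom C u \<in> \<X>" "Cod C u = Dom C f" "fac (f \<cdot> u)"
  then have "fac (g \<cdot> (f \<cdot> u))" using A assms(3,4) fac_Comp_left[of "f \<cdot> u" g] by simp
  then show "fac u" using wbij_inj[OF assms(2) u(1)] u A assms(3,4) by simp
qed

lemma wbij_homot_inverse:
  assumes "f \<in> Arr C" "g \<in> Arr C" "Dom C g = Cod C f" "Cod C g = Dom C f"
    "g \<cdot> f \<approx> Ident C (Dom C f)" "f \<cdot> g \<approx> Ident C (Cod C f)"
  shows "wbij f"
proof (rule wbijI)
  fix v assume v: "v \<in> Arr C" "Dom C v \<in> \<X>" "Cod C v = Cod C f"
  have "f \<cdot> (g \<cdot> v) \<approx> v"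
    using homot_Comp_right[OF assms(6) v(1)] v assms(1-4) by simp
  then show "\<exists>u \<in> Arr C. Dom C u = Dom C v \<and> Cod C u = Dom C f \<and> f \<cdot> u \<approx> v"
    using v assms(1-4) by (intro bexI[of _ "g \<cdot> v"]) simp_all
next
  fix u assume u: "u \<in> Arr C" "Dom C u \<in> \<X>" "Cod C u = Dom C f" "fac (f \<cdot> u)"
  have "g \<cdot> (f \<cdot> u) \<approx> u"
    using homot_Comp_right[OF assms(5) u(1)] u assms(1-4) by simp
  moreover have "fac (g \<cdot> (f \<cdot> u))" using fac_Comp_left u assms(1-4) by simp
  ultimately show "fac u" using homot_fac homot_sym by blast
qed fact

lemma wbij_Ident: "A \<in> Obj C \<Longrightarrow> wbij (Ident C A)"
  by (rule wbij_homot_inverse[of _ "Ident C A"]) simp_all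

text \<open>The projection \<open>pA\<close> is inverse to \<open>jA\<close> modulo
  \<open>\<omega>\<close>, because the defect \<open>jW \<cdot> pW\<close> factors through
  \<open>W\<close>.\<close>

lemma biproduct_wbij:
  assumes "is_biproduct C S A W jA jW pA pW" "W \<in> \<omega>"
  shows "wbij jA"
proof -
  note b = is_biproductD[OF assms(1)]
  have "jA \<cdot> pA \<approx> Ident C S"
    unfolding b(20)[symmetric] homot_def
    using b(1-15) facI[of "pW" "neg jW"] assms(2) by (simp add: Plus_assoc)
  then show ?thesis
    by (intro wbij_homot_inverse[of jA pA]) (use b in simp_all)
qed

lemma wbij_retract:
  assumes "wbij g" "retract_of C f g"
  shows "wbij f"
proof -
  obtain s s' r r' where s: "s \<in> Arr C" "Dom C s = Dom C f" "Cod C s = Dom C g"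
    and s': "s' \<in> Arr C" "Dom C s' = Cod C f" "Cod C s' = Cod C g"
    and r: "r \<in> Arr C" "Dom C r = Dom C g" "Cod C r = Dom C f"
    and r': "r' \<in> Arr C" "Dom C r' = Cod C g" "Cod C r' = Cod C f"
    and e: "g \<cdot> s = s' \<cdot> f" "f \<cdot> r = r' \<cdot> g" "r \<cdot> s = Ident C (Dom C f)" "r' \<cdot> s' = Ident C (Cod C f)"
    and f: "f \<in> Arr C" and g: "g \<in> Arr C"
    using assms(2) unfolding retract_of_def by auto
  show ?thesis
  proof (rule wbijI[OF f])
    fix v assume v: "v \<in> Arr C" "Dom C v \<in> \<X>" "Cod C v = Cod C f"
    have "s' \<cdot> v \<in> Arr C" "Dom C (s' \<cdot> v) = Dom C v" "Cod C (s' \<cdot> v) = Cod C g" using v s' by simp_all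
    then obtain u where u: "u \<in> Arr C" "Dom C u = Dom C v" "Cod C u = Dom C g" "g \<cdot> u \<approx> s' \<cdot> v"
      using wbij_surj[OF assms(1), of "s' \<cdot> v"] v by metis
    have "f \<cdot> (r \<cdot> u) = r' \<cdot> (g \<cdot> u)" using u(1-3) r r' f g by (simp add: Comp_reassoc[OF e(2)])
    also have "\<dots> \<approx> r' \<cdot> (s' \<cdot> v)"
      by (rule homot_Comp_left[OF u(4)]) (use r' s' v in simp_all)
    also have "r' \<cdot> (s' \<cdot> v) = v" using v s' r' by (simp add: Comp_reassoc[OF e(4)])
    finally show "\<exists>u \<in> Arr C. Dom C u = Dom C v \<and> Cod C u = Dom C f \<and> f \<cdot> u \<approx> v"
      using u(1-3) r by (intro bexI[of _ "r \<cdot> u"]) simp_all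
  next
    fix u assume u: "u \<in> Arr C" "Dom C u \<in> \<X>" "Cod C u = Dom C f" "fac (f \<cdot> u)"
    have "fac (s' \<cdot> (f \<cdot> u))" by (rule fac_Comp_left) (use u s' f in simp_all)
    moreover have "s' \<cdot> (f \<cdot> u) = g \<cdot> (s \<cdot> u)" using u(1-3) s s' f g by (simp add: Comp_reassoc[OF e(1)])
    ultimately have "fac (s \<cdot> u)" using wbij_inj[OF assms(1), of "s \<cdot> u"] u(1-3) s by simp
    then have "fac (r \<cdot> (s \<cdot> u))" using fac_Comp_left[of "s \<cdot> u" r] u(1-3) s r by simp
    then show "fac u" using u(1-3) s r by (simp add: Comp_reassoc[OF e(3)])
  qed
qed

section \<open>Objects seen through their arrows to and from zero, and closure under
  retracts\<close>

lemma Conf_Zero_Ident: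
  assumes "is_zero_obj C Z" "A \<in> Obj C"
  shows "(Zero C Z A, Ident C A) \<in> Conf C" "(Ident C A, Zero C A Z) \<in> Conf C"
  using biproduct_Conf[OF biproduct_with_zero[OF assms(2,1)]] biproduct_Conf'[OF biproduct_with_zero[OF assms(2,1)]]
  by auto

text \<open>An arrow to zero has the identity as one kernel. For a kernel chosen otherwise,
  \<open>A\<close> is a retract of its source, and closure under summands decides.\<close>

lemma Ydefl_to_zero:
  assumes "is_zero_obj C Z" "A \<in> Obj C"
  shows "Ydefl (Zero C A Z) \<longleftrightarrow> A \<in> \<Y>"
proof
  assume "A \<in> \<Y>"
  then show "Ydefl (Zero C A Z)" unfolding Ydefl_def
    using Conf_Zero_Ident(2)[OF assms] assms by (intro exI[of _ "Ident C A"]) simp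
next
  have Z: "Z \<in> Obj C" using assms(1) by (rule zero_obj_Obj)
  assume "Ydefl (Zero C A Z)"
  then obtain k where k: "(k, Zero C A Z) \<in> Conf C" "Dom C k \<in> \<Y>" by (auto simp: Ydefl_def)
  note kD = confD[OF k(1)]
  obtain h where "h \<in> Arr C" "Dom C h = A" "Cod C h = Dom C k" "k \<cdot> h = Ident C A"
    using kernel_factor[OF kD(5), of "Ident C A"] assms Z by auto
  then show "A \<in> \<Y>"
    using retract_in_summand_closed[OF Y_summand k(2), of h k] kD(1-3) assms Z by simp
qed

lemma CoFib_from_zero:
  assumes "is_zero_obj C Z" "A \<in> Obj C"
  shows "Zero C Z A \<in> CoFib\<^sub>\<omega> C \<X> \<longleftrightarrow> A \<in> \<X>"
proof
  assume "A \<in> \<X>"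
  then show "Zero C Z A \<in> CoFib\<^sub>\<omega> C \<X>" unfolding CoFib_iff
    using Conf_Zero_Ident(1)[OF assms] assms by (intro exI[of _ "Ident C A"]) simp
next
  have Z: "Z \<in> Obj C" using assms(1) by (rule zero_obj_Obj)
  assume "Zero C Z A \<in> CoFib\<^sub>\<omega> C \<X>"
  then obtain c where c: "(Zero C Z A, c) \<in> Conf C" "Cod C c \<in> \<X>" by (auto simp: CoFib_iff)
  note cD = confD[OF c(1)]
  have cA: "Dom C c = A" using cD(3) Z assms by simp
  obtain h where "h \<in> Arr C" "Dom C h = Cod C c" "Cod C h = A" "h \<cdot> c = Ident C A"
    using cokernel_factor[OF cD(6), of "Ident C A"] assms Z by auto
  then show "A \<in> \<X>"
    using retract_in_summand_closed[OF X_summand c(2), of c h] cD(1-2) cA by simp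
qed

lemma Fib_to_zero:
  assumes "is_zero_obj C Z" "A \<in> Obj C"
  shows "Zero C A Z \<in> Fib\<^sub>\<omega> C \<omega>"
proof -
  have Z: "Z \<in> Obj C" using assms(1) by (rule zero_obj_Obj)
  show ?thesis unfolding Fib_iff
  proof (intro conjI ballI impI)
    fix w assume w: "w \<in> Arr C" "Dom C w \<in> \<omega> \<and> Cod C w = Cod C (Zero C A Z)"
    then have "w = Zero C (Dom C w) Z" using zero_obj_arrow(2)[OF assms(1)] Z assms by simp
    then show "\<exists>u \<in> Hom C (Dom C w) (Dom C (Zero C A Z)). Zero C A Z \<cdot> u = w"
      using w(1) Z assms by (intro bexI[of _ "Zero C (Dom C w) A"]) auto
  qed (use Z assms in simp)
qed

lemma fibrant_objs_eq: "fibrant_objs C (Fib\<^sub>\<omega> C \<omega>) = Obj C"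
  unfolding fibrant_objs_def using zero_obj_exists Fib_to_zero zero_obj_Obj by force

lemma cofibrant_objs_eq: "cofibrant_objs C (CoFib\<^sub>\<omega> C \<X>) = \<X>"
proof -
  have "X \<in> \<X>" if "is_zero_obj C Z" "f \<in> Hom C Z X" "f \<in> CoFib\<^sub>\<omega> C \<X>" for X Z f
    using zero_obj_arrow(1)[OF that(1), of f] CoFib_from_zero[OF that(1)] that
    by (metis Cod_in_Obj Hom_iff)
  moreover obtain Z where "is_zero_obj C Z" using zero_obj_exists by blast
  moreover have "Zero C Z X \<in> Hom C Z X" if "X \<in> Obj C" for X
    using that calculation(2) zero_obj_Obj by simp
  ultimately show ?thesis
    unfolding cofibrant_objs_def using CoFib_from_zero X_Obj by blast
qed

text \<open>The composite \<open>g \<cdot> s = s' \<cdot> f\<close> is an inflation, since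
  \<open>s\<close> is a split monomorphism, so \<open>f\<close> is one by cancellation. The retract
  diagram then passes to cokernels.\<close>

lemma CoFib_retract: "retract_closed C (CoFib\<^sub>\<omega> C \<X>)"
  unfolding retract_closed_def
proof (intro ballI allI impI)
  fix f g assume g: "g \<in> CoFib\<^sub>\<omega> C \<X>" and "retract_of C f g"
  then obtain s s' r r' where s: "s \<in> Arr C" "Dom C s = Dom C f" "Cod C s = Dom C g"
    and s': "s' \<in> Arr C" "Dom C s' = Cod C f" "Cod C s' = Cod C g"
    and r: "r \<in> Arr C" "Dom C r = Dom C g" "Cod C r = Dom C f"
    and r': "r' \<in> Arr C" "Dom C r' = Cod C g" "Cod C r' = Cod C f"
    and e: "g \<cdot> s = s' \<cdot> f" "f \<cdot> r = r' \<cdot> g" "r \<cdot> s = Ident C (Dom C f)" "r' \<cdot> s' = Ident C (Cod C f)"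
    and f: "f \<in> Arr C" and gA: "g \<in> Arr C"
    unfolding retract_of_def by auto
  obtain c' where c': "(g, c') \<in> Conf C" "Cod C c' \<in> \<X>" using g by (auto simp: CoFib_iff)
  note gD = confD[OF c'(1)]
  have "split_mono C s" using s r e(3) by (auto simp: split_mono_def)
  then have "inflation C (g \<cdot> s)" using split_mono_inflation inflation_Comp gD(7) s(3) by blast
  then have "inflation C f" using inflation_cancel[of f s'] e(1) f s' by simp
  then obtain c where c: "(f, c) \<in> Conf C" by (auto simp: inflation_def)
  note fD = confD[OF c]
  have "(c' \<cdot> s') \<cdot> f = c' \<cdot> (g \<cdot> s)" using e(1) gD(1-3) s' f s by simp
  also have "\<dots> = Zero C (Dom C f) (Cod C c')" using gD s by (simp add: Comp_reassoc[OF gD(4)])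
  finally obtain a where a: "a \<in> Arr C" "Dom C a = Cod C c" "Cod C a = Cod C c'" "a \<cdot> c = c' \<cdot> s'"
    using cokernel_factor[OF fD(6), of "c' \<cdot> s'"] gD(1-3) s' by auto
  have "(c \<cdot> r') \<cdot> g = c \<cdot> (f \<cdot> r)" using e(2) fD(1-3) gD(1-3) r' r by simp
  also have "\<dots> = Zero C (Dom C g) (Cod C c)" using fD r by (simp add: Comp_reassoc[OF fD(4)])
  finally obtain b where b: "b \<in> Arr C" "Dom C b = Cod C c'" "Cod C b = Cod C c" "b \<cdot> c' = c \<cdot> r'"
    using cokernel_factor[OF gD(6), of "c \<cdot> r'"] fD(1-3) r' by auto
  have "b \<cdot> a = Ident C (Cod C c)"
    by (rule cokernel_epi[OF fD(6)])
      (use a b fD(1-3) gD(1-3) s' r' e(4) in \<open>simp_all add: Comp_reassoc[OF b(4)]\<close>)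
  then have "Dom C a \<in> \<X>"
    by (intro retract_in_summand_closed[OF X_summand c'(2), of a b]) (use a b in simp_all)
  then show "f \<in> CoFib\<^sub>\<omega> C \<X>" using c a(2) by (auto simp: CoFib_iff)
qed

lemma Fib_retract: "retract_closed C (Fib\<^sub>\<omega> C \<omega>)"
  unfolding retract_closed_def
proof (intro ballI allI impI)
  fix f g assume gF: "g \<in> Fib\<^sub>\<omega> C \<omega>" and "retract_of C f g"
  then obtain s s' r r' where s': "s' \<in> Arr C" "Dom C s' = Cod C f" "Cod C s' = Cod C g"
    and r: "r \<in> Arr C" "Dom C r = Dom C g" "Cod C r = Dom C f"
    and r': "r' \<in> Arr C" "Dom C r' = Cod C g" "Cod C r' = Cod C f"
    and e: "f \<cdot> r = r' \<cdot> g" "r' \<cdot> s' = Ident C (Cod C f)"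
    and f: "f \<in> Arr C" and g: "g \<in> Arr C"
    unfolding retract_of_def by auto
  have "\<exists>u \<in> Hom C (Dom C w) (Dom C f). f \<cdot> u = w" if w: "w \<in> Arr C" "Dom C w \<in> \<omega>" "Cod C w = Cod C f" for w
  proof -
    have "s' \<cdot> w \<in> Arr C" "Dom C (s' \<cdot> w) = Dom C w" "Cod C (s' \<cdot> w) = Cod C g" using w s' by simp_all
    then obtain u where u: "u \<in> Arr C" "Dom C u = Dom C w" "Cod C u = Dom C g" "g \<cdot> u = s' \<cdot> w"
      using gF w(2) unfolding Fib_iff by (metis Hom_iff)
    have "f \<cdot> (r \<cdot> u) = r' \<cdot> (g \<cdot> u)" using u(1-3) r r' f g by (simp add: Comp_reassoc[OF e(1)])
    also have "\<dots> = w" unfolding u(4) using w s' r' by (simp add: Comp_reassoc[OF e(2)])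
    finally show ?thesis using u(1-3) r by (intro bexI[of _ "r \<cdot> u"]) simp_all
  qed
  then show "f \<in> Fib\<^sub>\<omega> C \<omega>" using f by (simp add: Fib_iff)
qed

end

section \<open>The model structure of a hereditary complete cotorsion pair\<close>

lemma (in category) lifts_against_Comp:
  assumes "lifts_against C i p" "lifts_against C j p" "i \<in> Arr C" "j \<in> Arr C" "p \<in> Arr C"
    "Cod C i = Dom C j"
  shows "lifts_against C (j \<cdot> i) p"
  unfolding lifts_against_def
proof (intro ballI impI)
  fix u v assume uv: "u \<in> Hom C (Dom C (j \<cdot> i)) (Dom C p)" "v \<in> Hom C (Cod C (j \<cdot> i)) (Cod C p)"
    "p \<cdot> u = v \<cdot> (j \<cdot> i)"
  have "u \<in> Hom C (Dom C i) (Dom C p)" "v \<cdot> j \<in> Hom C (Cod C i) (Cod C p)" "p \<cdot> u = (v \<cdot> j) \<cdot> i"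
    using uv assms(3-6) by simp_all
  then obtain h where h: "h \<in> Hom C (Cod C i) (Dom C p)" "h \<cdot> i = u" "p \<cdot> h = v \<cdot> j"
    using assms(1) unfolding lifts_against_def by blast
  moreover have "h \<in> Hom C (Dom C j) (Dom C p)" "v \<in> Hom C (Cod C j) (Cod C p)"
    using h(1) uv(2) assms(3-6) by simp_all
  ultimately obtain k where k: "k \<in> Hom C (Cod C j) (Dom C p)" "k \<cdot> j = h" "p \<cdot> k = v"
    using assms(2) unfolding lifts_against_def by blast
  have "k \<cdot> (j \<cdot> i) = u" using k(1) h(2) assms(3-6) by (simp add: Comp_reassoc[OF k(2)])
  then show "\<exists>h \<in> Hom C (Cod C (j \<cdot> i)) (Dom C p). h \<cdot> (j \<cdot> i) = u \<and> p \<cdot> h = v"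
    using k assms(3-6) by (intro bexI[of _ k]) simp_all
qed

text \<open>Hereditary complete cotorsion pairs with vanishing of Ext expressed by splitting. The
  converse direction arrives at these assumptions and thereby inherits everything derived from
  them.\<close>

locale complete_hereditary_pair = orthogonal_pair +
  assumes X_perp: "\<lbrakk>Z \<in> Obj C; \<And>B. B \<in> \<Y> \<Longrightarrow> ext_vanish Z B\<rbrakk> \<Longrightarrow> Z \<in> \<X>"
    and Y_perp: "\<lbrakk>Z \<in> Obj C; \<And>B. B \<in> \<X> \<Longrightarrow> ext_vanish B Z\<rbrakk> \<Longrightarrow> Z \<in> \<Y>"
    and X_cover: "A \<in> Obj C \<Longrightarrow> \<exists>i d. (i, d) \<in> Conf C \<and> Dom C i \<in> \<Y> \<and> Dom C d \<in> \<X> \<and> Cod C d = A"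
    and Y_envelope: "A \<in> Obj C \<Longrightarrow> \<exists>i d. (i, d) \<in> Conf C \<and> Dom C i = A \<and> Dom C d \<in> \<Y> \<and> Cod C d \<in> \<X>"
    and X_resolving: "\<lbrakk>(i, d) \<in> Conf C; Dom C d \<in> \<X>; Cod C d \<in> \<X>\<rbrakk> \<Longrightarrow> Dom C i \<in> \<X>"
    and Y_coresolving: "\<lbrakk>(i, d) \<in> Conf C; Dom C i \<in> \<Y>; Dom C d \<in> \<Y>\<rbrakk> \<Longrightarrow> Cod C d \<in> \<Y>"
begin

lemma cover:
  assumes "A \<in> Obj C"
  obtains q where "Ydefl q" "Dom C q \<in> \<X>" "Cod C q = A"
  using X_cover[OF assms] unfolding Ydefl_def by blast

text \<open>For a conflation \<open>(k, p)\<close> ending at the cokernel, lift the square with zero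
  on top and \<open>c\<close> at the bottom. The diagonal kills \<open>j\<close>, hence descends to
  a section of \<open>p\<close>. This reverses the passage from vanishing Ext to lifting.\<close>

lemma lifts_Ydefl_cokernel:
  assumes "(j, c) \<in> Conf C" "\<And>p. Ydefl p \<Longrightarrow> lifts_against C j p"
  shows "Cod C c \<in> \<X>"
proof (rule X_perp)
  note jc = confD[OF assms(1)]
  show "Cod C c \<in> Obj C" using jc by simp
  fix B assume B: "B \<in> \<Y>"
  show "ext_vanish (Cod C c) B"
  proof (rule ext_vanish_sectionI)
    fix k p assume kp: "(k, p) \<in> Conf C" "Dom C k = B" "Cod C p = Cod C c"
    note kD = confD[OF kp(1)]
    have "Ydefl p" using kp B by (auto simp: Ydefl_def)
    then have "lifts_against C j p" by (rule assms(2))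
    then obtain h where h: "h \<in> Arr C" "Dom C h = Cod C j" "Cod C h = Dom C p"
      "h \<cdot> j = Zero C (Dom C j) (Dom C p)" "p \<cdot> h = c"
      by (rule lifts_againstE[where u = "Zero C (Dom C j) (Dom C p)" and v = c])
        (use jc kD(1-3) kp(3) in simp_all)
    obtain s where s: "s \<in> Arr C" "Dom C s = Cod C c" "Cod C s = Dom C p" "s \<cdot> c = h"
      using cokernel_factor[OF jc(6) h(1,2)] h(3,4) by metis
    have "p \<cdot> s = Ident C (Cod C c)"
      by (rule cokernel_epi[OF jc(6)]) (use s h jc kD(1-3) kp(3) in simp_all)
    then show "\<exists>s. s \<in> Arr C \<and> Dom C s = Cod C c \<and> Cod C s = Dom C p \<and> p \<cdot> s = Ident C (Cod C c)"
      using s by blast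
  qed
qed

text \<open>Lifting properties compose, and lifting against \<open>Ydefl\<close> arrows detects
  cokernels in \<open>\<X>\<close>; this avoids describing the cokernel of a composite as an
  extension.\<close>

lemma CoFib_Comp:
  assumes "i \<in> CoFib\<^sub>\<omega> C \<X>" "j \<in> CoFib\<^sub>\<omega> C \<X>" "Cod C i = Dom C j"
  shows "j \<cdot> i \<in> CoFib\<^sub>\<omega> C \<X>"
proof -
  have ij: "inflation C i" "inflation C j" using assms by (auto simp: CoFib\<^sub>\<omega>_def)
  then have "inflation C (j \<cdot> i)" by (rule inflation_Comp) fact
  then obtain c where c: "(j \<cdot> i, c) \<in> Conf C" by (auto simp: inflation_def)
  moreover have "Cod C c \<in> \<X>"
    using lifts_Ydefl_cokernel[OF c] lifts_against_Comp CoFib_lifts_Ydefl assms ij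
      inflation_Arr Ydefl_Arr by metis
  ultimately show ?thesis by (auto simp: CoFib_iff)
qed

lemma X_extension:
  assumes "(i, d) \<in> Conf C" "Dom C i \<in> \<X>" "Cod C d \<in> \<X>"
  shows "Dom C d \<in> \<X>"
proof -
  note iD = confD[OF assms(1)]
  obtain Z where Z: "is_zero_obj C Z" using zero_obj_exists by blast
  have "i \<cdot> Zero C Z (Dom C i) \<in> CoFib\<^sub>\<omega> C \<X>"
    by (rule CoFib_Comp) (use CoFib_from_zero[OF Z] CoFib_iff assms iD zero_obj_Obj[OF Z] in auto)
  then show ?thesis using CoFib_from_zero[OF Z] iD zero_obj_Obj[OF Z] by simp
qed

text \<open>The arrow extends to an envelope of its source. That envelope is an extension of objects
  of \<open>\<X>\<close>, so it lies in \<open>\<omega>\<close>.\<close>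

lemma fac_X_Y:
  assumes "u \<in> Arr C" "Dom C u \<in> \<X>" "Cod C u \<in> \<Y>"
  shows "fac u"
proof -
  obtain i d where id: "(i, d) \<in> Conf C" "Dom C i = Dom C u" "Dom C d \<in> \<Y>" "Cod C d \<in> \<X>"
    using Y_envelope[of "Dom C u"] assms by auto
  note iD = confD[OF id(1)]
  have "Dom C d \<in> \<omega>" using X_extension[OF id(1)] id assms by auto
  moreover obtain h where "h \<in> Arr C" "Cod C h = Cod C u" "Dom C h = Cod C i" "h \<cdot> i = u"
    using cofib_extend[OF id(1,4) assms(1,3)] id(2) by metis
  ultimately show ?thesis using facI[of i h] iD(1-3) by simp
qed

text \<open>Surjectivity holds by strict lifting. For injectivity, lift the factorization of
  \<open>p \<cdot> u\<close> through \<open>\<omega>\<close>; the error lands in the kernel of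
  \<open>p\<close>, and arrows from \<open>\<X>\<close> to \<open>\<Y>\<close> are null.\<close>

lemma Ydefl_wbij:
  assumes "Ydefl p"
  shows "wbij p"
proof (rule wbijI)
  show p: "p \<in> Arr C" using assms by (rule Ydefl_Arr)
  fix v assume "v \<in> Arr C" "Dom C v \<in> \<X>" "Cod C v = Cod C p"
  then obtain h where "h \<in> Arr C" "Dom C h = Dom C v" "Cod C h = Dom C p" "p \<cdot> h = v"
    using Ydefl_lift[OF assms] by blast
  then show "\<exists>u \<in> Arr C. Dom C u = Dom C v \<and> Cod C u = Dom C p \<and> p \<cdot> u \<approx> v"
    using p by (intro bexI[of _ h]) auto
next
  have p: "p \<in> Arr C" using assms by (rule Ydefl_Arr)
  fix u assume u: "u \<in> Arr C" "Dom C u \<in> \<X>" "Cod C u = Dom C p" "fac (p \<cdot> u)"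
  obtain k where k: "(k, p) \<in> Conf C" "Dom C k \<in> \<Y>" using assms by (auto simp: Ydefl_def)
  note kD = confD[OF k(1)]
  obtain a b where ab: "a \<in> Arr C" "b \<in> Arr C" "Cod C a = Dom C b" "Dom C b \<in> \<omega>"
    "Dom C a = Dom C u" "Cod C b = Cod C p" "b \<cdot> a = p \<cdot> u"
    using facE[OF u(4)] u p by (metis Comp_simps(2,3))
  obtain h where h: "h \<in> Arr C" "Dom C h = Dom C b" "Cod C h = Dom C p" "p \<cdot> h = b"
    using Ydefl_lift[OF assms ab(2)] ab(4,6) by blast
  have "p \<cdot> (u \<^bold>+ neg (h \<cdot> a)) = Zero C (Dom C u) (Cod C p)"
    using u(1-3) h(1-3) ab p by (simp add: Comp_reassoc[OF h(4)])
  then obtain z where z: "z \<in> Arr C" "Dom C z = Dom C u" "Cod C z = Dom C k" "k \<cdot> z = u \<^bold>+ neg (h \<cdot> a)"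
    using kernel_factor[OF kD(5), of "u \<^bold>+ neg (h \<cdot> a)"] u(1-3) h(1-3) ab(1-6) kD(1-3) by auto
  have "fac z" by (rule fac_X_Y) (use z u k in simp_all)
  then have "fac (k \<cdot> z)" using fac_Comp_left[of z k] z(1-3) kD(1) by simp
  moreover have "fac (h \<cdot> a)" using facI h ab by simp
  ultimately have "fac (k \<cdot> z \<^bold>+ h \<cdot> a)" by (rule fac_Plus) (use z(1-3) h(1-3) ab(1-6) kD(1-3) in simp_all)
  then show "fac u" unfolding z(4) using u(1-3) h(1-3) ab(1-6) by (simp add: Plus_assoc)
qed

text \<open>Adjoining a cover \<open>t\<close> of the codomain makes \<open>(f, t)\<close> a
  deflation, at the price of a cofibration with cokernel \<open>Dom C t\<close>. Its kernel need not
  lie in \<open>\<Y>\<close>; pushing out along an envelope of the kernel repairs this and costs one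
  more cofibration.\<close>

lemma factor_cofib_Ydefl:
  assumes "f \<in> Arr C"
  obtains j q where "j \<in> CoFib\<^sub>\<omega> C \<X>" "Ydefl q" "Dom C j = Dom C f" "Cod C j = Dom C q"
    "Cod C q = Cod C f" "q \<cdot> j = f"
proof -
  obtain t where t: "Ydefl t" "Dom C t \<in> \<X>" "Cod C t = Cod C f" using cover[of "Cod C f"] assms by auto
  note tA = Ydefl_Arr[OF t(1)]
  obtain S jA jT pA pT where bi: "is_biproduct C S (Dom C f) (Dom C t) jA jT pA pT"
    using biproduct_exists[of "Dom C f" "Dom C t"] assms tA by auto
  note b = is_biproductD[OF bi]
  obtain g where g: "g \<in> Arr C" "Dom C g = S" "Cod C g = Cod C f" "g \<cdot> jA = f" "g \<cdot> jT = t"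
    using biproduct_copair[OF bi assms tA] t(3) by metis
  have "deflation C g" using deflation_cancel[of jT g] b g t(1) Ydefl_iff by simp
  then obtain k where k: "(k, g) \<in> Conf C" by (auto simp: deflation_def)
  note kD = confD[OF k]
  obtain e x where ex: "(e, x) \<in> Conf C" "Dom C e = Dom C k" "Dom C x \<in> \<Y>" "Cod C x \<in> \<X>"
    using Y_envelope[of "Dom C k"] kD by auto
  note eD = confD[OF ex(1)]
  obtain k' g' e' where po: "(k', g') \<in> Conf C" "is_pushout C k e k' e'" "Cod C g' = Cod C g" "g' \<cdot> e' = g"
    using Conf_pushout[OF k eD(1) ex(2)] by metis
  note pD = pushoutD[OF po(2)] and kD' = confD[OF po(1)]
  \<comment> \<open>The same pushout square read in the other direction: \<open>e'\<close> is a
    pushout of the envelope \<open>e\<close> and inherits its cokernel.\<close>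
  obtain x' where x': "(e', x') \<in> Conf C" "Cod C x' = Cod C x"
    using pushout_Conf[OF ex(1) is_pushout_commute[OF po(2)]] by metis
  have "jA \<in> CoFib\<^sub>\<omega> C \<X>" using biproduct_Conf[OF bi] b t(2) by (auto simp: CoFib_iff)
  moreover have "e' \<in> CoFib\<^sub>\<omega> C \<X>" using x' ex(4) by (auto simp: CoFib_iff)
  moreover have e': "Dom C e' = S" "Cod C e' = Dom C g'" using pD kD(1-3) kD'(1-3) g by simp_all
  ultimately have "e' \<cdot> jA \<in> CoFib\<^sub>\<omega> C \<X>" using CoFib_Comp b by simp
  moreover have "Ydefl g'" unfolding Ydefl_def using po(1) pD(6) eD(3) ex(3) by (metis)
  moreover have "g' \<cdot> (e' \<cdot> jA) = f" using e' pD(4) kD'(2) b g by (simp add: Comp_reassoc[OF po(4)])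
  ultimately show ?thesis using that[of "e' \<cdot> jA" g'] e' pD(4) b g po(3) by simp
qed

text \<open>Write a cover \<open>q\<close> of the codomain as \<open>j \<cdot> v + b \<cdot> a\<close> with \<open>b\<close> defined on some \<open>W \<in> \<omega>\<close>. Then
  \<open>c \<cdot> b\<close> is a deflation, whose kernel lies in \<open>\<X>\<close>; using injectivity on it, \<open>b\<close> can be corrected to
  descend to a section of \<open>c\<close>.\<close>

lemma wbij_cofib_split:
  assumes jc: "(j, c) \<in> Conf C" and cX: "Cod C c \<in> \<X>" and wj: "wbij j"
  obtains \<sigma> where "Cod C c \<in> \<omega>" "\<sigma> \<in> Arr C" "Dom C \<sigma> = Cod C c" "Cod C \<sigma> = Dom C c" "c \<cdot> \<sigma> = Ident C (Cod C c)"
proof -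
  note jD = confD[OF jc]
  obtain q where q: "Ydefl q" "Dom C q \<in> \<X>" "Cod C q = Dom C c" using cover[of "Dom C c"] jD by auto
  note qA = Ydefl_Arr[OF q(1)]
  obtain v where v: "v \<in> Arr C" "Dom C v = Dom C q" "Cod C v = Dom C j" "j \<cdot> v \<approx> q"
    using wbij_surj[OF wj qA q(2)] q(3) jD(3) by metis
  have "fac (q \<^bold>+ neg (j \<cdot> v))" using homot_sym[OF v(4)] by (simp add: homot_def)
  then obtain a b where ab: "a \<in> Arr C" "b \<in> Arr C" "Cod C a = Dom C b" "Dom C b \<in> \<omega>"
    "Dom C a = Dom C q" "Cod C b = Dom C c" "b \<cdot> a = q \<^bold>+ neg (j \<cdot> v)"
    using facE[of "q \<^bold>+ neg (j \<cdot> v)"] q(3) qA v(1-3) jD(1-3) by auto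
  have "(c \<cdot> b) \<cdot> a = c \<cdot> (b \<cdot> a)" using ab(1-6) jD(1-3) by simp
  also have "\<dots> = c \<cdot> q"
    unfolding ab(7) using q qA v(1-3) jD by (simp add: Comp_reassoc[OF jD(4)])
  finally have cba: "(c \<cdot> b) \<cdot> a = c \<cdot> q" .
  have "deflation C (c \<cdot> q)" using deflation_Comp jD(8) q(1,3) Ydefl_iff by blast
  then have "deflation C (c \<cdot> b)" using deflation_cancel[of a "c \<cdot> b"] ab(1-6) jD(1-3) cba by simp
  then obtain l where l: "(l, c \<cdot> b) \<in> Conf C" by (auto simp: deflation_def)
  note lD0 = confD[OF l]
  have cb: "c \<cdot> b \<in> Arr C" "Dom C (c \<cdot> b) = Dom C b" "Cod C (c \<cdot> b) = Cod C c"
    using ab(1-6) jD(1-3) by simp_all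
  have lD: "l \<in> Arr C" "Cod C l = Dom C b" "c \<cdot> (b \<cdot> l) = Zero C (Dom C l) (Cod C c)"
    using lD0(1-4) cb ab(2,6) jD(1-3) by simp_all
  have LX: "Dom C l \<in> \<X>" by (rule X_resolving[OF l]) (use cb ab cX in auto)
  obtain m where m: "m \<in> Arr C" "Dom C m = Dom C l" "Cod C m = Dom C j" "j \<cdot> m = b \<cdot> l"
    using kernel_factor[OF jD(5), of "b \<cdot> l"] lD ab(2,6) by auto
  have "fac (j \<cdot> m)" unfolding m(4) using facI lD ab by simp
  then have "fac m" using wbij_inj[OF wj m(1)] m LX by simp
  then obtain m1 m2 where mm: "m1 \<in> Arr C" "m2 \<in> Arr C" "Cod C m1 = Dom C m2" "Dom C m2 \<in> \<omega>"
    "Dom C m1 = Dom C l" "Cod C m2 = Dom C j" "m2 \<cdot> m1 = m"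
    using facE[of m] m(1-3) by metis
  \<comment> \<open>\<open>m1\<close> runs from the kernel of \<open>c \<cdot> b\<close> to an
    object of \<open>\<Y>\<close>, and the cokernel is in \<open>\<X>\<close>, so it extends to the
    source of \<open>b\<close>. Subtracting \<open>j \<cdot> (m2 \<cdot> e)\<close> from
    \<open>b\<close> then annihilates that kernel and does not affect the composite with
    \<open>c\<close>.\<close>
  obtain e where e: "e \<in> Arr C" "Cod C e = Dom C m2" "Dom C e = Dom C b" "e \<cdot> l = m1"
    using cofib_extend[OF l _ mm(1) _ mm(5)] cb cX mm(3,4) lD(2) by (metis IntD2)
  define d where "d = b \<^bold>+ neg (j \<cdot> (m2 \<cdot> e))"
  have d: "d \<in> Arr C" "Dom C d = Dom C b" "Cod C d = Dom C c"
    using ab(1-6) e(1-3) mm(1-6) jD(1-3) by (simp_all add: d_def)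
  have "j \<cdot> (m2 \<cdot> (e \<cdot> l)) = b \<cdot> l" unfolding e(4) mm(7) by (fact m(4))
  then have "d \<cdot> l = Zero C (Dom C l) (Dom C c)"
    using ab(1-6) e(1-3) mm(1-6) jD(1-3) lD by (simp add: d_def)
  then obtain \<sigma> where \<sigma>: "\<sigma> \<in> Arr C" "Dom C \<sigma> = Cod C c" "Cod C \<sigma> = Dom C c" "\<sigma> \<cdot> (c \<cdot> b) = d"
    using cokernel_factor[OF lD0(6), of d] d lD cb by auto
  have cs: "c \<cdot> \<sigma> = Ident C (Cod C c)"
  proof (rule cokernel_epi[OF lD0(6)])
    have "(c \<cdot> \<sigma>) \<cdot> (c \<cdot> b) = c \<cdot> d" using \<sigma> cb jD(1-3) by simp
    also have "\<dots> = c \<cdot> b"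
      using ab(1-6) e(1-3) mm(1-6) jD by (simp add: d_def Comp_reassoc[OF jD(4)])
    finally show "(c \<cdot> \<sigma>) \<cdot> (c \<cdot> b) = Ident C (Cod C c) \<cdot> (c \<cdot> b)" using cb by simp
  qed (use \<sigma> cb jD in simp_all)
  \<comment> \<open>The section also places the cokernel in \<open>\<Y>\<close>: modulo
    \<open>\<omega>\<close> it comes from some \<open>w\<close>, and \<open>c\<close> kills
    \<open>j \<cdot> w\<close>. So the identity of the cokernel factors through an object of
    \<open>\<omega>\<close>.\<close>
  obtain w where w: "w \<in> Arr C" "Dom C w = Cod C c" "Cod C w = Dom C j" "j \<cdot> w \<approx> \<sigma>"
    using wbij_surj[OF wj \<sigma>(1)] \<sigma> cX jD(3) by metis
  have "fac (\<sigma> \<^bold>+ neg (j \<cdot> w))" using homot_sym[OF w(4)] by (simp add: homot_def)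
  then obtain a' b' where ab': "a' \<in> Arr C" "b' \<in> Arr C" "Cod C a' = Dom C b'" "Dom C b' \<in> \<omega>"
    "Dom C a' = Cod C c" "Cod C b' = Dom C c" "b' \<cdot> a' = \<sigma> \<^bold>+ neg (j \<cdot> w)"
    using facE[of "\<sigma> \<^bold>+ neg (j \<cdot> w)"] \<sigma> w(1-3) jD(1-3) by auto
  have "(c \<cdot> b') \<cdot> a' = c \<cdot> (b' \<cdot> a')" using ab'(1-6) jD(1-3) by simp
  also have "\<dots> = Ident C (Cod C c)"
    unfolding ab'(7) using \<sigma>(1-3) cs w(1-3) jD by (simp add: Comp_reassoc[OF jD(4)])
  finally have "Dom C a' \<in> \<Y>"
    using retract_in_summand_closed[OF Y_summand, of "Dom C b'" a' "c \<cdot> b'"] ab'(1-6) jD(1-3) by simp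
  then show ?thesis using that[of \<sigma>] \<sigma> cs cX ab'(5) by simp
qed

lemma Weq_iff_wbij: "f \<in> Weq\<^sub>\<omega> C \<omega> \<Y> \<longleftrightarrow> wbij f"
proof
  assume "f \<in> Weq\<^sub>\<omega> C \<omega> \<Y>"
  then obtain W S jA jW pA pW g where *: "W \<in> \<omega>" "is_biproduct C S (Dom C f) W jA jW pA pW"
    "Ydefl g" "Dom C g = S" "g \<cdot> jA = f"
    unfolding Weq_iff by blast
  show "wbij f"
    using wbij_Comp[OF biproduct_wbij[OF *(2,1)] Ydefl_wbij[OF *(3)]] is_biproductD[OF *(2)] * by simp
next
  assume f: "wbij f"
  note fA = wbij_Arr[OF f]
  obtain j q where jq: "j \<in> CoFib\<^sub>\<omega> C \<X>" "Ydefl q" "Dom C j = Dom C f" "Cod C j = Dom C q"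
    "Cod C q = Cod C f" "q \<cdot> j = f" using factor_cofib_Ydefl[OF fA] .
  obtain c where c: "(j, c) \<in> Conf C" "Cod C c \<in> \<X>" using jq(1) by (auto simp: CoFib_iff)
  note jD = confD[OF c(1)]
  have "wbij j"
    using wbij_cancel_left[OF Ydefl_wbij[OF jq(2)] _ jq(4) jD(1)] f jq(6) by simp
  then obtain \<sigma> where \<sigma>: "Cod C c \<in> \<omega>" "\<sigma> \<in> Arr C" "Dom C \<sigma> = Cod C c" "Cod C \<sigma> = Dom C c"
    "c \<cdot> \<sigma> = Ident C (Cod C c)" using wbij_cofib_split[OF c] by blast
  obtain r where "is_biproduct C (Dom C c) (Dom C j) (Cod C c) j \<sigma> r c"
    using split_kernel_biproduct[OF jD(5) \<sigma>(2-5)] by blast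
  then show "f \<in> Weq\<^sub>\<omega> C \<omega> \<Y>"
    unfolding Weq_iff using fA \<sigma>(1) jq jD(3) by metis
qed

lemma CoFib_Int_Weq: "CoFib\<^sub>\<omega> C \<X> \<inter> Weq\<^sub>\<omega> C \<omega> \<Y> = {f. split_mono C f \<and> Coker_in C f \<omega>}"
proof (intro Set.set_eqI iffI)
  fix f assume "f \<in> CoFib\<^sub>\<omega> C \<X> \<inter> Weq\<^sub>\<omega> C \<omega> \<Y>"
  then obtain c where c: "(f, c) \<in> Conf C" "Cod C c \<in> \<X>" and "wbij f"
    by (auto simp: CoFib_iff Weq_iff_wbij)
  then obtain \<sigma> where \<sigma>: "Cod C c \<in> \<omega>" "\<sigma> \<in> Arr C" "Dom C \<sigma> = Cod C c" "Cod C \<sigma> = Dom C c"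
    "c \<cdot> \<sigma> = Ident C (Cod C c)" using wbij_cofib_split[OF c] by blast
  note fD = confD[OF c(1)]
  obtain r where bi: "is_biproduct C (Dom C c) (Dom C f) (Cod C c) f \<sigma> r c"
    using split_kernel_biproduct[OF fD(5) \<sigma>(2-5)] by blast
  have "split_mono C f" using is_biproductD[OF bi] by (auto simp: split_mono_def)
  then show "f \<in> {f. split_mono C f \<and> Coker_in C f \<omega>}" using \<sigma>(1) fD(6) by (auto simp: Coker_in_def)
next
  fix f assume "f \<in> {f. split_mono C f \<and> Coker_in C f \<omega>}"
  then obtain c r where f: "split_mono C f" and c: "is_cokernel C c f" "Cod C c \<in> \<omega>"
    and r: "r \<in> Arr C" "Dom C r = Cod C f" "Cod C r = Dom C f" "r \<cdot> f = Ident C (Dom C f)"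
    by (auto simp: Coker_in_def split_mono_def)
  have "(f, c) \<in> Conf C" using inflation_cokernel_Conf[OF split_mono_inflation[OF f] c(1)] .
  then have "f \<in> CoFib\<^sub>\<omega> C \<X>" using c(2) by (auto simp: CoFib_iff)
  moreover obtain s where "is_biproduct C (Cod C f) (Dom C f) (Cod C c) f s r c"
    using split_cokernel_biproduct[OF c(1) r] .
  ultimately show "f \<in> CoFib\<^sub>\<omega> C \<X> \<inter> Weq\<^sub>\<omega> C \<omega> \<Y>"
    using biproduct_wbij c(2) Weq_iff_wbij by blast
qed

text \<open>The target of \<open>i\<close> is the biproduct of its source with an object of
  \<open>\<omega>\<close>, so the diagonal is chosen componentwise: \<open>u\<close> on the source,
  and a lift of \<open>v \<cdot> s\<close> supplied by \<open>\<omega>\<close>-epicness on the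
  complement.\<close>

lemma trivial_cofib_lifts:
  assumes "split_mono C i" "Coker_in C i \<omega>" "p \<in> Fib\<^sub>\<omega> C \<omega>"
  shows "lifts_against C i p"
  unfolding lifts_against_def
proof (intro ballI impI)
  fix u v assume u: "u \<in> Hom C (Dom C i) (Dom C p)" and v: "v \<in> Hom C (Cod C i) (Cod C p)"
    and e: "p \<cdot> u = v \<cdot> i"
  obtain c r where c: "is_cokernel C c i" "Cod C c \<in> \<omega>"
    and r: "r \<in> Arr C" "Dom C r = Cod C i" "Cod C r = Dom C i" "r \<cdot> i = Ident C (Dom C i)"
    using assms by (auto simp: Coker_in_def split_mono_def)
  obtain s where bi: "is_biproduct C (Cod C i) (Dom C i) (Cod C c) i s r c"
    using split_cokernel_biproduct[OF c(1) r] .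
  note b = is_biproductD[OF bi]
  have p: "p \<in> Arr C" using assms(3) by (simp add: Fib_iff)
  have "v \<cdot> s \<in> Arr C" "Dom C (v \<cdot> s) = Cod C c" "Cod C (v \<cdot> s) = Cod C p" using v b by simp_all
  then obtain w where w: "w \<in> Arr C" "Dom C w = Cod C c" "Cod C w = Dom C p" "p \<cdot> w = v \<cdot> s"
    using assms(3) c(2) unfolding Fib_iff by (metis Hom_iff)
  let ?h = "u \<cdot> r \<^bold>+ w \<cdot> c"
  have "?h \<cdot> i = u" using u w b by simp
  moreover have "p \<cdot> ?h = v"
    by (rule biproduct_right_ext[OF bi]) (use u v w b p e in simp_all)
  ultimately show "\<exists>h \<in> Hom C (Cod C i) (Dom C p). h \<cdot> i = u \<and> p \<cdot> h = v"
    using u w b by (intro bexI[of _ ?h]) simp_all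
qed

lemma model_structure:
  assumes "contravariantly_finite C \<omega>"
  shows "model_structure C (CoFib\<^sub>\<omega> C \<X>) (Fib\<^sub>\<omega> C \<omega>) (Weq\<^sub>\<omega> C \<omega> \<Y>)"
proof
  show "CoFib\<^sub>\<omega> C \<X> \<subseteq> Arr C" "Fib\<^sub>\<omega> C \<omega> \<subseteq> Arr C" "Weq\<^sub>\<omega> C \<omega> \<Y> \<subseteq> Arr C"
    using inflation_Arr by (auto simp: CoFib\<^sub>\<omega>_def Fib\<^sub>\<omega>_def Weq\<^sub>\<omega>_def)
next
  fix f g A B D assume "f \<in> Hom C A B" "g \<in> Hom C B D"
  then show "(f \<in> Weq\<^sub>\<omega> C \<omega> \<Y> \<and> g \<in> Weq\<^sub>\<omega> C \<omega> \<Y> \<longrightarrow> g \<cdot> f \<in> Weq\<^sub>\<omega> C \<omega> \<Y>) \<and>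
      (f \<in> Weq\<^sub>\<omega> C \<omega> \<Y> \<and> g \<cdot> f \<in> Weq\<^sub>\<omega> C \<omega> \<Y> \<longrightarrow> g \<in> Weq\<^sub>\<omega> C \<omega> \<Y>) \<and>
      (g \<in> Weq\<^sub>\<omega> C \<omega> \<Y> \<and> g \<cdot> f \<in> Weq\<^sub>\<omega> C \<omega> \<Y> \<longrightarrow> f \<in> Weq\<^sub>\<omega> C \<omega> \<Y>)"
    unfolding Weq_iff_wbij
    using wbij_Comp[of f g] wbij_cancel_left[of g f] wbij_cancel_right[of f g] by auto
next
  show "retract_closed C (CoFib\<^sub>\<omega> C \<X>)" by (rule CoFib_retract)
  show "retract_closed C (Fib\<^sub>\<omega> C \<omega>)" by (rule Fib_retract)
  show "retract_closed C (Weq\<^sub>\<omega> C \<omega> \<Y>)" unfolding retract_closed_def Weq_iff_wbij using wbij_retract Weq_iff_wbij by blast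
next
  fix i p assume "i \<in> CoFib\<^sub>\<omega> C \<X>" "p \<in> Fib\<^sub>\<omega> C \<omega> \<inter> Weq\<^sub>\<omega> C \<omega> \<Y>"
  then show "lifts_against C i p" using CoFib_lifts_Ydefl Fib_Int_Weq by blast
next
  fix i p assume "i \<in> CoFib\<^sub>\<omega> C \<X> \<inter> Weq\<^sub>\<omega> C \<omega> \<Y>" "p \<in> Fib\<^sub>\<omega> C \<omega>"
  then show "lifts_against C i p" using trivial_cofib_lifts CoFib_Int_Weq by blast
next
  fix f assume f: "f \<in> Arr C"
  \<comment> \<open>Here contravariant finiteness is used: adjoining an approximation
    \<open>t\<close> to \<open>f\<close> makes \<open>(f, t)\<close> an \<open>\<omega>\<close>-epic
    arrow because \<open>t\<close> already is one.\<close>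
  obtain t where t: "right_approximation C \<omega> (Cod C f) t"
    using assms f unfolding contravariantly_finite_def by fastforce
  then have t': "t \<in> Arr C" "Dom C t \<in> \<omega>" "Cod C t = Cod C f" by (auto simp: right_approximation_def)
  obtain S jA jT pA pT where bi: "is_biproduct C S (Dom C f) (Dom C t) jA jT pA pT"
    using biproduct_exists[of "Dom C f" "Dom C t"] f t' by auto
  note b = is_biproductD[OF bi]
  obtain g where g: "g \<in> Arr C" "Dom C g = S" "Cod C g = Cod C f" "g \<cdot> jA = f" "g \<cdot> jT = t"
    using biproduct_copair[OF bi f t'(1)] t'(3) by metis
  have "jA \<in> CoFib\<^sub>\<omega> C \<X> \<inter> Weq\<^sub>\<omega> C \<omega> \<Y>"
    using biproduct_wbij[OF bi] biproduct_Conf[OF bi] b t'(2) by (auto simp: Weq_iff_wbij CoFib_iff)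
  moreover have "g \<in> Fib\<^sub>\<omega> C \<omega>" unfolding Fib_iff
  proof (intro conjI ballI impI)
    fix w assume w: "w \<in> Arr C" "Dom C w \<in> \<omega> \<and> Cod C w = Cod C g"
    then have "w \<in> Hom C (Dom C w) (Cod C f)" using g by simp
    then obtain v where v: "v \<in> Hom C (Dom C w) (Dom C t)" "t \<cdot> v = w"
      using t w unfolding right_approximation_def by blast
    have "g \<cdot> (jT \<cdot> v) = w" using v g b by (simp add: Comp_reassoc[OF g(5)])
    then show "\<exists>u \<in> Hom C (Dom C w) (Dom C g). g \<cdot> u = w"
      using v b g by (intro bexI[of _ "jT \<cdot> v"]) auto
  qed (rule g)
  ultimately show "\<exists>i \<in> CoFib\<^sub>\<omega> C \<X> \<inter> Weq\<^sub>\<omega> C \<omega> \<Y>. \<exists>p \<in> Fib\<^sub>\<omega> C \<omega>. Dom C i = Dom C f \<and>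
      Cod C i = Dom C p \<and> Cod C p = Cod C f \<and> f = p \<cdot> i"
    using b g by (intro bexI[of _ jA] bexI[of _ g]) simp_all
next
  fix f assume f: "f \<in> Arr C"
  obtain j q where jq: "j \<in> CoFib\<^sub>\<omega> C \<X>" "Ydefl q" "Dom C j = Dom C f" "Cod C j = Dom C q"
    "Cod C q = Cod C f" "q \<cdot> j = f" using factor_cofib_Ydefl[OF f] .
  then show "\<exists>j \<in> CoFib\<^sub>\<omega> C \<X>. \<exists>q \<in> Fib\<^sub>\<omega> C \<omega> \<inter> Weq\<^sub>\<omega> C \<omega> \<Y>. Dom C j = Dom C f \<and>
      Cod C j = Dom C q \<and> Cod C q = Cod C f \<and> f = q \<cdot> j"
    unfolding Fib_Int_Weq by (intro bexI[of _ j] bexI[of _ q]) auto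
qed

text \<open>The composite from zero to \<open>X\<close> and back is an identity, so by
  two-out-of-three the arrow from \<open>X\<close> to zero is a weak equivalence too. It is a
  fibration for every \<open>X\<close>, hence a trivial fibration, with kernel
  \<open>X\<close>.\<close>

lemma trivial_objs_eq: "trivial_objs C (Weq\<^sub>\<omega> C \<omega> \<Y>) = \<Y>"
proof (intro Set.set_eqI iffI)
  fix X assume "X \<in> trivial_objs C (Weq\<^sub>\<omega> C \<omega> \<Y>)"
  then obtain Z f where X: "X \<in> Obj C" and Z: "is_zero_obj C Z" and f: "f \<in> Hom C Z X" "wbij f"
    by (auto simp: trivial_objs_def Weq_iff_wbij)
  have ZO: "Z \<in> Obj C" "Ident C Z = Zero C Z Z" using Z unfolding zero_obj_Ident by auto
  have "wbij (Zero C X Z \<cdot> f)" using wbij_Ident[OF ZO(1)] ZO f(1) X by simp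
  then have "wbij (Zero C X Z)" using wbij_cancel_right[OF f(2), of "Zero C X Z"] f(1) ZO X by simp
  then have "Ydefl (Zero C X Z)" using Fib_Int_Weq Fib_to_zero[OF Z X] Weq_iff_wbij by blast
  then show "X \<in> \<Y>" using Ydefl_to_zero[OF Z X] by simp
next
  fix X assume X: "X \<in> \<Y>"
  obtain Z where Z: "is_zero_obj C Z" using zero_obj_exists by blast
  have ZO: "Z \<in> Obj C" "Ident C Z = Zero C Z Z" using Z unfolding zero_obj_Ident by auto
  have "wbij (Zero C X Z)" using Ydefl_wbij Ydefl_to_zero[OF Z] X by simp
  moreover have "wbij (Zero C X Z \<cdot> Zero C Z X)" using wbij_Ident[OF ZO(1)] ZO X by simp
  ultimately have "wbij (Zero C Z X)" by (rule wbij_cancel_left) (use ZO X in simp_all)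
  then show "X \<in> trivial_objs C (Weq\<^sub>\<omega> C \<omega> \<Y>)"
    unfolding trivial_objs_def Weq_iff_wbij using Z ZO X by (auto intro!: exI[of _ Z])
qed

end

section \<open>From the model structure to the cotorsion pair\<close>

locale model_pair = subcat_pair +
  assumes model: "model_structure C (CoFib\<^sub>\<omega> C \<X>) (Fib\<^sub>\<omega> C \<omega>) (Weq\<^sub>\<omega> C \<omega> \<Y>)"
begin

lemma model_ext_vanish:
  assumes A: "A \<in> \<X>" and B: "B \<in> \<Y>"
  shows "ext_vanish A B"
proof (rule ext_vanish_retractionI)
  fix i d assume id: "(i, d) \<in> Conf C" "Dom C i = B" "Cod C d = A"
  note iD = confD[OF id(1)]
  obtain Z where Z: "is_zero_obj C Z" using zero_obj_exists by blast
  have ZO: "Z \<in> Obj C" using Z by (rule zero_obj_Obj)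
  have "Zero C B Z \<in> Fib\<^sub>\<omega> C \<omega> \<inter> Weq\<^sub>\<omega> C \<omega> \<Y>"
    using Fib_to_zero[OF Z] Ydefl_to_zero[OF Z] Ydefl_Weq B by auto
  moreover have "i \<in> CoFib\<^sub>\<omega> C \<X>" using id A by (auto simp: CoFib_iff)
  ultimately have "lifts_against C i (Zero C B Z)" using model_structure.CoFib_lifting[OF model] by blast
  \<comment> \<open>The square has the identity of \<open>B\<close> on top and the zero arrow at the
    bottom, so its diagonal is a retraction of \<open>i\<close>.\<close>
  then obtain h where "h \<in> Arr C" "Dom C h = Cod C i" "Cod C h = Dom C (Zero C B Z)" "h \<cdot> i = Ident C B"
    by (rule lifts_againstE[where u = "Ident C B" and v = "Zero C (Cod C i) Z"])
      (use iD(1-3) id B ZO in simp_all)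
  then show "\<exists>r. r \<in> Arr C \<and> Dom C r = Dom C d \<and> Cod C r = B \<and> r \<cdot> i = Ident C B"
    using iD(3) B ZO by auto
qed

sublocale orthogonal_pair C \<X> \<Y>
  by unfold_locales (rule model_ext_vanish)

lemma model_X_cover:
  assumes "A \<in> Obj C"
  obtains i d where "(i, d) \<in> Conf C" "Dom C i \<in> \<Y>" "Dom C d \<in> \<X>" "Cod C d = A"
proof -
  obtain Z where Z: "is_zero_obj C Z" using zero_obj_exists by blast
  have ZO: "Z \<in> Obj C" using Z by (rule zero_obj_Obj)
  have "Zero C Z A \<in> Arr C" using ZO assms by simp
  then obtain j q where jq: "j \<in> CoFib\<^sub>\<omega> C \<X>" "Ydefl q" "Dom C j = Z" "Cod C j = Dom C q" "Cod C q = A"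
    using model_structure.factor_trivial_fibration[OF model, of "Zero C Z A"] ZO assms
    unfolding Fib_Int_Weq by auto
  have "j \<in> Arr C" using jq(1) inflation_Arr by (auto simp: CoFib\<^sub>\<omega>_def)
  then have "j = Zero C Z (Dom C q)" using zero_obj_arrow(1)[OF Z, of j] jq(3,4) by metis
  then have "Dom C q \<in> \<X>" using CoFib_from_zero[OF Z, of "Dom C q"] jq(1,2) Ydefl_Arr by simp
  then show ?thesis using that jq(2,5) unfolding Ydefl_def by blast
qed

lemma model_Y_envelope:
  assumes "A \<in> Obj C"
  obtains i d where "(i, d) \<in> Conf C" "Dom C i = A" "Dom C d \<in> \<Y>" "Cod C d \<in> \<X>"
proof -
  obtain Z where Z: "is_zero_obj C Z" using zero_obj_exists by blast
  have ZO: "Z \<in> Obj C" using Z by (rule zero_obj_Obj)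
  have "Zero C A Z \<in> Arr C" using ZO assms by simp
  then obtain j q where jq: "j \<in> CoFib\<^sub>\<omega> C \<X>" "Ydefl q" "Dom C j = A" "Cod C j = Dom C q" "Cod C q = Z"
    using model_structure.factor_trivial_fibration[OF model, of "Zero C A Z"] ZO assms
    unfolding Fib_Int_Weq by auto
  have "q = Zero C (Dom C q) Z" using zero_obj_arrow(2)[OF Z, of q] Ydefl_Arr jq(2,5) by metis
  then have Y: "Dom C q \<in> \<Y>" using Ydefl_to_zero[OF Z, of "Dom C q"] jq(2) Ydefl_Arr by simp
  obtain c where c: "(j, c) \<in> Conf C" "Cod C c \<in> \<X>" using jq(1) by (auto simp: CoFib_iff)
  then show ?thesis using that[of j c] jq Y confD(3)[OF c(1)] by simp
qed

text \<open>A cover of \<open>Z\<close> has its kernel in \<open>\<Y>\<close>, so it splits and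
  makes \<open>Z\<close> a summand of an object of \<open>\<X>\<close>.\<close>

lemma model_X_perp:
  assumes "Z \<in> Obj C" "\<And>B. B \<in> \<Y> \<Longrightarrow> ext_vanish Z B"
  shows "Z \<in> \<X>"
proof -
  obtain i d where id: "(i, d) \<in> Conf C" "Dom C i \<in> \<Y>" "Dom C d \<in> \<X>" "Cod C d = Z"
    using model_X_cover[OF assms(1)] .
  obtain r s where "is_biproduct C (Dom C d) (Dom C i) (Cod C d) i s r d"
    using ext_vanishE[OF _ id(1)] assms(2) id by metis
  note b = is_biproductD[OF this]
  show ?thesis using retract_in_summand_closed[OF X_summand id(3), of s d] b id by simp
qed

lemma model_Y_perp:
  assumes "Z \<in> Obj C" "\<And>B. B \<in> \<X> \<Longrightarrow> ext_vanish B Z"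
  shows "Z \<in> \<Y>"
proof -
  obtain i d where id: "(i, d) \<in> Conf C" "Dom C i = Z" "Dom C d \<in> \<Y>" "Cod C d \<in> \<X>"
    using model_Y_envelope[OF assms(1)] .
  obtain r s where "is_biproduct C (Dom C d) (Dom C i) (Cod C d) i s r d"
    using ext_vanishE[OF _ id(1)] assms(2) id by metis
  note b = is_biproductD[OF this]
  show ?thesis using retract_in_summand_closed[OF Y_summand id(3), of i r] b id by simp
qed

text \<open>Both \<open>d\<close> and the arrow from its source to zero have kernels in
  \<open>\<Y>\<close>, so two-out-of-three makes the arrow from the cokernel to zero a weak
  equivalence. Every object is fibrant, so it is a trivial fibration.\<close>

lemma model_Y_coresolving:
  assumes "(i, d) \<in> Conf C" "Dom C i \<in> \<Y>" "Dom C d \<in> \<Y>"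
  shows "Cod C d \<in> \<Y>"
proof -
  note iD = confD[OF assms(1)]
  obtain Z where Z: "is_zero_obj C Z" using zero_obj_exists by blast
  have ZO: "Z \<in> Obj C" using Z by (rule zero_obj_Obj)
  have "d \<in> Weq\<^sub>\<omega> C \<omega> \<Y>" using assms(1,2) Ydefl_Weq by (auto simp: Ydefl_def)
  moreover have "Zero C (Cod C d) Z \<cdot> d \<in> Weq\<^sub>\<omega> C \<omega> \<Y>"
    using Ydefl_Weq Ydefl_to_zero[OF Z, of "Dom C d"] assms(3) iD(1-2) ZO by simp
  ultimately have "Zero C (Cod C d) Z \<in> Weq\<^sub>\<omega> C \<omega> \<Y>"
    using model_structure.two_of_three[OF model, of d "Dom C d" "Cod C d" "Zero C (Cod C d) Z" Z] iD(2) ZO by simp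
  then have "Ydefl (Zero C (Cod C d) Z)"
    using Fib_to_zero[OF Z, of "Cod C d"] iD(2) Fib_Int_Weq by auto
  then show ?thesis using Ydefl_to_zero[OF Z, of "Cod C d"] iD(2) by simp
qed

text \<open>For a conflation \<open>L \<rightarrow> M \<rightarrow> X\<close> with \<open>M, X \<in> \<X>\<close>, take a cover \<open>F \<rightarrow> V \<rightarrow> L\<close>, an envelope
  \<open>V \<rightarrow> I\<close>, and the pushout \<open>P = I/F\<close>, which lies in \<open>\<Y>\<close>. Then \<open>L \<rightarrow> P\<close> extends to \<open>M\<close> and lifts to
  \<open>I\<close>, and this splits the cover because \<open>V\<close> is also the pullback of \<open>L \<rightarrow> P \<leftarrow> I\<close>.\<close>

lemma model_X_resolving:
  assumes ld: "(l, d) \<in> Conf C" and M: "Dom C d \<in> \<X>" and X: "Cod C d \<in> \<X>"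
  shows "Dom C l \<in> \<X>"
proof -
  note lD = confD[OF ld]
  obtain k q where kq: "(k, q) \<in> Conf C" "Dom C k \<in> \<Y>" "Dom C q \<in> \<X>" "Cod C q = Dom C l"
    using model_X_cover[of "Dom C l"] lD by auto
  note kD = confD[OF kq(1)]
  obtain i x where ix: "(i, x) \<in> Conf C" "Dom C i = Dom C q" "Dom C x \<in> \<Y>" "Cod C x \<in> \<X>"
    using model_Y_envelope[of "Dom C q"] kD by auto
  note iD = confD[OF ix(1)]
  have "inflation C (i \<cdot> k)" using inflation_Comp[OF kD(7) iD(7)] kD(3) ix(2) by simp
  then obtain z where z: "(i \<cdot> k, z) \<in> Conf C" by (auto simp: inflation_def)
  note zD0 = confD[OF z]
  have ik: "i \<cdot> k \<in> Arr C" "Dom C (i \<cdot> k) = Dom C k" "Cod C (i \<cdot> k) = Dom C x"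
    using kD(1-3) iD(1-3) ix(2) by simp_all
  have zD: "z \<in> Arr C" "Dom C z = Dom C x" "z \<cdot> (i \<cdot> k) = Zero C (Dom C k) (Cod C z)"
    using zD0(2-4) ik by simp_all
  \<comment> \<open>The object \<open>P\<close> is realised as the cokernel of
    \<open>F \<rightarrow> V \<rightarrow> I\<close>. As \<open>F\<close> and \<open>I\<close> lie
    in \<open>\<Y>\<close>, the half of heredity already established applies.\<close>
  have zY: "Cod C z \<in> \<Y>" using model_Y_coresolving[OF z] ik ix(3) kq(2) zD by simp
  have "(z \<cdot> i) \<cdot> k = Zero C (Dom C k) (Cod C z)" using zD kD(1-3) iD(1-3) ix(2) by simp
  then obtain t where t: "t \<in> Arr C" "Dom C t = Dom C l" "Cod C t = Cod C z" "t \<cdot> q = z \<cdot> i"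
    using cokernel_factor[OF kD(6), of "z \<cdot> i"] zD kD(1-3) iD(1-3) ix(2) kq(4) by auto
  obtain g where g: "g \<in> Arr C" "Cod C g = Cod C z" "Dom C g = Dom C d" "g \<cdot> l = t"
    using cofib_extend[OF ld X t(1)] t zY lD(3) by metis
  have "Ydefl z" unfolding Ydefl_def using z ik(2) kq(2) by metis
  then obtain h where h: "h \<in> Arr C" "Dom C h = Dom C d" "Cod C h = Dom C x" "z \<cdot> h = g"
    using Ydefl_lift[of z g] g M zD(2) by metis
  text \<open>\<open>h \<cdot> l \<cdot> q - i\<close> is killed by \<open>z\<close>, so it factors through \<open>F\<close>; the correction descends
    to the section.\<close>
  have "z \<cdot> (h \<cdot> (l \<cdot> q) \<^bold>+ neg i) = Zero C (Dom C q) (Cod C z)"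
  proof -
    have "z \<cdot> (h \<cdot> (l \<cdot> q)) = (g \<cdot> l) \<cdot> q"
      using h(1-3) zD(1,2) lD(1-3) kD(1-3) kq(4) g(1-3) by (simp add: Comp_reassoc[OF h(4)])
    also have "\<dots> = z \<cdot> i" unfolding g(4) by (fact t(4))
    finally show ?thesis
      using h(1-3) zD(1,2) lD(1-3) kD(1-3) kq(4) iD(1-3) ix(2) by simp
  qed
  then obtain a where a: "a \<in> Arr C" "Dom C a = Dom C q" "Cod C a = Dom C k"
    "(i \<cdot> k) \<cdot> a = h \<cdot> (l \<cdot> q) \<^bold>+ neg i"
    using kernel_factor[OF zD0(5), of "h \<cdot> (l \<cdot> q) \<^bold>+ neg i"] h(1-3) zD(1,2) lD(1-3) kD(1-3) kq(4) iD(1-3) ix(2) ik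
    by auto
  \<comment> \<open>Modulo \<open>F\<close> this is the identity, so \<open>q \<cdot> b = q\<close>.
    On the other hand \<open>i \<cdot> b = h \<cdot> (l \<cdot> q)\<close> vanishes on
    \<open>F\<close>, hence so does \<open>b\<close>, and \<open>b\<close> descends along
    \<open>q\<close> to a section.\<close>
  define b where "b = Ident C (Dom C q) \<^bold>+ k \<cdot> a"
  have b: "b \<in> Arr C" "Dom C b = Dom C q" "Cod C b = Dom C q" using a kD(1-3) by (simp_all add: b_def)
  have ib: "i \<cdot> b = h \<cdot> (l \<cdot> q)"
  proof -
    have "i \<cdot> b = i \<^bold>+ (i \<cdot> k) \<cdot> a" using a(1-3) kD(1-3) iD(1-3) ix(2) by (simp add: b_def)
    then show ?thesis unfolding a(4) using h(1-3) lD(1-3) kD(1-3) kq(4) iD(1-3) ix(2) by simp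
  qed
  have "b \<cdot> k = Zero C (Dom C k) (Dom C q)"
  proof (rule kernel_mono[OF iD(5)])
    have "i \<cdot> (b \<cdot> k) = h \<cdot> (l \<cdot> (q \<cdot> k))"
      using b iD(1-3) ix(2) kD(1-3) h(1-3) lD(1-3) kq(4) by (simp add: Comp_reassoc[OF ib])
    then show "i \<cdot> (b \<cdot> k) = i \<cdot> Zero C (Dom C k) (Dom C q)"
      using kD iD(1-3) ix(2) h(1-3) lD(1-3) kq(4) by simp
  qed (use b kD iD ix(2) in simp_all)
  then obtain s where s: "s \<in> Arr C" "Dom C s = Dom C l" "Cod C s = Dom C q" "s \<cdot> q = b"
    using cokernel_factor[OF kD(6), of b] b kD(3) kq(4) by metis
  have "q \<cdot> s = Ident C (Dom C l)"
    by (rule cokernel_epi[OF kD(6)])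
      (use s a(1-3) kD kq(4) lD(1) in \<open>simp_all add: b_def Comp_reassoc[OF kD(4)]\<close>)
  then show ?thesis
    using retract_in_summand_closed[OF X_summand kq(3), of s q] s kD(2) kq(4) by simp
qed

sublocale complete_hereditary_pair C \<X> \<Y>
proof unfold_locales
  fix A assume A: "A \<in> Obj C"
  show "\<exists>i d. (i, d) \<in> Conf C \<and> Dom C i \<in> \<Y> \<and> Dom C d \<in> \<X> \<and> Cod C d = A"
    using model_X_cover[OF A] by metis
  show "\<exists>i d. (i, d) \<in> Conf C \<and> Dom C i = A \<and> Dom C d \<in> \<Y> \<and> Cod C d \<in> \<X>"
    using model_Y_envelope[OF A] by metis
qed (use model_X_perp model_Y_perp model_X_resolving model_Y_coresolving in blast)+

text \<open>Factoring \<open>0 \<rightarrow> B\<close> as a trivial cofibration followed by a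
  fibration yields a middle object that is cofibrant and trivial, hence in \<open>\<omega>\<close>;
  the \<open>\<omega>\<close>-epic arrow from it to \<open>B\<close> is the approximation.\<close>

lemma model_contravariantly_finite: "contravariantly_finite C \<omega>"
  unfolding contravariantly_finite_def
proof
  fix B assume B: "B \<in> Obj C"
  obtain Z where Z: "is_zero_obj C Z" using zero_obj_exists by blast
  have ZO: "Z \<in> Obj C" using Z by (rule zero_obj_Obj)
  have "Zero C Z B \<in> Arr C" using ZO B by simp
  then obtain j q where jq: "j \<in> CoFib\<^sub>\<omega> C \<X> \<inter> Weq\<^sub>\<omega> C \<omega> \<Y>" "q \<in> Fib\<^sub>\<omega> C \<omega>" "Dom C j = Z"
    "Cod C j = Dom C q" "Cod C q = B"
    using model_structure.factor_trivial_cofibration[OF model, of "Zero C Z B"] ZO B by auto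
  have jA: "j \<in> Arr C" using jq(1) inflation_Arr by (auto simp: CoFib\<^sub>\<omega>_def)
  have j: "j = Zero C Z (Dom C q)" using zero_obj_arrow(1)[OF Z jA] jq(3,4) by metis
  have q: "q \<in> Arr C" using jq(2) by (simp add: Fib_iff)
  have "Dom C q \<in> \<X>" using CoFib_from_zero[OF Z, of "Dom C q"] j jq(1) q by simp
  moreover have "Dom C q \<in> trivial_objs C (Weq\<^sub>\<omega> C \<omega> \<Y>)"
    unfolding trivial_objs_def
    using Z jq(1,3,4) jA q by (intro CollectI conjI exI[of _ Z] bexI[of _ j]) simp_all
  ultimately have "Dom C q \<in> \<omega>" by (simp add: trivial_objs_eq)
  then have "right_approximation C \<omega> B q"
    using jq(2,5) q unfolding right_approximation_def Fib_iff by (metis Hom_iff)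
  then show "\<exists>t. right_approximation C \<omega> B t" by blast
qed

end

section \<open>The homotopy category\<close>

context category
begin

lemma zigzag_Obj: "zigzag C W A p B \<Longrightarrow> A \<in> Obj C \<and> B \<in> Obj C"
proof (induction p arbitrary: A)
  case (Cons s p)
  then show ?case by (cases s) auto
qed auto

lemma zigzag_append: "zigzag C W A p B \<Longrightarrow> zigzag C W B q D \<Longrightarrow> zigzag C W A (p @ q) D"
  by (induction p arbitrary: A) auto

lemma zz_eq_zigzag: "zz_eq C W A B p q \<Longrightarrow> zigzag C W A p B \<and> zigzag C W A q B"
  by (induction rule: zz_eq.induct) (auto intro: zigzag_append)

lemma zz_class_eq_iff:
  assumes "zigzag C W A p B"
  shows "zz_class C W A p B = zz_class C W A q B \<longleftrightarrow> zz_eq C W A B p q"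
  unfolding zz_class_def using assms by (auto intro: zz_refl zz_sym zz_trans)

lemma loc_simps [simp]:
  "Obj (localization C W) = Obj C"
  "Dom (localization C W) (zz_class C W A p B) = A" "Cod (localization C W) (zz_class C W A p B) = B"
  "Ident (localization C W) A = zz_class C W A [] A"
  by (simp_all add: localization_def zz_class_def)

lemma loc_Arr: "\<Phi> \<in> Arr (localization C W) \<longleftrightarrow> (\<exists>A p B. zigzag C W A p B \<and> \<Phi> = zz_class C W A p B)"
  by (auto simp: localization_def)

lemma loc_ArrI [simp]: "zigzag C W A p B \<Longrightarrow> zz_class C W A p B \<in> Arr (localization C W)"
  by (auto simp: loc_Arr)

lemma loc_Hom: "\<Phi> \<in> Hom (localization C W) A B \<Longrightarrow> \<exists>p. zigzag C W A p B \<and> \<Phi> = zz_class C W A p B"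
  by (auto simp: loc_Arr)

text \<open>Zigzag equivalence is a congruence for concatenation, so the union over representatives
  in the definition collapses to a single class.\<close>

lemma loc_Comp [simp]:
  assumes "zigzag C W A p B" "zigzag C W B q D"
  shows "zz_class C W B q D \<cdot>\<^bsub>localization C W\<^esub> zz_class C W A p B = zz_class C W A (p @ q) D"
proof -
  have "(\<exists>p'. zz_eq C W A B p p' \<and> (\<exists>q'. zz_eq C W B D q q' \<and> zz_eq C W A D (p' @ q') r)) \<longleftrightarrow>
    zz_eq C W A D (p @ q) r" for r
    using assms by (meson zz_append zz_refl zz_trans)
  then show ?thesis by (simp add: localization_def zz_class_def)
qed

lemma category_localization: "category (localization C W)"
proof
  fix f assume "f \<in> Arr (localization C W)"
  then obtain A p B where "zigzag C W A p B" "f = zz_class C W A p B" by (auto simp: loc_Arr)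
  then show "Dom (localization C W) f \<in> Obj (localization C W)"
    "Cod (localization C W) f \<in> Obj (localization C W)" using zigzag_Obj by auto
next
  fix A assume "A \<in> Obj (localization C W)"
  then show "Ident (localization C W) A \<in> Hom (localization C W) A A" by simp
next
  fix f g A B D assume "f \<in> Hom (localization C W) A B" "g \<in> Hom (localization C W) B D"
  then obtain p q where "zigzag C W A p B" "f = zz_class C W A p B" "zigzag C W B q D" "g = zz_class C W B q D"
    using loc_Hom by metis
  then show "g \<cdot>\<^bsub>localization C W\<^esub> f \<in> Hom (localization C W) A D" using zigzag_append by auto
next
  fix f g h A B D E
  assume "f \<in> Hom (localization C W) A B" "g \<in> Hom (localization C W) B D" "h \<in> Hom (localization C W) D E"
  then obtain p q r where "zigzag C W A p B" "f = zz_class C W A p B" "zigzag C W B q D" "g = zz_class C W B q D"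
    "zigzag C W D r E" "h = zz_class C W D r E" using loc_Hom by metis
  then show "(h \<cdot>\<^bsub>localization C W\<^esub> g) \<cdot>\<^bsub>localization C W\<^esub> f =
      h \<cdot>\<^bsub>localization C W\<^esub> (g \<cdot>\<^bsub>localization C W\<^esub> f)"
    using zigzag_append[of W A p B q D] zigzag_append[of W B q D r E] by simp
next
  fix f A B assume "f \<in> Hom (localization C W) A B"
  then obtain p where "zigzag C W A p B" "f = zz_class C W A p B" using loc_Hom by metis
  then show "f \<cdot>\<^bsub>localization C W\<^esub> Ident (localization C W) A = f"
    "Ident (localization C W) B \<cdot>\<^bsub>localization C W\<^esub> f = f"
    using zigzag_Obj[of W A p B] by simp_all
qed

lemma loc_map_iso:
  assumes "w \<in> W" "w \<in> Arr C"
  shows "is_iso (localization C W) (loc_map C W w)"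
proof -
  have z: "zigzag C W (Dom C w) [Fwd w] (Cod C w)" "zigzag C W (Cod C w) [Bwd w] (Dom C w)"
    using assms by auto
  have "zz_eq C W (Dom C w) (Dom C w) [Fwd w, Bwd w] []" "zz_eq C W (Cod C w) (Cod C w) [Bwd w, Fwd w] []"
    using assms by (auto intro: zz_inv_right zz_inv_left)
  then have "zz_class C W (Dom C w) [Fwd w, Bwd w] (Dom C w) = zz_class C W (Dom C w) [] (Dom C w)"
    "zz_class C W (Cod C w) [Bwd w, Fwd w] (Cod C w) = zz_class C W (Cod C w) [] (Cod C w)"
    using zz_eq_zigzag zz_class_eq_iff by blast+
  then show ?thesis
    unfolding is_iso_def loc_map_def using z
    by (auto intro!: bexI[of _ "zz_class C W (Cod C w) [Bwd w] (Dom C w)"])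
qed

lemma zz_Fwd: "f \<in> Arr C \<Longrightarrow> zz_eq C W (Dom C f) (Cod C f) [Fwd f] [Fwd f]"
  by (rule zz_refl) simp

lemma zz_Comp:
  assumes "f \<in> Arr C" "g \<in> Arr C" "Cod C f = Dom C g"
  shows "zz_eq C W (Dom C f) (Cod C g) [Fwd f, Fwd g] [Fwd (g \<cdot> f)]"
  using zz_comp[of f C "Dom C f" "Dom C g" g "Cod C g"] assms by simp

end

section \<open>The additive quotient, and its arrows in the localization\<close>

context subcat_pair
begin

text \<open>Cosets of the null arrows are the classes of \<open>\<approx>\<close>; afterwards the
  quotient group is no longer unfolded element by element.\<close>

lemma quot_class_eq:
  assumes "f \<in> Arr C"
  shows "quot_class C \<omega> f = {g. g \<approx> f}"
proof -
  have "g \<in> quot_class C \<omega> f \<longleftrightarrow> (\<exists>h. fac h \<and> Dom C h = Dom C f \<and> Cod C h = Cod C f \<and> g = h \<^bold>+ f)" for g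
    by (auto simp: quot_class_def r_coset_def factoring_iff Hom_group_def)
  also have "\<dots> g \<longleftrightarrow> g \<approx> f" for g
  proof
    assume "\<exists>h. fac h \<and> Dom C h = Dom C f \<and> Cod C h = Cod C f \<and> g = h \<^bold>+ f"
    then show "g \<approx> f" using fac_Arr assms by (auto simp: homot_def Plus_assoc)
  next
    assume "g \<approx> f"
    then show "\<exists>h. fac h \<and> Dom C h = Dom C f \<and> Cod C h = Cod C f \<and> g = h \<^bold>+ f"
      by (intro exI[of _ "g \<^bold>+ neg f"]) (simp add: homot_def Plus_assoc)
  qed
  finally show ?thesis by blast
qed

abbreviation "qc f \<equiv> quot_class C \<omega> f"
abbreviation "Quot \<equiv> additive_quotient C \<X> \<omega>"

lemma qc_eq_iff: "f \<in> Arr C \<Longrightarrow> g \<in> Arr C \<Longrightarrow> qc f = qc g \<longleftrightarrow> f \<approx> g"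
  by (auto simp: quot_class_eq intro: homot_sym homot_trans homot_refl)

text \<open>Source and target of a coset are read off a chosen member, as is its image in the
  localization; any choice agrees with \<open>f\<close> modulo \<open>\<omega>\<close>.\<close>

lemma qc_some:
  assumes "f \<in> Arr C"
  shows "(SOME g. g \<in> qc f) \<approx> f"
proof -
  have "f \<in> qc f" using assms by (simp add: quot_class_eq)
  then have "(SOME g. g \<in> qc f) \<in> qc f" by (rule someI)
  then show ?thesis using assms by (simp add: quot_class_eq)
qed

lemma Quot_simps [simp]:
  "Obj Quot = \<X>" "Ident Quot A = qc (Ident C A)"
  "f \<in> Arr C \<Longrightarrow> Dom Quot (qc f) = Dom C f" "f \<in> Arr C \<Longrightarrow> Cod Quot (qc f) = Cod C f"
  using homot_parallel[OF qc_some] by (simp_all add: additive_quotient_def)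

lemma Quot_Arr: "F \<in> Arr Quot \<longleftrightarrow> (\<exists>f \<in> Arr C. Dom C f \<in> \<X> \<and> Cod C f \<in> \<X> \<and> F = qc f)"
proof -
  have "carrier (Hom_group C A B Mod factoring C \<omega> A B) = qc ` Hom C A B" for A B
    by (auto simp: FactGroup_def RCOSETS_def Hom_group_def quot_class_def)
  moreover have "F \<in> qc ` Hom C A B \<longleftrightarrow> (\<exists>f \<in> Arr C. Dom C f = A \<and> Cod C f = B \<and> F = qc f)" for A B
    by auto
  ultimately have "F \<in> Arr Quot \<longleftrightarrow> (\<exists>A \<in> \<X>. \<exists>B \<in> \<X>. \<exists>f \<in> Arr C. Dom C f = A \<and> Cod C f = B \<and> F = qc f)"
    by (simp add: additive_quotient_def)
  then show ?thesis by blast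
qed

lemma Quot_ArrI [simp]: "f \<in> Arr C \<Longrightarrow> Dom C f \<in> \<X> \<Longrightarrow> Cod C f \<in> \<X> \<Longrightarrow> qc f \<in> Arr Quot"
  by (auto simp: Quot_Arr)

lemma Quot_Hom: "F \<in> Hom Quot A B \<Longrightarrow> \<exists>f \<in> Arr C. Dom C f = A \<and> Cod C f = B \<and> A \<in> \<X> \<and> B \<in> \<X> \<and> F = qc f"
  by (auto simp: Quot_Arr)

lemma Quot_Comp [simp]:
  assumes "f \<in> Arr C" "g \<in> Arr C" "Cod C f = Dom C g"
  shows "qc g \<cdot>\<^bsub>Quot\<^esub> qc f = qc (g \<cdot> f)"
proof -
  have "qc (g' \<cdot> f') = qc (g \<cdot> f)" if "g' \<in> qc g" "f' \<in> qc f" for f' g'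
  proof -
    have gf: "g' \<approx> g" "f' \<approx> f" using that assms by (auto simp: quot_class_eq)
    have "g' \<cdot> f' \<approx> g \<cdot> f"
      by (rule homot_Comp[OF gf(2,1)]) (use homot_parallel[OF gf(1)] homot_parallel[OF gf(2)] assms(3) in simp)
    then show ?thesis using homot_parallel qc_eq_iff by blast
  qed
  moreover have "g \<in> qc g" "f \<in> qc f" using assms by (auto simp: quot_class_eq)
  ultimately have "(\<Union>g' \<in> qc g. \<Union>f' \<in> qc f. qc (g' \<cdot> f')) = qc (g \<cdot> f)" by blast
  then show ?thesis by (simp add: additive_quotient_def)
qed

lemma category_Quot: "category Quot"
proof
  fix f assume "f \<in> Arr Quot"
  then show "Dom Quot f \<in> Obj Quot" "Cod Quot f \<in> Obj Quot" by (auto simp: Quot_Arr)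
next
  fix A assume "A \<in> Obj Quot"
  then show "Ident Quot A \<in> Hom Quot A A" by simp
next
  fix f g A B D assume "f \<in> Hom Quot A B" "g \<in> Hom Quot B D"
  then obtain f' g' where "f' \<in> Arr C" "Dom C f' = A" "Cod C f' = B" "f = qc f'" "A \<in> \<X>"
    "g' \<in> Arr C" "Dom C g' = B" "Cod C g' = D" "g = qc g'" "D \<in> \<X>"
    using Quot_Hom by metis
  then show "g \<cdot>\<^bsub>Quot\<^esub> f \<in> Hom Quot A D" by simp
next
  fix f g h A B D E assume "f \<in> Hom Quot A B" "g \<in> Hom Quot B D" "h \<in> Hom Quot D E"
  then obtain f' g' h' where "f' \<in> Arr C" "Dom C f' = A" "Cod C f' = B" "f = qc f'"
    "g' \<in> Arr C" "Dom C g' = B" "Cod C g' = D" "g = qc g'"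
    "h' \<in> Arr C" "Dom C h' = D" "Cod C h' = E" "h = qc h'"
    using Quot_Hom by metis
  then show "(h \<cdot>\<^bsub>Quot\<^esub> g) \<cdot>\<^bsub>Quot\<^esub> f = h \<cdot>\<^bsub>Quot\<^esub> (g \<cdot>\<^bsub>Quot\<^esub> f)" by simp
next
  fix f A B assume "f \<in> Hom Quot A B"
  then obtain f' where "f' \<in> Arr C" "Dom C f' = A" "Cod C f' = B" "f = qc f'" "A \<in> \<X>" "B \<in> \<X>"
    using Quot_Hom by metis
  then show "f \<cdot>\<^bsub>Quot\<^esub> Ident Quot A = f" "Ident Quot B \<cdot>\<^bsub>Quot\<^esub> f = f" by simp_all
qed

abbreviation "Wq \<equiv> Weq\<^sub>\<omega> C \<omega> \<Y>"

text \<open>Both \<open>(1, 0)\<close> and \<open>(1, u)\<close> are sections of the weak equivalence \<open>A \<oplus> W \<rightarrow> A\<close>, so they become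
  equal in the localization; \<open>g\<close> and \<open>f = g + v \<cdot> u\<close> are their composites with \<open>(g, v)\<close>.\<close>

lemma homot_zz_eq:
  assumes "f \<approx> g"
  shows "zz_eq C Wq (Dom C f) (Cod C f) [Fwd f] [Fwd g]"
proof -
  let ?A = "Dom C f"
  have fg: "f \<in> Arr C" "g \<in> Arr C" "Dom C g = ?A" "Cod C g = Cod C f"
    using homot_parallel[OF assms] by auto
  have "fac (f \<^bold>+ neg g)" using assms by (simp add: homot_def)
  then obtain u v where uv: "u \<in> Arr C" "v \<in> Arr C" "Cod C u = Dom C v" "Dom C v \<in> \<omega>" "Dom C u = ?A"
    "Cod C v = Cod C f" "v \<cdot> u = f \<^bold>+ neg g"
    using facE[of "f \<^bold>+ neg g"] fg by (metis Plus_simps(2,3) neg_simps)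
  obtain S jA jW pA pW where bi: "is_biproduct C S ?A (Dom C v) jA jW pA pW"
    using biproduct_exists[of ?A "Dom C v"] fg uv by auto
  note b = is_biproductD[OF bi]
  obtain s where s: "s \<in> Arr C" "Cod C s = S" "Dom C s = ?A" "pA \<cdot> s = Ident C ?A" "pW \<cdot> s = u"
    using biproduct_pair[OF bi, of "Ident C ?A" u ?A] b uv by (metis Ident_simps)
  obtain h where h: "h \<in> Arr C" "Dom C h = S" "Cod C h = Cod C f" "h \<cdot> jA = g" "h \<cdot> jW = v"
    using biproduct_copair[OF bi fg(2) uv(2) fg(3) refl fg(4) uv(6)] .
  have hs: "h \<cdot> s = f"
  proof -
    have "h \<cdot> s = h \<cdot> (jA \<cdot> (pA \<cdot> s) \<^bold>+ jW \<cdot> (pW \<cdot> s))"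
      using biproduct_decomp_left[OF bi s(1,2)] by simp
    also have "\<dots> = g \<^bold>+ v \<cdot> u"
      unfolding s(4,5) using h b uv(1-6) fg by (simp add: Comp_reassoc[OF h(5)])
    finally show ?thesis using fg uv(7) by (simp add: Plus_ac)
  qed
  have "Ydefl pA" unfolding Ydefl_def using biproduct_Conf'[OF bi] uv(4) b(8) by (intro exI[of _ jW]) simp
  then have pA: "pA \<in> Wq" by (rule Ydefl_Weq)
  \<comment> \<open>A section of an inverted arrow becomes its inverse: evaluate \<open>t\<close>,
    then \<open>pA\<close>, then \<open>pA\<close> backwards, in the two possible ways.\<close>
  have sec: "zz_eq C Wq ?A S [Fwd t] [Bwd pA]" if t: "t \<in> Arr C" "Dom C t = ?A" "Cod C t = S" "pA \<cdot> t = Ident C ?A" for t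
  proof -
    have 1: "zz_eq C Wq ?A S [Fwd t] [Fwd t]" using zz_Fwd[OF t(1)] t by simp
    have "zz_eq C Wq S S [Fwd pA, Bwd pA] []" using zz_inv_right[OF pA, of C S ?A] b by simp
    from zz_append[OF 1 this] have 2: "zz_eq C Wq ?A S [Fwd t, Fwd pA, Bwd pA] [Fwd t]" by simp
    have 3: "zz_eq C Wq ?A S [Bwd pA] [Bwd pA]" by (rule zz_refl) (use pA b in simp)
    have "zz_eq C Wq ?A ?A [Fwd t, Fwd pA] [Fwd (Ident C ?A)]"
      using zz_Comp[of t pA Wq] t b by simp
    then have "zz_eq C Wq ?A ?A [Fwd t, Fwd pA] []"
      by (rule zz_trans) (rule zz_ident, use fg in simp)
    from zz_append[OF this 3] have "zz_eq C Wq ?A S [Fwd t, Fwd pA, Bwd pA] [Bwd pA]" by simp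
    then show ?thesis using 2 zz_sym zz_trans by metis
  qed
  have sj: "zz_eq C Wq ?A S [Fwd s] [Fwd jA]"
    by (rule zz_trans[OF sec[OF s(1,3,2,4)] zz_sym[OF sec[OF b(4-6,16)]]])
  have "zz_eq C Wq S (Cod C f) [Fwd h] [Fwd h]" using zz_Fwd[OF h(1)] h by simp
  from zz_append[OF sj this]
  have 1: "zz_eq C Wq ?A (Cod C f) [Fwd s, Fwd h] [Fwd jA, Fwd h]" by simp
  have 2: "zz_eq C Wq ?A (Cod C f) [Fwd s, Fwd h] [Fwd f]" using zz_Comp[of s h Wq] s h hs by simp
  have 3: "zz_eq C Wq ?A (Cod C f) [Fwd jA, Fwd h] [Fwd g]" using zz_Comp[of jA h Wq] b h by simp
  show ?thesis by (rule zz_trans[OF zz_sym[OF 2] zz_trans[OF 1 3]])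
qed

lemma loc_map_homot:
  assumes "f \<approx> g"
  shows "loc_map C Wq f = loc_map C Wq g"
proof -
  note z = homot_zz_eq[OF assms]
  have "zz_class C Wq (Dom C f) [Fwd f] (Cod C f) = zz_class C Wq (Dom C f) [Fwd g] (Cod C f)"
    using zz_class_eq_iff zz_eq_zigzag[OF z] z by blast
  then show ?thesis using homot_parallel[OF assms] by (simp add: loc_map_def)
qed

end

section \<open>Cofibrant replacement and the equivalence of categories\<close>

context complete_hereditary_pair
begin

definition cov where "cov A = (SOME q. Ydefl q \<and> Dom C q \<in> \<X> \<and> Cod C q = A)"

abbreviation "Q A \<equiv> Dom C (cov A)"

lemma cov:
  assumes "A \<in> Obj C"
  shows "Ydefl (cov A)" "Q A \<in> \<X>" "Cod C (cov A) = A" "cov A \<in> Arr C" "wbij (cov A)"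
proof -
  have "\<exists>q. Ydefl q \<and> Dom C q \<in> \<X> \<and> Cod C q = A" using cover[OF assms] by metis
  then have *: "Ydefl (cov A) \<and> Dom C (cov A) \<in> \<X> \<and> Cod C (cov A) = A" unfolding cov_def by (rule someI_ex)
  then show "Ydefl (cov A)" "Q A \<in> \<X>" "Cod C (cov A) = A" "cov A \<in> Arr C" "wbij (cov A)"
    using Ydefl_Arr Ydefl_wbij by auto
qed

text \<open>Lifts of a step to the replacements, in the direction of traversal. For a backward step
  nothing is inverted: \<open>u\<close> solves an equation modulo \<open>\<omega>\<close> in which
  \<open>w\<close> and a cover stand on the left.\<close>

fun rep :: "'b zstep \<Rightarrow> 'b \<Rightarrow> bool" where
  "rep (Fwd f) u \<longleftrightarrow> u \<in> Arr C \<and> Dom C u = Q (Dom C f) \<and> Cod C u = Q (Cod C f) \<and>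
    cov (Cod C f) \<cdot> u \<approx> f \<cdot> cov (Dom C f)"
| "rep (Bwd w) u \<longleftrightarrow> u \<in> Arr C \<and> Dom C u = Q (Cod C w) \<and> Cod C u = Q (Dom C w) \<and>
    (w \<cdot> cov (Dom C w)) \<cdot> u \<approx> cov (Cod C w)"

definition srep where "srep s = (SOME u. rep s u)"

lemma wbij_cov_Comp: "wbij w \<Longrightarrow> wbij (w \<cdot> cov (Dom C w))"
  using wbij_Comp[OF cov(5)] cov(3) wbij_Arr by simp

lemma rep_srep:
  assumes "zstep_ok C Wq s"
  shows "rep s (srep s)"
proof -
  have "\<exists>u. rep s u"
  proof (cases s)
    case (Fwd f)
    then have f: "f \<in> Arr C" using assms by simp
    note a = cov[of "Dom C f"] and b = cov[of "Cod C f"]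
    let ?v = "f \<cdot> cov (Dom C f)"
    have v: "?v \<in> Arr C" "Dom C ?v = Q (Dom C f)" "Cod C ?v = Cod C f" using f a by simp_all
    obtain u where "u \<in> Arr C" "Dom C u = Dom C ?v" "Cod C u = Q (Cod C f)" "cov (Cod C f) \<cdot> u \<approx> ?v"
      using wbij_surj[OF b(5) v(1)] v a(2) b(3) f by (metis Cod_in_Obj Dom_in_Obj)
    then show ?thesis using Fwd v by auto
  next
    case (Bwd w)
    then have w: "w \<in> Arr C" "wbij w" using assms Weq_iff_wbij by auto
    note a = cov[of "Dom C w"] and b = cov[of "Cod C w"]
    let ?f = "w \<cdot> cov (Dom C w)"
    have v: "Dom C ?f = Q (Dom C w)" "Cod C ?f = Cod C w" using w a by simp_all
    obtain u where "u \<in> Arr C" "Dom C u = Q (Cod C w)" "Cod C u = Dom C ?f" "?f \<cdot> u \<approx> cov (Cod C w)"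
      using wbij_surj[OF wbij_cov_Comp[OF w(2)] b(4)] v b(2,3) w(1) by (metis Cod_in_Obj)
    then show ?thesis using Bwd v by auto
  qed
  then show ?thesis unfolding srep_def by (rule someI_ex)
qed

text \<open>The action of a zigzag on cofibrant replacements. It depends on the chosen lifts and
  respects the relations only modulo \<open>\<omega>\<close>.\<close>

fun ev where
  "ev A [] = Ident C (Q A)"
| "ev A (s # p) = ev (ztgt C s) p \<cdot> srep s"

lemma srep_Hom:
  assumes "zstep_ok C Wq s"
  shows "srep s \<in> Arr C" "Dom C (srep s) = Q (zsrc C s)" "Cod C (srep s) = Q (ztgt C s)"
  using rep_srep[OF assms] by (cases s; simp)+

lemma ev_Hom:
  assumes "zigzag C Wq A p B"
  shows "ev A p \<in> Arr C \<and> Dom C (ev A p) = Q A \<and> Cod C (ev A p) = Q B"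
  using assms
proof (induction p arbitrary: A)
  case Nil
  then have "A \<in> Obj C" "A = B" by auto
  then show ?case using cov(2)[of A] by simp
next
  case (Cons s p)
  then show ?case using srep_Hom[of s] by auto
qed

lemma ev_append:
  assumes "zigzag C Wq A p B" "zigzag C Wq B q D"
  shows "ev A (p @ q) = ev B q \<cdot> ev A p"
  using assms(1)
proof (induction p arbitrary: A)
  case Nil
  then show ?case using ev_Hom[OF assms(2)] by auto
next
  case (Cons s p)
  then have "zigzag C Wq (ztgt C s) p B" "zstep_ok C Wq s" by auto
  then show ?case using Cons.IH srep_Hom[of s] ev_Hom[of "ztgt C s" p B] ev_Hom[OF assms(2)] by simp
qed

text \<open>Both lifts have the same composite with a cover modulo \<open>\<omega>\<close>, and
  covers are injective modulo \<open>\<omega>\<close> on arrows from \<open>\<X>\<close>.\<close>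

lemma rep_unique:
  assumes "f \<in> Arr C" "rep (Fwd f) u" "rep (Fwd f) v"
  shows "u \<approx> v"
proof -
  have O: "Dom C f \<in> Obj C" "Cod C f \<in> Obj C" using assms(1) by auto
  have "cov (Cod C f) \<cdot> u \<approx> f \<cdot> cov (Dom C f)" "cov (Cod C f) \<cdot> v \<approx> f \<cdot> cov (Dom C f)"
    using assms by auto
  then have "cov (Cod C f) \<cdot> u \<approx> cov (Cod C f) \<cdot> v" using homot_sym homot_trans by blast
  then show ?thesis
    by (rule wbij_cancel[OF cov(5)[OF O(2)]]) (use assms(2,3) cov(2)[OF O(1)] in simp_all)
qed

text \<open>Each generating relation compares two lifts of the same data. Identities and composites
  are settled by \<open>rep_unique\<close>; an arrow traversed forth and back is settled by
  cancelling a cover, or a cover followed by \<open>w\<close>, both of which are bijective modulo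
  \<open>\<omega>\<close>.\<close>

lemma ev_zz_eq: "zz_eq C Wq A B p q \<Longrightarrow> ev A p \<approx> ev A q"
proof (induction rule: zz_eq.induct)
  case (zz_refl A p B)
  then show ?case using ev_Hom by simp
next
  case (zz_append A B p q D r s)
  have z: "zigzag C Wq A p B" "zigzag C Wq A q B" "zigzag C Wq B r D" "zigzag C Wq B s D"
    using zz_eq_zigzag[OF zz_append.hyps(1)] zz_eq_zigzag[OF zz_append.hyps(2)] by auto
  have "ev B r \<cdot> ev A p \<approx> ev B s \<cdot> ev A q"
    by (rule homot_Comp[OF zz_append.IH]) (use ev_Hom[OF z(1)] ev_Hom[OF z(3)] in simp)
  then show ?case using ev_append z by simp
next
  case (zz_ident A)
  note a = cov[OF zz_ident]
  have "rep (Fwd (Ident C A)) (srep (Fwd (Ident C A)))" by (rule rep_srep) (use zz_ident in simp)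
  moreover have "rep (Fwd (Ident C A)) (Ident C (Q A))" using zz_ident a by simp
  ultimately have "srep (Fwd (Ident C A)) \<approx> Ident C (Q A)" by (rule rep_unique[rotated]) (use zz_ident in simp)
  then show ?case using zz_ident a homot_parallel by force
next
  case (zz_comp f A B g D)
  then have f: "f \<in> Arr C" "Dom C f = A" "Cod C f = B" and g: "g \<in> Arr C" "Dom C g = B" "Cod C g = D" by auto
  note c = cov[of A] cov[of B] cov[of D]
  have O: "A \<in> Obj C" "B \<in> Obj C" "D \<in> Obj C" using f g by auto
  let ?u = "srep (Fwd f)" and ?v = "srep (Fwd g)"
  have u: "?u \<in> Arr C" "Dom C ?u = Q A" "Cod C ?u = Q B" "cov B \<cdot> ?u \<approx> f \<cdot> cov A"
    using rep_srep[of "Fwd f"] f by auto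
  have v: "?v \<in> Arr C" "Dom C ?v = Q B" "Cod C ?v = Q D" "cov D \<cdot> ?v \<approx> g \<cdot> cov B"
    using rep_srep[of "Fwd g"] g by auto
  have "(cov D \<cdot> ?v) \<cdot> ?u \<approx> (g \<cdot> cov B) \<cdot> ?u" by (rule homot_Comp_right[OF v(4)]) (use u g c O in auto)
  then have "cov D \<cdot> (?v \<cdot> ?u) \<approx> g \<cdot> (cov B \<cdot> ?u)" using u v g c O by simp
  also have "g \<cdot> (cov B \<cdot> ?u) \<approx> g \<cdot> (f \<cdot> cov A)" by (rule homot_Comp_left[OF u(4)]) (use f g c O in auto)
  finally have "rep (Fwd (g \<cdot> f)) (?v \<cdot> ?u)" using u v f g c O by simp
  moreover have "rep (Fwd (g \<cdot> f)) (srep (Fwd (g \<cdot> f)))" by (rule rep_srep) (use f g in simp)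
  ultimately have "?v \<cdot> ?u \<approx> srep (Fwd (g \<cdot> f))" by (rule rep_unique[rotated]) (use f g in simp)
  then show ?case using u v f g homot_parallel[of "?v \<cdot> ?u"] c O by simp
next
  case (zz_inv_right w A B)
  then have w: "w \<in> Arr C" "Dom C w = A" "Cod C w = B" "wbij w" using Weq_iff_wbij by auto
  have O: "A \<in> Obj C" "B \<in> Obj C" using w by auto
  note c = cov[OF O(1)] cov[OF O(2)]
  let ?u = "srep (Fwd w)" and ?v = "srep (Bwd w)"
  have u: "?u \<in> Arr C" "Dom C ?u = Q A" "Cod C ?u = Q B" "cov B \<cdot> ?u \<approx> w \<cdot> cov A"
    using rep_srep[of "Fwd w"] w by auto
  have v: "?v \<in> Arr C" "Dom C ?v = Q B" "Cod C ?v = Q A" "(w \<cdot> cov A) \<cdot> ?v \<approx> cov B"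
    using rep_srep[of "Bwd w"] w zz_inv_right by auto
  have "((w \<cdot> cov A) \<cdot> ?v) \<cdot> ?u \<approx> cov B \<cdot> ?u" by (rule homot_Comp_right[OF v(4)]) (use u c in auto)
  also note u(4)
  finally have "(w \<cdot> cov A) \<cdot> (?v \<cdot> ?u) \<approx> (w \<cdot> cov A) \<cdot> Ident C (Q A)" using u v w c by simp
  then have "?v \<cdot> ?u \<approx> Ident C (Q A)"
    by (rule wbij_cancel[OF wbij_cov_Comp[OF w(4), unfolded w(2)]]) (use u v w c in simp_all)
  then show ?case using u v w c by simp
next
  case (zz_inv_left w A B)
  then have w: "w \<in> Arr C" "Dom C w = A" "Cod C w = B" "wbij w" using Weq_iff_wbij by auto
  have O: "A \<in> Obj C" "B \<in> Obj C" using w by auto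
  note c = cov[OF O(1)] cov[OF O(2)]
  let ?u = "srep (Fwd w)" and ?v = "srep (Bwd w)"
  have u: "?u \<in> Arr C" "Dom C ?u = Q A" "Cod C ?u = Q B" "cov B \<cdot> ?u \<approx> w \<cdot> cov A"
    using rep_srep[of "Fwd w"] w by auto
  have v: "?v \<in> Arr C" "Dom C ?v = Q B" "Cod C ?v = Q A" "(w \<cdot> cov A) \<cdot> ?v \<approx> cov B"
    using rep_srep[of "Bwd w"] w zz_inv_left by auto
  have "(cov B \<cdot> ?u) \<cdot> ?v \<approx> (w \<cdot> cov A) \<cdot> ?v" by (rule homot_Comp_right[OF u(4)]) (use v w c in auto)
  also note v(4)
  finally have "cov B \<cdot> (?u \<cdot> ?v) \<approx> cov B \<cdot> Ident C (Q B)" using u v w c by simp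
  then have "?u \<cdot> ?v \<approx> Ident C (Q B)"
    by (rule wbij_cancel[OF c(10)]) (use u v w c in simp_all)
  then show ?case using u v w c by simp
qed (auto intro: homot_sym homot_trans)

text \<open>A lifted forward step commutes with the covers modulo \<open>\<omega>\<close>, a
  difference that the localization does not see. For a backward step the defining equation still
  contains \<open>w\<close>, and appending \<open>w\<close> backwards removes it.\<close>

lemma srep_natural:
  assumes "zstep_ok C Wq s"
  shows "zz_eq C Wq (Q (zsrc C s)) (ztgt C s) [Fwd (cov (zsrc C s)), s] [Fwd (srep s), Fwd (cov (ztgt C s))]"
proof (cases s)
  case (Fwd f)
  let ?A = "Dom C f" and ?B = "Cod C f"
  have f: "f \<in> Arr C" using assms Fwd by simp
  then have O: "?A \<in> Obj C" "?B \<in> Obj C" by auto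
  note c = cov[OF O(1)] cov[OF O(2)]
  have u: "srep s \<in> Arr C" "Dom C (srep s) = Q ?A" "Cod C (srep s) = Q ?B" "cov ?B \<cdot> srep s \<approx> f \<cdot> cov ?A"
    using rep_srep[OF assms] Fwd by auto
  have 1: "zz_eq C Wq (Q ?A) ?B [Fwd (cov ?A), Fwd f] [Fwd (f \<cdot> cov ?A)]"
    using zz_Comp[of "cov ?A" f Wq] f c by simp
  have 2: "zz_eq C Wq (Q ?A) ?B [Fwd (cov ?B \<cdot> srep s)] [Fwd (f \<cdot> cov ?A)]"
    using homot_zz_eq[OF u(4)] u c by simp
  have 3: "zz_eq C Wq (Q ?A) ?B [Fwd (srep s), Fwd (cov ?B)] [Fwd (cov ?B \<cdot> srep s)]"
    using zz_Comp[of "srep s" "cov ?B" Wq] u c by simp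
  show ?thesis using Fwd zz_trans[OF 1 zz_trans[OF zz_sym[OF 2] zz_sym[OF 3]]] by simp
next
  case (Bwd w)
  let ?A = "Dom C w" and ?B = "Cod C w"
  have w: "w \<in> Arr C" "w \<in> Wq" using assms Bwd by simp_all
  then have O: "?A \<in> Obj C" "?B \<in> Obj C" by auto
  note c = cov[OF O(1)] cov[OF O(2)]
  have u: "srep s \<in> Arr C" "Dom C (srep s) = Q ?B" "Cod C (srep s) = Q ?A" "(w \<cdot> cov ?A) \<cdot> srep s \<approx> cov ?B"
    using rep_srep[OF assms] Bwd by auto
  have uc: "zz_eq C Wq (Q ?B) ?A [Fwd (srep s), Fwd (cov ?A)] [Fwd (cov ?A \<cdot> srep s)]"
    using zz_Comp[of "srep s" "cov ?A" Wq] u c by simp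
  have ww: "zz_eq C Wq ?A ?A [Fwd w, Bwd w] []" by (rule zz_inv_right[OF w(2)]) (use w in simp)
  have bw: "zz_eq C Wq ?B ?A [Bwd w] [Bwd w]" by (rule zz_refl) (use w in simp)
  have "zz_eq C Wq (Q ?B) ?B [Fwd (cov ?A \<cdot> srep s), Fwd w] [Fwd ((w \<cdot> cov ?A) \<cdot> srep s)]"
    using zz_Comp[of "cov ?A \<cdot> srep s" w Wq] u c w by simp
  also have "zz_eq C Wq (Q ?B) ?B [Fwd ((w \<cdot> cov ?A) \<cdot> srep s)] [Fwd (cov ?B)]"
    using homot_zz_eq[OF u(4)] u(1-3) c w by simp
  finally (zz_trans) have "zz_eq C Wq (Q ?B) ?B [Fwd (cov ?A \<cdot> srep s), Fwd w] [Fwd (cov ?B)]" .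
  from zz_append[OF this bw]
  have 1: "zz_eq C Wq (Q ?B) ?A [Fwd (cov ?A \<cdot> srep s), Fwd w, Bwd w] [Fwd (cov ?B), Bwd w]" by simp
  have "zz_eq C Wq (Q ?B) ?A [Fwd (cov ?A \<cdot> srep s)] [Fwd (cov ?A \<cdot> srep s)]"
    using zz_Fwd[of "cov ?A \<cdot> srep s" Wq] u c by simp
  from zz_append[OF this ww]
  have 2: "zz_eq C Wq (Q ?B) ?A [Fwd (cov ?A \<cdot> srep s), Fwd w, Bwd w] [Fwd (cov ?A \<cdot> srep s)]" by simp
  show ?thesis using Bwd zz_trans[OF zz_sym[OF 1] zz_trans[OF 2 zz_sym[OF uc]]] by simp
qed

text \<open>Pasting the squares of the single steps makes the covers natural with respect to all
  morphisms of the localization.\<close>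

lemma ev_natural:
  "zigzag C Wq A p B \<Longrightarrow> zz_eq C Wq (Q A) B (Fwd (cov A) # p) [Fwd (ev A p), Fwd (cov B)]"
proof (induction p arbitrary: A)
  case Nil
  then have A: "A \<in> Obj C" "A = B" by auto
  have "zz_eq C Wq (Q A) A [Fwd (Ident C (Q A)), Fwd (cov A)] [Fwd (cov A)]"
    using zz_Comp[of "Ident C (Q A)" "cov A" Wq] cov[OF A(1)] by simp
  then show ?case using A zz_sym by simp
next
  case (Cons s p)
  let ?T = "ztgt C s"
  have s: "zstep_ok C Wq s" "zsrc C s = A" and p: "zigzag C Wq ?T p B" using Cons.prems by auto
  note r = srep_Hom[OF s(1)] and e = ev_Hom[OF p]
  have O: "B \<in> Obj C" using zigzag_Obj[OF p] by simp
  note c = cov[OF O]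
  have 1: "zz_eq C Wq (Q A) B ([Fwd (cov A), s] @ p) ([Fwd (srep s), Fwd (cov ?T)] @ p)"
    using srep_natural[OF s(1)] s(2) by (intro zz_append[OF _ zz_refl[OF p]]) simp
  have 2: "zz_eq C Wq (Q A) B ([Fwd (srep s)] @ (Fwd (cov ?T) # p)) ([Fwd (srep s)] @ [Fwd (ev ?T p), Fwd (cov B)])"
    using zz_Fwd[OF r(1), of Wq] r s(2) by (intro zz_append[OF _ Cons.IH[OF p]]) simp
  have 3: "zz_eq C Wq (Q A) B ([Fwd (srep s), Fwd (ev ?T p)] @ [Fwd (cov B)]) ([Fwd (ev ?T p \<cdot> srep s)] @ [Fwd (cov B)])"
  proof (rule zz_append)
    show "zz_eq C Wq (Q A) (Q B) [Fwd (srep s), Fwd (ev ?T p)] [Fwd (ev ?T p \<cdot> srep s)]"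
      using zz_Comp[of "srep s" "ev ?T p" Wq] r e s(2) by simp
    show "zz_eq C Wq (Q B) B [Fwd (cov B)] [Fwd (cov B)]" using zz_Fwd[OF c(4), of Wq] c by simp
  qed
  show ?case using zz_trans[OF 1[simplified] zz_trans[OF 2[simplified] 3[simplified]]] by simp
qed

lemma loc_map_class: "f \<in> Arr C \<Longrightarrow> zigzag C Wq (Dom C f) [Fwd f] (Cod C f)"
  by simp

lemma equivalent_homotopy_category: "equivalent_categories (homotopy_category C Wq) Quot"
proof -
  let ?L = "localization C Wq"
  \<comment> \<open>Both functors evaluate an arbitrary representative. Independence of the choice
    is \<open>ev_zz_eq\<close> for zigzags and \<open>loc_map_homot\<close> for cosets.\<close>
  define Fa where "Fa = (\<lambda>(A, P, B :: 'a). qc (ev A (SOME p. p \<in> P)))"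
  define Ga where "Ga = (\<lambda>\<Phi>. loc_map C Wq (SOME f. f \<in> \<Phi>))"
  have Fa: "Fa (zz_class C Wq A p B) = qc (ev A p)" if "zigzag C Wq A p B" for A p B
  proof -
    have "zz_eq C Wq A B p (SOME q. zz_eq C Wq A B p q)" using zz_refl[OF that] by (rule someI)
    then have "ev A p \<approx> ev A (SOME q. zz_eq C Wq A B p q)" by (rule ev_zz_eq)
    then have "qc (ev A (SOME q. zz_eq C Wq A B p q)) = qc (ev A p)"
      using qc_eq_iff homot_parallel homot_sym by metis
    then show ?thesis by (simp add: Fa_def zz_class_def)
  qed
  have Ga: "Ga (qc f) = loc_map C Wq f" if "f \<in> Arr C" for f
    using loc_map_homot[OF qc_some[OF that]] by (simp add: Ga_def)
  have F: "is_functor ?L Quot Q Fa"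
    unfolding is_functor_def
  proof (intro conjI ballI impI)
    fix A B \<Phi> assume "\<Phi> \<in> Hom ?L A B"
    then obtain p where p: "zigzag C Wq A p B" "\<Phi> = zz_class C Wq A p B" using loc_Hom by metis
    then show "Fa \<Phi> \<in> Hom Quot (Q A) (Q B)" using Fa ev_Hom[OF p(1)] zigzag_Obj[OF p(1)] cov by simp
  next
    fix \<Phi> \<Psi> assume "\<Phi> \<in> Arr ?L" "\<Psi> \<in> Arr ?L" "Cod ?L \<Phi> = Dom ?L \<Psi>"
    then obtain A p B q D where p: "zigzag C Wq A p B" "\<Phi> = zz_class C Wq A p B"
      and q: "zigzag C Wq B q D" "\<Psi> = zz_class C Wq B q D"
      by (auto simp: loc_Arr)
    then show "Fa (\<Psi> \<cdot>\<^bsub>?L\<^esub> \<Phi>) = Fa \<Psi> \<cdot>\<^bsub>Quot\<^esub> Fa \<Phi>"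
      using Fa zigzag_append[OF p(1) q(1)] ev_append[OF p(1) q(1)] ev_Hom[OF p(1)] ev_Hom[OF q(1)] by simp
  qed (use Fa cov in auto)
  have G: "is_functor Quot ?L id Ga"
    unfolding is_functor_def
  proof (intro conjI ballI impI)
    fix A assume "A \<in> Obj Quot"
    then have A: "A \<in> Obj C" by simp
    have "zz_class C Wq A [Fwd (Ident C A)] A = zz_class C Wq A [] A"
      using zz_ident[OF A, of Wq] zz_class_eq_iff zz_eq_zigzag by blast
    then show "Ga (Ident Quot A) = Ident ?L (id A)" using Ga A by (simp add: loc_map_def)
  next
    fix A B F assume "F \<in> Hom Quot A B"
    then obtain f where "f \<in> Arr C" "Dom C f = A" "Cod C f = B" "F = qc f" using Quot_Hom by metis
    then show "Ga F \<in> Hom ?L (id A) (id B)" using Ga by (auto simp: loc_map_def)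
  next
    fix F G assume "F \<in> Arr Quot" "G \<in> Arr Quot" "Cod Quot F = Dom Quot G"
    then obtain f g where fg: "f \<in> Arr C" "F = qc f" "g \<in> Arr C" "G = qc g" "Cod C f = Dom C g"
      by (auto simp: Quot_Arr)
    have "zz_class C Wq (Dom C f) [Fwd f, Fwd g] (Cod C g) = zz_class C Wq (Dom C f) [Fwd (g \<cdot> f)] (Cod C g)"
      using zz_Comp[OF fg(1,3,5), of Wq] zz_class_eq_iff zz_eq_zigzag by blast
    then show "Ga (G \<cdot>\<^bsub>Quot\<^esub> F) = Ga G \<cdot>\<^bsub>?L\<^esub> Ga F"
      using fg Ga loc_Comp[OF loc_map_class[OF fg(1), unfolded fg(5)] loc_map_class[OF fg(3)]]
      by (simp add: loc_map_def)
  qed auto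
  \<comment> \<open>In the localization the covers are invertible because they are weak
    equivalences, and their naturality is \<open>ev_natural\<close>.\<close>
  have GF: "naturally_isomorphic ?L ?L (id \<circ> Q) (Ga \<circ> Fa) id id"
    unfolding naturally_isomorphic_def
  proof (intro exI[of _ "\<lambda>A. loc_map C Wq (cov A)"] conjI ballI)
    fix A assume "A \<in> Obj ?L"
    then have A: "A \<in> Obj C" by simp
    note c = cov[OF A]
    show "loc_map C Wq (cov A) \<in> Hom ?L ((id \<circ> Q) A) (id A)" using c A by (simp add: loc_map_def)
    show "is_iso ?L (loc_map C Wq (cov A))" by (rule loc_map_iso) (use c Weq_iff_wbij in auto)
  next
    fix \<Phi> assume "\<Phi> \<in> Arr ?L"
    then obtain A p B where p: "zigzag C Wq A p B" "\<Phi> = zz_class C Wq A p B" by (auto simp: loc_Arr)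
    note O = zigzag_Obj[OF p(1)] and e = ev_Hom[OF p(1)]
    note a = cov[OF conjunct1[OF O]] and b = cov[OF conjunct2[OF O]]
    have z: "zigzag C Wq (Q A) [Fwd (ev A p)] (Q B)" "zigzag C Wq (Q B) [Fwd (cov B)] B"
      "zigzag C Wq (Q A) [Fwd (cov A)] A" using a b e O by simp_all
    have "zz_class C Wq (Q A) (Fwd (cov A) # p) B = zz_class C Wq (Q A) [Fwd (ev A p), Fwd (cov B)] B"
      using ev_natural[OF p(1)] zz_class_eq_iff zz_eq_zigzag by blast
    then show "loc_map C Wq (cov (Cod ?L \<Phi>)) \<cdot>\<^bsub>?L\<^esub> (Ga \<circ> Fa) \<Phi> = id \<Phi> \<cdot>\<^bsub>?L\<^esub> loc_map C Wq (cov (Dom ?L \<Phi>))"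
      using p Fa Ga e a b loc_Comp[OF z(1,2)] loc_Comp[OF z(3) p(1)] by (simp add: loc_map_def)
  qed
  have FG: "naturally_isomorphic Quot Quot (Q \<circ> id) (Fa \<circ> Ga) id id"
    unfolding naturally_isomorphic_def
  proof (intro exI[of _ "\<lambda>A. qc (cov A)"] conjI ballI)
    fix A assume "A \<in> Obj Quot"
    then have A: "A \<in> Obj C" "A \<in> \<X>" by simp_all
    note c = cov[OF A(1)]
    show "qc (cov A) \<in> Hom Quot ((Q \<circ> id) A) (id A)" using c A by simp
    \<comment> \<open>In the quotient the covers are invertible because \<open>A\<close> itself lies
      in \<open>\<X>\<close>: surjectivity at the identity of \<open>A\<close> gives a right inverse
      \<open>u\<close> modulo \<open>\<omega>\<close>, and cancelling \<open>cov A\<close> shows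
      that \<open>u\<close> is a left inverse as well.\<close>
    obtain u where u: "u \<in> Arr C" "Dom C u = A" "Cod C u = Q A" "cov A \<cdot> u \<approx> Ident C A"
      using wbij_surj[OF c(5), of "Ident C A"] A c by auto
    have "(cov A \<cdot> u) \<cdot> cov A \<approx> Ident C A \<cdot> cov A" by (rule homot_Comp_right[OF u(4)]) (use c A in auto)
    then have "cov A \<cdot> (u \<cdot> cov A) \<approx> cov A \<cdot> Ident C (Q A)" using u c A by simp
    then have "u \<cdot> cov A \<approx> Ident C (Q A)"
      by (rule wbij_cancel[OF c(5)]) (use u c in simp_all)
    then have "qc (u \<cdot> cov A) = qc (Ident C (Q A))" "qc (cov A \<cdot> u) = qc (Ident C A)"
      using u(4) homot_parallel qc_eq_iff by blast+
    then show "is_iso Quot (qc (cov A))"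
      unfolding is_iso_def using u(1-3) c A by (intro conjI bexI[of _ "qc u"]) simp_all
  next
    fix F assume "F \<in> Arr Quot"
    then obtain f where f: "f \<in> Arr C" "Dom C f \<in> \<X>" "Cod C f \<in> \<X>" "F = qc f" by (auto simp: Quot_Arr)
    note a = cov[of "Dom C f"] and b = cov[of "Cod C f"]
    have s: "srep (Fwd f) \<in> Arr C" "Dom C (srep (Fwd f)) = Q (Dom C f)" "Cod C (srep (Fwd f)) = Q (Cod C f)"
      "cov (Cod C f) \<cdot> srep (Fwd f) \<approx> f \<cdot> cov (Dom C f)"
      using rep_srep[of "Fwd f"] f by auto
    have "Fa (Ga F) = qc (srep (Fwd f))"
      using f Ga Fa[OF loc_map_class[OF f(1)]] s b by (simp add: loc_map_def)
    moreover have "qc (cov (Cod C f) \<cdot> srep (Fwd f)) = qc (f \<cdot> cov (Dom C f))"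
      using s(4) homot_parallel qc_eq_iff by blast
    ultimately show "qc (cov (Cod Quot F)) \<cdot>\<^bsub>Quot\<^esub> (Fa \<circ> Ga) F = id F \<cdot>\<^bsub>Quot\<^esub> qc (cov (Dom Quot F))"
      using f s(1-3) a b by simp
  qed
  show ?thesis
    unfolding equivalent_categories_def homotopy_category_def
    using category_localization category_Quot F G GF FG by blast
qed

end

text \<open>\<open>Ext1_zero_iff\<close> translates the two perpendicular classes into splitting
  statements, and the ends of a conflation meet in its middle object, so \<open>Cod C i\<close> and
  \<open>Dom C d\<close> may be exchanged.\<close>

lemma (in subcat_pair) hereditary_complete_cotorsion_pair_iff:
  "hereditary_complete_cotorsion_pair C \<X> \<Y> \<longleftrightarrow> complete_hereditary_pair C \<X> \<Y>"
proof
  assume "hereditary_complete_cotorsion_pair C \<X> \<Y>"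
  then have X: "\<X> = left_perp C \<Y>" and Y: "\<Y> = right_perp C \<X>"
    and cp: "complete_pair C \<X> \<Y>" and hp: "hereditary_pair C \<X> \<Y>"
    unfolding hereditary_complete_cotorsion_pair_def cotorsion_pair_def by blast+
  show "complete_hereditary_pair C \<X> \<Y>"
  proof unfold_locales
    fix A B assume AB: "A \<in> \<X>" "B \<in> \<Y>"
    then have "A \<in> left_perp C \<Y>" using X by blast
    then have "Ext1_zero C A B" using AB(2) by (simp add: left_perp_def)
    then show "ext_vanish A B" using Ext1_zero_iff AB by simp
  next
    fix Z assume "Z \<in> Obj C" "\<And>B. B \<in> \<Y> \<Longrightarrow> ext_vanish Z B"
    then have "Z \<in> left_perp C \<Y>" using Ext1_zero_iff by (simp add: left_perp_def)
    then show "Z \<in> \<X>" using X by simp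
  next
    fix Z assume "Z \<in> Obj C" "\<And>B. B \<in> \<X> \<Longrightarrow> ext_vanish B Z"
    then have "Z \<in> right_perp C \<X>" using Ext1_zero_iff by (simp add: right_perp_def)
    then show "Z \<in> \<Y>" using Y by simp
  next
    fix A assume "A \<in> Obj C"
    then show "\<exists>i d. (i, d) \<in> Conf C \<and> Dom C i \<in> \<Y> \<and> Dom C d \<in> \<X> \<and> Cod C d = A"
      "\<exists>i d. (i, d) \<in> Conf C \<and> Dom C i = A \<and> Dom C d \<in> \<Y> \<and> Cod C d \<in> \<X>"
      using cp confD(3) unfolding complete_pair_def by (fastforce, fastforce)
  next
    fix i d assume id: "(i, d) \<in> Conf C"
    show "Dom C d \<in> \<X> \<Longrightarrow> Cod C d \<in> \<X> \<Longrightarrow> Dom C i \<in> \<X>"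
      "Dom C i \<in> \<Y> \<Longrightarrow> Dom C d \<in> \<Y> \<Longrightarrow> Cod C d \<in> \<Y>"
      using hp id confD(3)[OF id] unfolding hereditary_pair_def by auto
  qed
next
  assume "complete_hereditary_pair C \<X> \<Y>"
  then interpret complete_hereditary_pair C \<X> \<Y> .
  have "Z \<in> \<X> \<longleftrightarrow> Z \<in> left_perp C \<Y>" for Z
    unfolding left_perp_def using X_perp[of Z] orth[of Z] Ext1_zero_iff[of Z] by auto
  then have "\<X> = left_perp C \<Y>" by blast
  moreover have "Z \<in> \<Y> \<longleftrightarrow> Z \<in> right_perp C \<X>" for Z
    unfolding right_perp_def using Y_perp[of Z] orth[of _ Z] Ext1_zero_iff[of _ Z] by auto
  then have "\<Y> = right_perp C \<X>" by blast
  moreover have "complete_pair C \<X> \<Y>"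
    unfolding complete_pair_def using X_cover Y_envelope confD(3) by fastforce
  moreover have "hereditary_pair C \<X> \<Y>"
    unfolding hereditary_pair_def using X_resolving Y_coresolving confD(3) by fastforce
  moreover have "\<X> \<subseteq> Obj C" "\<Y> \<subseteq> Obj C" by auto
  ultimately show "hereditary_complete_cotorsion_pair C \<X> \<Y>"
    by (simp add: hereditary_complete_cotorsion_pair_def cotorsion_pair_def)
qed

theorem theorem1p1:
  fixes A :: "('o, 'm) exact_cat" and \<X> \<Y> \<omega> :: "'o set" and CoFib Fib Weq :: "'m set"
  assumes "exact_category A" and "weakly_idempotent_complete A"
    and "additive_subcat A \<X>" and "iso_closed A \<X>" and "summand_closed A \<X>"
    and "additive_subcat A \<Y>" and "iso_closed A \<Y>" and "summand_closed A \<Y>"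
    and "\<omega> = \<X> \<inter> \<Y>"
    and "CoFib = CoFib\<^sub>\<omega> A \<X>" and "Fib = Fib\<^sub>\<omega> A \<omega>" and "Weq = Weq\<^sub>\<omega> A \<omega> \<Y>"
  shows "(model_structure A CoFib Fib Weq \<longleftrightarrow>
      hereditary_complete_cotorsion_pair A \<X> \<Y> \<and> contravariantly_finite A \<omega>) \<and>
    (model_structure A CoFib Fib Weq \<longrightarrow>
      CoFib \<inter> Weq = {f. split_mono A f \<and> Coker_in A f \<omega>} \<and>
      Fib \<inter> Weq = {f. deflation A f \<and> Ker_in A f \<Y>} \<and>
      cofibrant_objs A CoFib = \<X> \<and>
      fibrant_objs A Fib = Obj A \<and>
      trivial_objs A Weq = \<Y> \<and>
      equivalent_categories (homotopy_category A Weq) (additive_quotient A \<X> \<omega>))"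
proof -
  interpret subcat_pair A \<X> \<Y>
    using assms(1-8)
    by (intro subcat_pair.intro wic_exact.intro wic_exact_axioms.intro subcat_pair_axioms.intro)
  have \<omega>: "\<X> \<inter> \<Y> = \<omega>" by (simp add: assms(9))
  have model_pair: "model_pair A \<X> \<Y>" if "model_structure A CoFib Fib Weq"
    using that assms(9-12)
    by (intro model_pair.intro model_pair_axioms.intro subcat_pair_axioms) simp
  have "model_structure A CoFib Fib Weq \<longleftrightarrow>
      hereditary_complete_cotorsion_pair A \<X> \<Y> \<and> contravariantly_finite A \<omega>"
  proof
    assume "model_structure A CoFib Fib Weq"
    then interpret model_pair A \<X> \<Y> by (rule model_pair)
    show "hereditary_complete_cotorsion_pair A \<X> \<Y> \<and> contravariantly_finite A \<omega>"
      using hereditary_complete_cotorsion_pair_iff complete_hereditary_pair_axioms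
        model_contravariantly_finite \<omega> by simp
  next
    assume *: "hereditary_complete_cotorsion_pair A \<X> \<Y> \<and> contravariantly_finite A \<omega>"
    then interpret complete_hereditary_pair A \<X> \<Y> using hereditary_complete_cotorsion_pair_iff by simp
    show "model_structure A CoFib Fib Weq"
      using model_structure * \<omega> assms(10-12) by simp
  qed
  moreover have "CoFib \<inter> Weq = {f. split_mono A f \<and> Coker_in A f \<omega>} \<and>
      Fib \<inter> Weq = {f. deflation A f \<and> Ker_in A f \<Y>} \<and>
      cofibrant_objs A CoFib = \<X> \<and> fibrant_objs A Fib = Obj A \<and> trivial_objs A Weq = \<Y> \<and>
      equivalent_categories (homotopy_category A Weq) (additive_quotient A \<X> \<omega>)"
    if m: "model_structure A CoFib Fib Weq"
  proof -
    interpret model_pair A \<X> \<Y> using m by (rule model_pair)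
    show ?thesis
      using CoFib_Int_Weq Fib_Int_Weq cofibrant_objs_eq fibrant_objs_eq trivial_objs_eq
        equivalent_homotopy_category \<omega> assms(10-12) by (simp add: Ydefl_iff)
  qed
  ultimately show ?thesis by blast
qed

end
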